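(* Assume that $\langle\mathcal L r,r\rangle\ge\lambda\|r\|^2$ for all $r\in H^1_0(\Omega)$, where $\lambda\ge0$ is some constant. Suppose that a unique solution $u$ of $$\sum_{i=1}^\ell q_i(t)D_t^{\alpha_i}u(x,t)+\mathcal L u(x,t)=f(x,t)\ \text{ in }\Omega\times(0,T],\quad u(\cdot,0)=u_0\text{ in }\Omega,\quad u=0\text{ on }\partial\Omega\times(0,T],$$ and its approximation $u_h$ are in $C([0,T];L_2(\Omega))\cap W^{1,\infty}(\epsilon,T;L_2(\Omega))$ for each $\epsilon\in(0,T]$, and also in $H^1_0(\Omega)$ for each $t>0$. Let $R_h(\cdot,t):=\bigl(\sum_{i=1}^\ell q_i(t)D_t^{\alpha_i}+\mathcal L\bigr)u_h(\cdot,t)-f(\cdot,t)$. Then, for $t\in(0,T]$, $$\|(u_h-u)(\cdot,t)\|\le\sup_{0<s\le t}\left\{\frac{\|R_h(\cdot,s)\|}{\mathcal R_0(s)}\right\},\qquad\text{where}\quad \mathcal R_0(t):=\lambda+\sum_{i=j}^\ell\frac{q_i(t)\,t^{-\alpha_i}}{\Gamma(1-\alpha_i)},$$ with $j=1$ if $\alpha_1<1$ and $j=2$ if $\alpha_1=1$.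
   Context: $\Omega\subset\mathbb R^d$, $d\in\{1,2,3\}$, is a bounded Lipschitz domain; $T>0$; $\mathcal L$ is a spatial linear second-order elliptic operator; $\|\cdot\|$ and $\langle\cdot,\cdot\rangle$ are the norm and inner product of $L_2(\Omega)$. $\ell$ is a positive integer; $0<\alpha_\ell<\dots<\alpha_1\le1$ are constants; $q_i\in C[0,T]$ with $q_i\ge0$ and $\sum_{i=1}^\ell q_i(t)>0$ on $[0,T]$. For $\alpha_i<1$ and $0<t\le T$, $$\Gamma(1-\alpha_i)\,D_t^{\alpha_i}y(\cdot,t)=t^{-\alpha_i}[y(\cdot,t)-y(\cdot,0)]+\int_0^t\alpha_i(t-s)^{-\alpha_i-1}[y(\cdot,t)-y(\cdot,s)]\,ds,$$ and $D_t^1y:=\partial_ty$ (piecewise continuous time derivatives are regarded as left-continuous on $(0,T]$). Standing assumption on the approximate solution $u_h$: $u_h(\cdot,0)=u(\cdot,0)$ on $\Omega$ and $u_h(x,t)=u(x,t)$ for $x\in\partial\Omega$, $t>0$. The supremum takes values in $[0,\infty]$ (the bound being trivial if it is $\infty$); where $\mathcal R_0(s)=0$ the quotient is read as $+\infty$ if $\|R_h(\cdot,s)\|>0$ and as $0$ if $\|R_h(\cdot,s)\|=0$. *)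

theory Defs
  imports "HOL-Analysis.Analysis"
begin

section \<open>Function spaces on a domain\<close>

text \<open>
  Elements of \<open>L\<^sub>2(\<Omega>)\<close> are handled through representatives; every notion below is invariant under
  changing a representative on a null set.
\<close>

definition l2 :: "(real ^ 'd) set \<Rightarrow> (real ^ 'd \<Rightarrow> real) set" where
  "l2 \<Omega> = {v. v \<in> borel_measurable (lebesgue_on \<Omega>) \<and> integrable (lebesgue_on \<Omega>) (\<lambda>x. (v x)\<^sup>2)}"

definition l2_inner :: "(real ^ 'd) set \<Rightarrow> (real ^ 'd \<Rightarrow> real) \<Rightarrow> (real ^ 'd \<Rightarrow> real) \<Rightarrow> real" where
  "l2_inner \<Omega> v w = (LINT x|lebesgue_on \<Omega>. v x * w x)"

definition l2_norm :: "(real ^ 'd) set \<Rightarrow> (real ^ 'd \<Rightarrow> real) \<Rightarrow> real" where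
  "l2_norm \<Omega> v = sqrt (l2_inner \<Omega> v v)"

definition locally_integrable :: "(real ^ 'd) set \<Rightarrow> (real ^ 'd \<Rightarrow> real) \<Rightarrow> bool" where
  "locally_integrable \<Omega> g \<longleftrightarrow> (\<forall>K. compact K \<and> K \<subseteq> \<Omega> \<longrightarrow> g absolutely_integrable_on K)"

primrec C_k :: "nat \<Rightarrow> ('a::euclidean_space \<Rightarrow> real) \<Rightarrow> bool" where
  "C_k 0 \<phi> \<longleftrightarrow> continuous_on UNIV \<phi>"
| "C_k (Suc k) \<phi> \<longleftrightarrow> (\<forall>x. \<phi> differentiable (at x)) \<and>
     (\<forall>b\<in>Basis. C_k k (\<lambda>x. frechet_derivative \<phi> (at x) b))"

definition test_functions :: "'a::euclidean_space set \<Rightarrow> ('a \<Rightarrow> real) set" where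
  "test_functions S = {\<phi>. (\<forall>k. C_k k \<phi>) \<and> compact (closure {x. \<phi> x \<noteq> 0}) \<and> closure {x. \<phi> x \<noteq> 0} \<subseteq> S}"

definition is_weak_grad ::
  "(real ^ 'd) set \<Rightarrow> (real ^ 'd \<Rightarrow> real) \<Rightarrow> (real ^ 'd \<Rightarrow> real ^ 'd) \<Rightarrow> bool" where
  "is_weak_grad \<Omega> v G \<longleftrightarrow> (\<forall>i. (\<lambda>x. G x $ i) \<in> l2 \<Omega> \<and>
     (\<forall>\<phi>\<in>test_functions \<Omega>.
        l2_inner \<Omega> v (\<lambda>x. frechet_derivative \<phi> (at x) (axis i 1)) = - l2_inner \<Omega> (\<lambda>x. G x $ i) \<phi>))"

definition weak_grad :: "(real ^ 'd) set \<Rightarrow> (real ^ 'd \<Rightarrow> real) \<Rightarrow> real ^ 'd \<Rightarrow> real ^ 'd" where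
  "weak_grad \<Omega> v = (SOME G. is_weak_grad \<Omega> v G)"

definition H1 :: "(real ^ 'd) set \<Rightarrow> (real ^ 'd \<Rightarrow> real) set" where
  "H1 \<Omega> = {v \<in> l2 \<Omega>. \<exists>G. is_weak_grad \<Omega> v G}"

definition H1_norm :: "(real ^ 'd) set \<Rightarrow> (real ^ 'd \<Rightarrow> real) \<Rightarrow> real" where
  "H1_norm \<Omega> v = sqrt ((l2_norm \<Omega> v)\<^sup>2 + (\<Sum>i\<in>UNIV. (l2_norm \<Omega> (\<lambda>x. weak_grad \<Omega> v x $ i))\<^sup>2))"

definition H10 :: "(real ^ 'd) set \<Rightarrow> (real ^ 'd \<Rightarrow> real) set" where
  "H10 \<Omega> = {v \<in> H1 \<Omega>. \<exists>\<phi> :: nat \<Rightarrow> real ^ 'd \<Rightarrow> real.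
     (\<forall>n. \<phi> n \<in> test_functions \<Omega>) \<and> (\<lambda>n. H1_norm \<Omega> (\<lambda>x. \<phi> n x - v x)) \<longlonglongrightarrow> 0}"

text \<open>
  Near each boundary point, in suitable orthogonal coordinates, \<open>\<Omega>\<close> is the strict epigraph of a
  Lipschitz function; \<open>e\<close> is the vertical direction and \<open>\<gamma>\<close> lives on the hyperplane orthogonal to it.
\<close>

definition lipschitz_domain :: "(real ^ 'd) set \<Rightarrow> bool" where
  "lipschitz_domain \<Omega> \<longleftrightarrow> open \<Omega> \<and> connected \<Omega> \<and> \<Omega> \<noteq> {} \<and>
     (\<forall>p\<in>frontier \<Omega>. \<exists>e U K \<gamma>. norm e = 1 \<and> open U \<and> p \<in> U \<and> K-lipschitz_on {y. e \<bullet> y = 0} \<gamma> \<and>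
        \<Omega> \<inter> U = {x \<in> U. \<gamma> (x - (e \<bullet> x) *\<^sub>R e) < e \<bullet> x})"


section \<open>Second-order elliptic operators\<close>

text \<open>
  The general linear second-order operator in divergence form (Gilbarg--Trudinger, Chapter 8),
  \<open>\<L> v = - div (A \<nabla>v + p v) + b \<bullet> \<nabla>v + c v\<close>,
  with bounded measurable coefficients and uniformly elliptic \<open>A\<close> (not necessarily symmetric).
\<close>

record 'd elliptic_operator =
  diffusion :: "real ^ 'd \<Rightarrow> real ^ 'd ^ 'd"
  flux :: "real ^ 'd \<Rightarrow> real ^ 'd"
  convection :: "real ^ 'd \<Rightarrow> real ^ 'd"
  reaction :: "real ^ 'd \<Rightarrow> real"

definition elliptic :: "(real ^ 'd) set \<Rightarrow> 'd::finite elliptic_operator \<Rightarrow> bool" where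
  "elliptic \<Omega> L \<longleftrightarrow>
     diffusion L \<in> borel_measurable (lebesgue_on \<Omega>) \<and> flux L \<in> borel_measurable (lebesgue_on \<Omega>) \<and>
     convection L \<in> borel_measurable (lebesgue_on \<Omega>) \<and> reaction L \<in> borel_measurable (lebesgue_on \<Omega>) \<and>
     (\<exists>K. AE x in lebesgue_on \<Omega>. norm (diffusion L x) \<le> K \<and> norm (flux L x) \<le> K \<and>
        norm (convection L x) \<le> K \<and> \<bar>reaction L x\<bar> \<le> K) \<and>
     (\<exists>\<theta>>0. AE x in lebesgue_on \<Omega>. \<forall>\<xi>. \<xi> \<bullet> (diffusion L x *v \<xi>) \<ge> \<theta> * (norm \<xi>)\<^sup>2)"

text \<open>
  For \<open>v \<in> H\<^sup>1(\<Omega>)\<close>, \<open>\<L> v\<close> is in general only a distribution (an element of \<open>H\<^sup>-\<^sup>1(\<Omega>)\<close>);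
  \<open>pairing \<Omega> L v w\<close> is the duality product \<open>\<langle>\<L> v, w\<rangle>\<close> for \<open>w \<in> H\<^sup>1\<^sub>0(\<Omega>)\<close>.
\<close>

definition pairing ::
  "(real ^ 'd) set \<Rightarrow> 'd::finite elliptic_operator \<Rightarrow> (real ^ 'd \<Rightarrow> real) \<Rightarrow> (real ^ 'd \<Rightarrow> real) \<Rightarrow> real" where
  "pairing \<Omega> L v w =
     (LINT x|lebesgue_on \<Omega>.
        (diffusion L x *v weak_grad \<Omega> v x + v x *\<^sub>R flux L x) \<bullet> weak_grad \<Omega> w x
        + (convection L x \<bullet> weak_grad \<Omega> v x + reaction L x * v x) * w x)"


section \<open>Functions of time with values in \<open>L\<^sub>2(\<Omega>)\<close>\<close>

text \<open>
  A time-dependent function is written \<open>y t x\<close>. The value \<open>y t\<close> is meaningful for every \<open>t\<close>.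
\<close>

definition C_l2 :: "(real ^ 'd) set \<Rightarrow> real \<Rightarrow> (real \<Rightarrow> real ^ 'd \<Rightarrow> real) set" where
  "C_l2 \<Omega> T = {y. \<forall>t\<in>{0..T}. y t \<in> l2 \<Omega> \<and>
     ((\<lambda>s. l2_norm \<Omega> (\<lambda>x. y s x - y t x)) \<longlongrightarrow> 0) (at t within {0..T})}"

text \<open>
  \<open>Linf_l2 \<Omega> a b\<close> is \<open>L\<^sub>\<infinity>(a,b;L\<^sub>2(\<Omega>))\<close>. A Bochner measurable function with values in \<open>L\<^sub>2(\<Omega>)\<close> is given
  by a jointly measurable representative, and its Bochner integrals in time are then computed
  pointwise for almost every \<open>x\<close>. Both facts are used in what follows. A continuous function into
  \<open>L\<^sub>2(\<Omega>)\<close> has a jointly measurable representative that is correct for every \<open>t\<close>.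
\<close>

definition Linf_l2 :: "(real ^ 'd) set \<Rightarrow> real \<Rightarrow> real \<Rightarrow> (real \<Rightarrow> real ^ 'd \<Rightarrow> real) set" where
  "Linf_l2 \<Omega> a b = {y.
     (\<lambda>(t, x). y t x) \<in> borel_measurable (lebesgue_on {a<..<b} \<Otimes>\<^sub>M lebesgue_on \<Omega>) \<and>
     (\<exists>C. AE t in lebesgue_on {a<..<b}. y t \<in> l2 \<Omega> \<and> l2_norm \<Omega> (y t) \<le> C)}"

text \<open>\<open>y \<in> W\<^sup>1\<^sup>,\<^sup>\<infinity>(a,b;L\<^sub>2(\<Omega>))\<close>, with weak time derivative \<open>y'\<close>.\<close>

definition has_W1inf_deriv ::
  "(real ^ 'd) set \<Rightarrow> real \<Rightarrow> real \<Rightarrow> (real \<Rightarrow> real ^ 'd \<Rightarrow> real) \<Rightarrow> (real \<Rightarrow> real ^ 'd \<Rightarrow> real) \<Rightarrow> bool"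
  where
  "has_W1inf_deriv \<Omega> a b y y' \<longleftrightarrow> y \<in> Linf_l2 \<Omega> a b \<and> y' \<in> Linf_l2 \<Omega> a b \<and>
     (\<forall>\<psi>\<in>test_functions {a<..<b}. AE x in lebesgue_on \<Omega>.
        (LINT t|lebesgue_on {a<..<b}. deriv \<psi> t * y t x)
        = - (LINT t|lebesgue_on {a<..<b}. \<psi> t * y' t x))"

text \<open>
  The regularity class of the solution and of its approximation. Functions in it vanish on the
  boundary for \<open>t > 0\<close> because of membership in \<open>H\<^sup>1\<^sub>0(\<Omega>)\<close>. The second function \<open>y'\<close> fixes values of
  \<open>\<partial>\<^sub>t y\<close> at all \<open>t \<in> (0,T]\<close>. Any representative of the weak derivative is admitted; in particular,
  when that derivative is piecewise continuous, the left-continuous one is.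
\<close>

definition regular ::
  "(real ^ 'd) set \<Rightarrow> real \<Rightarrow> (real \<Rightarrow> real ^ 'd \<Rightarrow> real) \<Rightarrow> (real \<Rightarrow> real ^ 'd \<Rightarrow> real) \<Rightarrow> bool" where
  "regular \<Omega> T y y' \<longleftrightarrow> y \<in> C_l2 \<Omega> T \<and> (\<forall>\<epsilon>\<in>{0<..T}. has_W1inf_deriv \<Omega> \<epsilon> T y y') \<and>
     (\<forall>t\<in>{0<..T}. y t \<in> H10 \<Omega> \<and> y' t \<in> l2 \<Omega>)"


section \<open>The multiterm time-fractional equation\<close>

definition time_deriv ::
  "real \<Rightarrow> (real \<Rightarrow> real ^ 'd \<Rightarrow> real) \<Rightarrow> (real \<Rightarrow> real ^ 'd \<Rightarrow> real) \<Rightarrow> real \<Rightarrow> real ^ 'd \<Rightarrow> real" where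
  "time_deriv \<alpha> y y' t x =
     (if \<alpha> < 1 then
        (t powr (- \<alpha>) * (y t x - y 0 x)
         + (LINT s|lebesgue_on {0<..<t}. \<alpha> * (t - s) powr (- \<alpha> - 1) * (y t x - y s x)))
        / Gamma (1 - \<alpha>)
      else y' t x)"

text \<open>
  The distribution \<open>(\<Sum>\<^sub>i q\<^sub>i(t) D\<^sub>t\<^bsup>\<alpha>\<^sub>i\<^esup> + \<L>) y(\<cdot>,t) - f(\<cdot>,t)\<close> applied to a test function \<open>\<phi>\<close>.
\<close>

definition residual ::
  "(real ^ 'd) set \<Rightarrow> nat \<Rightarrow> (nat \<Rightarrow> real) \<Rightarrow> (nat \<Rightarrow> real \<Rightarrow> real) \<Rightarrow> 'd::finite elliptic_operator
   \<Rightarrow> (real \<Rightarrow> real ^ 'd \<Rightarrow> real) \<Rightarrow> (real \<Rightarrow> real ^ 'd \<Rightarrow> real) \<Rightarrow> (real \<Rightarrow> real ^ 'd \<Rightarrow> real)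
   \<Rightarrow> real \<Rightarrow> (real ^ 'd \<Rightarrow> real) \<Rightarrow> real" where
  "residual \<Omega> l \<alpha> q L f y y' t \<phi> =
     l2_inner \<Omega> (\<lambda>x. \<Sum>i=1..l. q i t * time_deriv (\<alpha> i) y y' t x) \<phi>
     + pairing \<Omega> L (y t) \<phi> - l2_inner \<Omega> (f t) \<phi>"

text \<open>
  The \<open>L\<^sub>2(\<Omega>)\<close> norm of a distribution \<open>F\<close>. A function representing \<open>F\<close> is unique almost everywhere,
  and the infimum is \<open>\<infinity>\<close> if \<open>F\<close> is not represented by an element of \<open>L\<^sub>2(\<Omega>)\<close>.
\<close>

definition distr_l2_norm :: "(real ^ 'd) set \<Rightarrow> ((real ^ 'd \<Rightarrow> real) \<Rightarrow> real) \<Rightarrow> ennreal" where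
  "distr_l2_norm \<Omega> F =
     (INF g\<in>{g \<in> l2 \<Omega>. \<forall>\<phi>\<in>test_functions \<Omega>. F \<phi> = l2_inner \<Omega> g \<phi>}. ennreal (l2_norm \<Omega> g))"

definition is_solution ::
  "(real ^ 'd) set \<Rightarrow> real \<Rightarrow> nat \<Rightarrow> (nat \<Rightarrow> real) \<Rightarrow> (nat \<Rightarrow> real \<Rightarrow> real) \<Rightarrow> 'd::finite elliptic_operator
   \<Rightarrow> (real \<Rightarrow> real ^ 'd \<Rightarrow> real) \<Rightarrow> (real ^ 'd \<Rightarrow> real)
   \<Rightarrow> (real \<Rightarrow> real ^ 'd \<Rightarrow> real) \<Rightarrow> (real \<Rightarrow> real ^ 'd \<Rightarrow> real) \<Rightarrow> bool" where
  "is_solution \<Omega> T l \<alpha> q L f u\<^sub>0 u u' \<longleftrightarrow> regular \<Omega> T u u' \<and>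
     (\<forall>t\<in>{0<..T}. \<forall>\<phi>\<in>test_functions \<Omega>. residual \<Omega> l \<alpha> q L f u u' t \<phi> = 0) \<and>
     (AE x in lebesgue_on \<Omega>. u 0 x = u\<^sub>0 x)"

definition R0 :: "nat \<Rightarrow> (nat \<Rightarrow> real) \<Rightarrow> (nat \<Rightarrow> real \<Rightarrow> real) \<Rightarrow> real \<Rightarrow> real \<Rightarrow> real" where
  "R0 l \<alpha> q lam t =
     lam + (\<Sum>i = (if \<alpha> 1 < 1 then 1 else 2)..l. q i t * t powr (- \<alpha> i) / Gamma (1 - \<alpha> i))"

text \<open>
  Quotients of residual norms by \<open>R0\<close> are taken in \<^typ>\<open>ennreal\<close>, whose conventions are the desired
  ones when \<open>R0\<close> vanishes.
\<close>

lemma ennreal_quotient_by_zero: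
  fixes r :: ennreal
  shows "r / 0 = (if r > 0 then \<infinity> else 0)"
  by (auto simp: divide_ennreal_def ennreal_mult_top)

end

theory Submission
  imports Defs
begin

text \<open>
  Write \<open>e = u\<^sub>h - u\<close> and \<open>v(s) = \<parallel>e(s)\<parallel>\<close>, and let \<open>M\<close> be the supremum on the right. If \<open>v(t) > M\<close>, then, as
  \<open>v\<close> is continuous and \<open>v(0) = 0\<close>, there are times \<open>s \<le> t\<close> with \<open>v(s) > M\<close> and \<open>v(r) \<le> v(s)\<close> for all
  \<open>r \<le> s\<close>; call such an \<open>s\<close> a record. Test the equation of the error with \<open>e(s)\<close> at a record \<open>s\<close>. In
  \<open>\<langle>D\<^sup>\<alpha> e(s), e(s)\<rangle>\<close> the integrand of the memory integral is a positive multiple of \<open>\<langle>e(s) - e(r), e(s)\<rangle>\<close>, which is at least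
  \<open>v(s) (v(s) - v(r)) \<ge> 0\<close>, so that a term of order \<open>\<alpha> < 1\<close> contributes at least
  \<open>s\<^bsup>-\<alpha>\<^esup> v(s)\<^sup>2 / \<Gamma>(1 - \<alpha>)\<close> (\<open>time_deriv_record_lower_bound\<close>). With coercivity,
  \<open>\<R>\<^sub>0(s) v(s)\<^sup>2 + q\<^sub>1(s) \<langle>\<partial>\<^sub>t e(s), e(s)\<rangle> \<le> \<parallel>R\<^sub>h(s)\<parallel> v(s)\<close>, where the middle term occurs only if
  \<open>\<alpha>\<^sub>1 = 1\<close>. If \<open>\<langle>\<partial>\<^sub>t e(s), e(s)\<rangle> > 0\<close>, this contradicts \<open>\<parallel>R\<^sub>h(s)\<parallel> \<le> M \<R>\<^sub>0(s)\<close>: for \<open>\<R>\<^sub>0(s) > 0\<close> because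
  \<open>v(s) > M\<close>, and for \<open>\<R>\<^sub>0(s) = 0\<close> because then \<open>R\<^sub>h(s) = 0\<close> while \<open>q\<^sub>1(s) > 0\<close> is the only nonzero
  coefficient.

  A maximum of \<open>v\<close> need not be a record with \<open>\<langle>\<partial>\<^sub>t e(s), e(s)\<rangle> > 0\<close>, since \<open>\<partial>\<^sub>t e\<close> is only a weak derivative and
  its value at any particular time carries no information. But \<open>v\<^sup>2\<close> is an indefinite integral of
  \<open>2 \<langle>\<partial>\<^sub>t e, e\<rangle>\<close> away from \<open>0\<close> (\<open>energy_identity\<close>), and the gaps between records contribute nothing positive
  to the increase of \<open>v\<^sup>2\<close>; hence the integrand is positive at some record (\<open>increasing_record\<close>).

  Three points need analysis. First, \<open>\<L> u\<close> is a distribution, so the equation may be tested with \<open>e(s)\<close> only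
  after approximating \<open>e(s)\<close> in \<open>H\<^sup>1\<^sub>0\<close> by test functions (\<open>pairing_identity_extends\<close>); this uses that weak
  gradients are unique almost everywhere, by the fundamental lemma of the calculus of variations
  (\<open>AE_zero_of_orthogonal_test_functions\<close>). Second, the weak time derivative has to be turned into
  \<open>\<langle>y(b) - y(a), h\<rangle> = \<integral> \<langle>\<partial>\<^sub>t y, h\<rangle>\<close> (\<open>weak_derivative_imp_integral\<close>), which yields Lipschitz continuity in time
  away from \<open>0\<close>. Third, by this Lipschitz continuity the singular memory integral converges in \<open>L\<^sub>2\<close>, by
  Minkowski's inequality for integrals (\<open>l2_time_integral\<close>), and may be interchanged with inner products.
\<close>

section \<open>Increasing records of an indefinite integral\<close>

lemma first_time_at_level:
  fixes f :: "real \<Rightarrow> real"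
  assumes "continuous_on {c..d} f" "c \<le> d" "f c < y" "y \<le> f d"
  obtains s where "c < s" "s \<le> d" "f s = y" "\<And>r. c \<le> r \<Longrightarrow> r < s \<Longrightarrow> f r < y"
proof -
  let ?A = "{c..d} \<inter> f -` {y..}"
  have "closed ?A"
    by (intro continuous_closed_preimage assms(1) closed_real_atLeastAtMost closed_atLeast)
  then have "compact ?A"
    by (simp add: compact_eq_bounded_closed bounded_Int)
  moreover have "d \<in> ?A" using assms by auto
  ultimately obtain s where s: "s \<in> ?A" "\<And>r. r \<in> ?A \<Longrightarrow> s \<le> r"
    using compact_attains_inf[of ?A] by blast
  have lt: "f r < y" if "c \<le> r" "r < s" for r
    using s(2)[of r] s(1) that by (cases "f r < y") auto
  have "c < s" using s(1) assms(3) by (cases "s = c") auto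
  moreover have "f s = y"
  proof -
    have "continuous_on {c..s} f" using assms(1) s(1) by (auto intro: continuous_on_subset)
    then obtain x where "c \<le> x" "x \<le> s" "f x = y"
      using IVT'[of f c y s] assms(3) s(1) by auto
    with lt[of x] show ?thesis by (cases "x = s") auto
  qed
  ultimately show thesis using that[of s] s(1) lt by auto
qed

text \<open>
  The end points of a component lie outside the open set, as otherwise the component could be enlarged.
\<close>

lemma component_of_open_real:
  fixes U :: "real set"
  assumes "open U" "bounded U" "C \<in> components U"
  obtains c d where "c < d" "C = {c<..<d}" "c \<notin> U" "d \<notin> U"
proof -
  have "open C" using assms open_components by blast
  have "connected C" "C \<noteq> {}" "C \<subseteq> U"
    using assms(3) in_components_connected in_components_nonempty in_components_subset by blast+
  have bdd: "bdd_above C" "bdd_below C"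
    using bounded_subset[OF assms(2) \<open>C \<subseteq> U\<close>] bounded_imp_bdd_above bounded_imp_bdd_below by auto
  define c d where "c = Inf C" and "d = Sup C"
  obtain m n where "\<And>x. x \<in> C \<Longrightarrow> m \<le> x" "\<And>x. x \<in> C \<Longrightarrow> x \<le> n"
    using bdd by (meson bdd_above.E bdd_below.E)
  then have "c \<notin> C" "d \<notin> C"
    unfolding c_def d_def
    using Inf_notin_open[OF \<open>open C\<close>, of "m - 1"] Sup_notin_open[OF \<open>open C\<close>, of "n + 1"]
    by force+
  have "C \<subseteq> {c..d}" unfolding c_def d_def using bdd by (auto intro: cInf_lower cSup_upper)
  then have sub: "C \<subseteq> {c<..<d}" using \<open>c \<notin> C\<close> \<open>d \<notin> C\<close> by (auto simp: less_le) 
  have "{c<..<d} \<subseteq> C"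
  proof
    fix x assume x: "x \<in> {c<..<d}"
    obtain p where p: "p \<in> C" "p < x" using x cInf_lessD[OF \<open>C \<noteq> {}\<close>] c_def by auto
    obtain q where q: "q \<in> C" "x < q" using x less_cSupD[OF \<open>C \<noteq> {}\<close>] d_def by auto
    have "is_interval C" using \<open>connected C\<close> by (simp add: is_interval_connected_1)
    then show "x \<in> C" using p q by (meson is_interval_1 less_imp_le)
  qed
  with sub have C: "C = {c<..<d}" by auto
  have "c < d" using C \<open>C \<noteq> {}\<close> by auto
  have "c \<notin> U"
  proof
    assume "c \<in> U"
    have "{c..<d} \<subseteq> U" using \<open>c \<in> U\<close> C \<open>C \<subseteq> U\<close> by (auto simp: le_less)
    then have "{c..<d} \<subseteq> C"
      using \<open>c < d\<close> C by (intro components_maximal[OF assms(3)]) (use dense[OF \<open>c < d\<close>] in auto)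
    then show False using \<open>c \<notin> C\<close> \<open>c < d\<close> by auto
  qed
  moreover have "d \<notin> U"
  proof
    assume "d \<in> U"
    have "{c<..d} \<subseteq> U" using \<open>d \<in> U\<close> C \<open>C \<subseteq> U\<close> by (auto simp: le_less)
    then have "{c<..d} \<subseteq> C"
      using \<open>c < d\<close> C by (intro components_maximal[OF assms(3)]) (use dense[OF \<open>c < d\<close>] in auto)
    then show False using \<open>d \<notin> C\<close> \<open>c < d\<close> by auto
  qed
  ultimately show thesis using that C \<open>c < d\<close> by blast
qed

text \<open>
  The components are countably many and disjoint, so the integral over \<open>U\<close> is the limit of the sums of the
  integrals over finitely many components.
\<close>

lemma set_integral_open_real_nonpos:
  fixes U :: "real set" and g :: "real \<Rightarrow> real"
  assumes "open U" "bounded U" "set_integrable lebesgue U g"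
    and comp: "\<And>c d. c < d \<Longrightarrow> {c<..<d} \<in> components U \<Longrightarrow> c \<notin> U \<Longrightarrow> d \<notin> U \<Longrightarrow>
      (LINT r:{c<..<d}|lebesgue. g r) \<le> 0"
  shows "(LINT r:U|lebesgue. g r) \<le> 0"
proof -
  have cnt: "countable (components U)" 
    using open_components[OF assms(1)] pairwise_disjoint_components[of U] 
    by (intro countable_disjoint_open_subsets) (fastforce simp: disjnt_def pairwise_def)+
  \<comment> \<open>An enumeration of the components by all of \<open>nat\<close>, also if there are only finitely many of them: \<open>A n\<close> is
    the component with number \<open>n\<close>, or empty.\<close>
  define A where "A n = \<Union>{C \<in> components U. to_nat_on (components U) C = n}" for n
  have A: "A n = {} \<or> A n \<in> components U" for n
  proof (cases "\<exists>C\<in>components U. to_nat_on (components U) C = n")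
    case True
    then obtain C where C: "C \<in> components U" "to_nat_on (components U) C = n" by auto
    have "{C \<in> components U. to_nat_on (components U) C = n} = {C}"
      using C cnt by (auto simp: to_nat_on_inj)
    with C show ?thesis by (auto simp: A_def)
  qed (auto simp: A_def)
  have "(\<Union>n. A n) = \<Union>(components U)" by (auto simp: A_def simp del: Union_components)
  then have UA: "(\<Union>n. A n) = U" using Union_components[of U] by metis
  have meas: "A n \<in> sets lebesgue" for n
    using A[of n] open_components[OF assms(1)] by (auto intro: lebesgue_openin)
  have disj: "A i \<inter> A j = {}" if "i \<noteq> j" for i j
  proof -
    have "C \<inter> D = {}" if "C \<in> components U" "D \<in> components U" "C \<noteq> D" for C D
      using that pairwise_disjoint_components[of U] by (auto simp: pairwise_def)
    then show ?thesis using that unfolding A_def by fastforce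
  qed
  have nonpos: "(LINT r:A n|lebesgue. g r) \<le> 0" for n
  proof (cases "A n = {}")
    case False
    then have "A n \<in> components U" using A by auto
    then obtain c d where "c < d" "A n = {c<..<d}" "c \<notin> U" "d \<notin> U"
      using component_of_open_real assms by metis
    then show ?thesis using comp \<open>A n \<in> components U\<close> by metis
  qed (simp add: set_lebesgue_integral_def)
  have int: "set_integrable lebesgue (A n) g" for n
    using set_integrable_subset[OF assms(3) meas[of n]] UA by auto
  have "(\<lambda>n. LINT r:(\<Union>i<n. A i)|lebesgue. g r) \<longlonglongrightarrow> (LINT r:(\<Union>n. \<Union>i<n. A i)|lebesgue. g r)"
  proof (rule set_integral_cont_up)
    show "incseq (\<lambda>n. \<Union>i<n. A i)" by (force simp: incseq_def)
    have "(\<Union>n. \<Union>i<n. A i) = U" using UA by auto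
    then show "set_integrable lebesgue (\<Union>n. \<Union>i<n. A i) g" using assms(3) by simp
  qed (use meas in auto)
  moreover have "(\<Union>n. \<Union>i<n. A i) = U" using UA by auto
  moreover have "(LINT r:(\<Union>i<n. A i)|lebesgue. g r) \<le> 0" for n
  proof -
    have "(LINT r:(\<Union>i<n. A i)|lebesgue. g r) = (\<Sum>i<n. LINT r:A i|lebesgue. g r)"
      using disj by (intro set_integral_finite_Union int meas) (auto simp: disjoint_family_on_def)
    also have "\<dots> \<le> 0" by (intro sum_nonpos nonpos)
    finally show ?thesis .
  qed
  ultimately show ?thesis by (auto intro: LIMSEQ_le_const2)
qed

text \<open>
  The idea of the rising sun lemma. Let \<open>E\<close> be the closed set of records in \<open>{a..b}\<close>. If \<open>{c<..<d}\<close> is a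
  component of the complement, then \<open>f d \<le> f c\<close>, since otherwise the first time at which \<open>f\<close> attains the
  mean of \<open>f c\<close> and \<open>f d\<close> would be a record in \<open>{c<..<d}\<close>. So the integral of \<open>g\<close> over the complement is at
  most \<open>0\<close>. As the integral over \<open>{a..b}\<close> is \<open>f b - f a > 0\<close>, the integral over \<open>E\<close> is positive, which is
  impossible if \<open>g \<le> 0\<close> on \<open>E\<close>. No derivative of \<open>f\<close> at individual points is used, and the
  conclusion holds for every representative of the density.
\<close>

lemma increasing_record:
  fixes f g :: "real \<Rightarrow> real"
  assumes cont: "continuous_on {a..b} f"
    and int: "set_integrable lebesgue {a..b} g"
    and ftc: "\<And>x y. a \<le> x \<Longrightarrow> x \<le> y \<Longrightarrow> y \<le> b \<Longrightarrow> f y - f x = (LINT r:{x..y}|lebesgue. g r)"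
    and "a \<le> b" "f a < f b" and max: "\<And>r. r \<in> {a..b} \<Longrightarrow> f r \<le> f b"
  shows "\<exists>s\<in>{a..b}. (\<forall>r\<in>{a..s}. f r \<le> f s) \<and> 0 < g s"
proof (rule ccontr)
  assume no: "\<not> ?thesis"
  define E where "E = {s \<in> {a..b}. \<forall>r\<in>{a..s}. f r \<le> f s}"
  have nonpos: "g s \<le> 0" if "s \<in> E" for s
    using no that by (force simp: E_def)
  \<comment> \<open>With \<open>min r s\<close> instead of \<open>r\<close> the range of \<open>r\<close> is independent of \<open>s\<close>, and \<open>E\<close> is an intersection of
    closed sets.\<close>
  have E_eq: "E = (\<Inter>r\<in>{a..b}. {s \<in> {a..b}. f (min r s) \<le> f s})"
  proof (intro equalityI subsetI)
    fix s assume "s \<in> E"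
    then show "s \<in> (\<Inter>r\<in>{a..b}. {s \<in> {a..b}. f (min r s) \<le> f s})"
      by (auto simp: E_def)
  next
    fix s assume s: "s \<in> (\<Inter>r\<in>{a..b}. {s \<in> {a..b}. f (min r s) \<le> f s})"
    then have "s \<in> {a..b}" using \<open>a \<le> b\<close> by auto
    moreover have "f r \<le> f s" if "r \<in> {a..s}" for r
      using s that \<open>s \<in> {a..b}\<close> by (auto simp: min_def dest!: bspec[of _ _ r])
    ultimately show "s \<in> E" by (auto simp: E_def)
  qed
  have "closed E"
    unfolding E_eq
    by (intro closed_INT ballI continuous_on_closed_Collect_le cont
        continuous_on_compose2[OF cont] continuous_intros) (auto simp: min_def)
  then have Emeas: "E \<in> sets lebesgue" by (simp add: lebesgue_closedin)
  have ab: "a \<in> E" "b \<in> E" using max \<open>a \<le> b\<close> by (auto simp: E_def)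
  define U where "U = {a<..<b} - E"
  have "open U" unfolding U_def using \<open>closed E\<close> by auto
  then have Umeas: "U \<in> sets lebesgue" by (simp add: lebesgue_openin)
  have split: "{a..b} = E \<union> U" "E \<inter> U = {}" 
    using ab by (auto simp: U_def E_def less_eq_real_def[of a] less_eq_real_def[of _ b])
  have intE: "set_integrable lebesgue E g" and intU: "set_integrable lebesgue U g"
    using split by (auto intro: set_integrable_subset[OF int] Emeas Umeas)
  have "(LINT r:E|lebesgue. g r) \<le> 0"
    unfolding set_lebesgue_integral_def
    using Bochner_Integration.integral_mono[of lebesgue "\<lambda>x. indicat_real E x *\<^sub>R g x" "\<lambda>_. 0"] intE nonpos
    by (auto simp: set_integrable_def indicator_def)
  moreover have "(LINT r:U|lebesgue. g r) \<le> 0"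
  proof (rule set_integral_open_real_nonpos[OF \<open>open U\<close> _ intU])
    show "bounded U" unfolding U_def by (auto intro: bounded_subset[of "{a..b}"])
    fix c d :: real assume cd: "c < d" "{c<..<d} \<in> components U" "c \<notin> U" "d \<notin> U"
    have sub: "{c<..<d} \<subseteq> U" using cd in_components_subset by blast
    then have "{c<..<d} \<subseteq> {a..b}" using split by auto
    then have "a \<le> c" "d \<le> b" using cd(1) by (auto simp: greaterThanLessThan_subseteq_atLeastAtMost_iff)
    then have cdE: "c \<in> E" "d \<in> E" using cd split by auto
    have "f d \<le> f c"
    proof (rule ccontr)
      assume "\<not> f d \<le> f c"
      define y where "y = (f c + f d) / 2"
      have y: "f c < y" "y < f d" using \<open>\<not> f d \<le> f c\<close> by (auto simp: y_def)
      have "continuous_on {c..d} f"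
        using cont \<open>a \<le> c\<close> \<open>d \<le> b\<close> by (auto intro: continuous_on_subset)
      then obtain s where s: "c < s" "s \<le> d" "f s = y" "\<And>r. c \<le> r \<Longrightarrow> r < s \<Longrightarrow> f r < y"
        using first_time_at_level[of c d f y] cd(1) y by auto
      have "f r \<le> f s" if "r \<in> {a..s}" for r
      proof -
        consider "r \<le> c" | "c \<le> r" "r < s" | "r = s" using \<open>r \<in> {a..s}\<close> by fastforce
        then show ?thesis
        proof cases
          case 1
          then have "f r \<le> f c" using cdE(1) that by (auto simp: E_def)
          then show ?thesis using y s(3) by simp
        qed (use s in force)+
      qed
      then have "s \<in> E" using s \<open>a \<le> c\<close> \<open>d \<le> b\<close> by (auto simp: E_def)
      moreover have "s \<in> {c<..<d}" using s y(2) by (cases "s = d") auto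
      ultimately show False using sub split(2) by auto
    qed
    moreover have "f d - f c = (LINT r:{c..d}|lebesgue. g r)"
      using ftc cd(1) \<open>a \<le> c\<close> \<open>d \<le> b\<close> by auto
    moreover have "(LINT r:{c..d}|lebesgue. g r) = (LINT r:{c<..<d}|lebesgue. g r)"
      by (rule set_integral_discrete_difference[where X = "{c, d}"]) auto
    ultimately show "(LINT r:{c<..<d}|lebesgue. g r) \<le> 0" by simp
  qed
  moreover have "(LINT r:{a..b}|lebesgue. g r) = (LINT r:E|lebesgue. g r) + (LINT r:U|lebesgue. g r)"
    unfolding split(1) using split(2) by (intro set_integral_Un intE intU) auto
  moreover have "f b - f a = (LINT r:{a..b}|lebesgue. g r)" using ftc \<open>a \<le> b\<close> by auto
  ultimately show False using \<open>f a < f b\<close> by simp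
qed

section \<open>Smooth functions\<close>

lemma C_k_SucI:
  assumes "\<And>x. (\<phi> has_derivative D x) (at x)" "\<And>b. b \<in> Basis \<Longrightarrow> C_k k (\<lambda>x. D x b)"
  shows "C_k (Suc k) \<phi>"
proof -
  have "frechet_derivative \<phi> (at x) = D x" for x
    using assms(1) by (metis frechet_derivative_at)
  with assms show ?thesis by (auto simp: differentiable_def)
qed

lemma C_k_SucD:
  assumes "C_k (Suc k) \<phi>"
  shows "(\<phi> has_derivative frechet_derivative \<phi> (at x)) (at x)"
    and "b \<in> Basis \<Longrightarrow> C_k k (\<lambda>x. frechet_derivative \<phi> (at x) b)"
  using assms by (auto simp: frechet_derivative_works[symmetric])

lemma C_k_imp_continuous: "C_k k \<phi> \<Longrightarrow> continuous_on UNIV \<phi>"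
  by (cases k) (auto intro!: differentiable_imp_continuous_on simp: differentiable_on_def differentiable_at_withinI)

lemma C_k_Suc_imp: "C_k (Suc k) \<phi> \<Longrightarrow> C_k k \<phi>"
proof (induction k arbitrary: \<phi>)
  case 0
  then show ?case using C_k_imp_continuous by (simp only: C_k.simps(1))
next
  case (Suc k)
  then show ?case by auto
qed

lemma C_k_const: "C_k k (\<lambda>x. c)"
  by (induction k arbitrary: c) auto

lemma C_k_add:
  assumes "C_k k f" "C_k k g"
  shows "C_k k (\<lambda>x. f x + g x)"
  using assms
proof (induction k arbitrary: f g)
  case (Suc k)
  show ?case
    by (rule C_k_SucI, rule has_derivative_add[OF C_k_SucD(1)[OF Suc.prems(1)] C_k_SucD(1)[OF Suc.prems(2)]])
      (intro Suc.IH C_k_SucD(2) Suc.prems)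
qed (auto intro: continuous_intros)

lemma C_k_mult:
  assumes "C_k k f" "C_k k g"
  shows "C_k k (\<lambda>x. f x * g x)"
  using assms
proof (induction k arbitrary: f g)
  case (Suc k)
  show ?case
    by (rule C_k_SucI, rule has_derivative_mult[OF C_k_SucD(1)[OF Suc.prems(1)] C_k_SucD(1)[OF Suc.prems(2)]])
      (intro C_k_add Suc.IH C_k_SucD(2) Suc.prems C_k_Suc_imp)
qed (auto intro: continuous_intros)

lemma C_k_diff:
  assumes "C_k k f" "C_k k g"
  shows "C_k k (\<lambda>x. f x - g x)"
  using C_k_add[OF assms(1) C_k_mult[OF C_k_const[of k "-1"] assms(2)]] by simp

lemma C_k_prod:
  assumes "\<And>i. i \<in> I \<Longrightarrow> C_k k (f i)"
  shows "C_k k (\<lambda>x. \<Prod>i\<in>I. f i x)"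
  using assms
  by (induction I rule: infinite_finite_induct) (auto intro: C_k_const C_k_mult)

lemma C_k_real_SucI:
  fixes \<phi> :: "real \<Rightarrow> real"
  assumes "\<And>x. (\<phi> has_real_derivative D x) (at x)" "C_k k D"
  shows "C_k (Suc k) \<phi>"
  by (rule C_k_SucI, rule has_field_derivative_imp_has_derivative[OF assms(1)]) (use assms(2) in simp)

text \<open>
  For functions of one real variable the Frechet derivative in the direction \<open>1\<close> is \<open>deriv\<close>.
\<close>

lemma C_k_real_SucD:
  fixes \<phi> :: "real \<Rightarrow> real"
  assumes "C_k (Suc k) \<phi>"
  shows "(\<phi> has_real_derivative deriv \<phi> x) (at x)" "C_k k (deriv \<phi>)"
proof -
  have D: "(\<phi> has_real_derivative deriv \<phi> x) (at x)" for x
    using C_k_SucD(1)[OF assms, of x] has_real_derivative DERIV_imp_deriv by metis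
  then have *: "frechet_derivative \<phi> (at x) = (*) (deriv \<phi> x)" for x
    by (intro frechet_derivative_at[symmetric] has_field_derivative_imp_has_derivative)
  show "(\<phi> has_real_derivative deriv \<phi> x) (at x)"
    by (rule D)
  show "C_k k (deriv \<phi>)" using C_k_SucD(2)[OF assms, of 1] by (simp add: *)
qed

lemma C_k_compose_affine:
  fixes \<phi> :: "real \<Rightarrow> real" and w :: "'a::euclidean_space"
  assumes "C_k k \<phi>"
  shows "C_k k (\<lambda>x. \<phi> (w \<bullet> x + c))"
  using assms
proof (induction k arbitrary: \<phi>)
  case 0
  then show ?case by (auto intro!: continuous_on_compose2[where g = \<phi> and t = UNIV] continuous_intros)
next
  case (Suc k)
  have "((\<lambda>x. \<phi> (w \<bullet> x + c)) has_derivative (\<lambda>h. (w \<bullet> h) * deriv \<phi> (w \<bullet> x + c))) (at x)" for x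
    by (rule has_derivative_eq_rhs[OF has_derivative_compose[OF _ 
          C_k_real_SucD(1)[OF Suc.prems, THEN has_field_derivative_imp_has_derivative]]])
      (auto intro!: derivative_eq_intros simp: algebra_simps)
  then show ?case
    by (rule C_k_SucI) (intro C_k_mult C_k_const Suc.IH C_k_real_SucD(2)[OF Suc.prems])
qed

text \<open>
  With \<open>z = 1 / x\<close> this is \<open>z\<^sup>m e\<^bsup>-z\<^esup>\<close> for \<open>x > 0\<close>, continued by \<open>0\<close>. Differentiation leads to combinations of
  functions of the same kind, so the whole family is needed to see that \<open>flat 0\<close> is smooth.
\<close>

definition flat :: "nat \<Rightarrow> real \<Rightarrow> real" where
  "flat m x = (if x > 0 then (1 / x) ^ m * exp (- (1 / x)) else 0)"

lemma flat_tendsto_0: "(flat m \<longlongrightarrow> 0) (at 0)"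
proof -
  have "((\<lambda>z::real. z ^ m * exp (- z)) \<longlongrightarrow> 0) at_top"
    using tendsto_power_div_exp_0[of m] by (simp add: exp_minus divide_inverse)
  from filterlim_compose[OF this filterlim_inverse_at_top_right]
  have lim: "((\<lambda>x::real. (1 / x) ^ m * exp (- (1 / x))) \<longlongrightarrow> 0) (at_right 0)"
    by (simp add: divide_inverse)
  have ev: "\<forall>\<^sub>F x in at_right 0. (1 / x) ^ m * exp (- (1 / x)) = flat m x"
    by (rule eventually_at_rightI[of 0 1]) (auto simp: flat_def)
  have "(flat m \<longlongrightarrow> 0) (at_right 0)" by (rule Lim_transform_eventually[OF lim ev])
  moreover have "(flat m \<longlongrightarrow> 0) (at_left 0)"
    by (rule Lim_transform_eventually[OF tendsto_const], rule eventually_at_leftI[of "-1"])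
      (auto simp: flat_def)
  ultimately show ?thesis by (simp add: filterlim_split_at)
qed

lemma flat_deriv:
  "(flat m has_real_derivative flat (m + 2) x - m * flat (m + 1) x) (at x)"
proof (cases x "0::real" rule: linorder_cases)
  case less
  have "((\<lambda>_. 0) has_real_derivative flat (m + 2) x - m * flat (m + 1) x) (at x)"
    using less by (simp add: flat_def)
  then show ?thesis
    by (rule has_field_derivative_transform_within_open[of _ _ _ "{..<0}"]) (use less in \<open>auto simp: flat_def\<close>)
next
  case equal
  have "((\<lambda>h. (flat m (0 + h) - flat m 0) / h) \<longlongrightarrow> 0) (at 0)"
    by (rule Lim_transform_eventually[OF flat_tendsto_0[of "Suc m"]])
      (auto simp: flat_def eventually_at_filter)
  then show ?thesis using equal by (simp add: DERIV_def flat_def)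
next
  case greater
  have D: "((\<lambda>x. 1 / x) has_real_derivative - ((1 / x)\<^sup>2)) (at x)"
    using greater by (auto intro!: derivative_eq_intros simp: power2_eq_square)
  have "((\<lambda>x. (1 / x) ^ m * exp (- (1 / x))) has_real_derivative
      of_nat m * (- ((1 / x)\<^sup>2) * (1 / x) ^ (m - Suc 0)) * exp (- (1 / x))
      + exp (- (1 / x)) * - (- ((1 / x)\<^sup>2)) * (1 / x) ^ m) (at x)"
    by (rule DERIV_mult[OF DERIV_power[OF D] DERIV_fun_exp[OF DERIV_minus[OF D]]])
  also have "of_nat m * (- ((1 / x)\<^sup>2) * (1 / x) ^ (m - Suc 0)) * exp (- (1 / x))
      + exp (- (1 / x)) * - (- ((1 / x)\<^sup>2)) * (1 / x) ^ m = flat (m + 2) x - m * flat (m + 1) x"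
    using greater by (cases m) (simp_all add: flat_def power2_eq_square algebra_simps del: power_divide)
  finally have "((\<lambda>x. (1 / x) ^ m * exp (- (1 / x))) has_real_derivative flat (m + 2) x - m * flat (m + 1) x) (at x)" .
  then show ?thesis
    by (rule has_field_derivative_transform_within_open[of _ _ _ "{0<..}"]) (use greater in \<open>auto simp: flat_def\<close>)
qed

lemma C_k_flat: "C_k k (flat m)"
proof (induction k arbitrary: m)
  case 0
  have "continuous_on UNIV (flat m)"
    by (rule DERIV_continuous_on[OF has_field_derivative_at_within[OF flat_deriv]])
  then show ?case by simp
next
  case (Suc k)
  show ?case by (rule C_k_real_SucI[OF flat_deriv]) (intro C_k_diff C_k_mult C_k_const Suc)
qed

definition bump :: "real \<Rightarrow> real" where "bump x = flat 0 x * flat 0 (1 - x)"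

lemma C_k_bump: "C_k k bump"
proof -
  have "C_k k (\<lambda>x. flat 0 x * flat 0 ((-1) \<bullet> x + 1))"
    by (rule C_k_mult[OF C_k_flat C_k_compose_affine[OF C_k_flat]])
  then show ?thesis by (simp add: bump_def[abs_def] add.commute)
qed

lemma bump_nonneg: "bump x \<ge> 0" by (simp add: bump_def flat_def)
lemma bump_eq_0: "x \<le> 0 \<or> 1 \<le> x \<Longrightarrow> bump x = 0" by (auto simp: bump_def flat_def)

text \<open>
  The normalised primitive of a smooth function that is positive on \<open>{0<..<1}\<close> and vanishes elsewhere. Cutoff
  functions are built from \<open>\<Phi>\<close>, and approximations of the Dirac measure from its derivative \<open>\<beta>\<close>.
\<close>

lemma smooth_step_exists:
  obtains \<Phi> \<beta> :: "real \<Rightarrow> real" where "\<And>k. C_k k \<Phi>" "\<And>x. 0 \<le> \<Phi> x \<and> \<Phi> x \<le> 1"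
    "\<And>x. x \<le> 0 \<Longrightarrow> \<Phi> x = 0" "\<And>x. 1 \<le> x \<Longrightarrow> \<Phi> x = 1"
    "\<And>x. (\<Phi> has_real_derivative \<beta> x) (at x)"
    "continuous_on UNIV \<beta>" "\<And>x. \<beta> x \<ge> 0" "\<And>x. x \<notin> {0..1} \<Longrightarrow> \<beta> x = 0"
proof -
  have cont: "continuous_on UNIV bump" using C_k_bump[of 0] by simp
  define F where "F x = integral {-1..x} bump" for x
  have F0: "F x = 0" if "x \<le> 0" for x
  proof -
    have "F x = integral {-1..x} (\<lambda>_. 0)"
      unfolding F_def using that bump_eq_0 by (intro integral_cong) auto
    then show ?thesis by simp
  qed
  have F': "(F has_real_derivative bump x) (at x)" for x
  proof (cases "x < 0")
    case True
    have "((\<lambda>_. 0) has_real_derivative bump x) (at x)" using True bump_eq_0[of x] by simp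
    then show ?thesis
      by (rule has_field_derivative_transform_within_open[of _ _ _ "{..<0}"]) (use True F0 in auto)
  next
    case False
    have "(F has_real_derivative bump x) (at x within {-1..x+1})"
      unfolding F_def using False 
      by (intro integral_has_real_derivative continuous_on_subset[OF cont]) auto
    moreover have "at x within {-1..x+1} = at x"
      using False by (intro at_within_interior) auto
    ultimately show ?thesis by simp
  qed
  have mono: "F x \<le> F y" if "x \<le> y" for x y
    by (rule DERIV_nonneg_imp_nondecreasing[OF that]) (use F' bump_nonneg in blast)
  have F1: "F x = F 1" if "x \<ge> 1" for x
  proof (cases "x = 1")
    case False
    then have "1 < x" using that by simp
    from MVT2[OF this F'] obtain z where "1 < z" "F x - F 1 = (x - 1) * bump z" by blast
    then show ?thesis using bump_eq_0[of z] by simp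
  qed simp
  obtain z where z: "0 < z" "z < 1" "F 1 - F 0 = (1 - 0) * bump z"
    using MVT2[of 0 1 F bump, OF zero_less_one F'] by blast
  then have "bump z > 0" by (simp add: bump_def flat_def)
  then have pos: "F 1 > 0" using F0[of 0] z(3) by simp
  have F_smooth: "C_k k F" for k
    by (rule C_k_Suc_imp, rule C_k_real_SucI[where D = bump], rule F', rule C_k_bump)
  show thesis
  proof (rule that[of "\<lambda>x. (1 / F 1) * F x" "\<lambda>x. (1 / F 1) * bump x"])
    show "C_k k (\<lambda>x. (1 / F 1) * F x)" for k
      by (rule C_k_mult[OF C_k_const F_smooth])
    show "0 \<le> (1 / F 1) * F x \<and> (1 / F 1) * F x \<le> 1" for x
      using mono[of 0 x] mono[of x 1] F0[of x] F0[of 0] F1[of x] pos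
      by (cases "x \<le> 0"; cases "x \<ge> 1") auto
    show "(1 / F 1) * F x = 0" if "x \<le> 0" for x using F0[OF that] by simp
    show "(1 / F 1) * F x = 1" if "1 \<le> x" for x unfolding F1[OF that] using pos by simp
    show "((\<lambda>x. (1 / F 1) * F x) has_real_derivative (1 / F 1) * bump x) (at x)" for x
      by (rule DERIV_cmult[OF F'])
    show "continuous_on UNIV (\<lambda>x. (1 / F 1) * bump x)"
      by (rule continuous_on_mult[OF continuous_on_const cont])
    show "(1 / F 1) * bump x \<ge> 0" for x using pos bump_nonneg[of x] by simp
    show "(1 / F 1) * bump x = 0" if "x \<notin> {0..1}" for x
      using that bump_eq_0[of x] by (cases "x \<le> 0") auto
  qed
qed

section \<open>The space of square-integrable functions\<close>

lemma l2_measurable: "v \<in> l2 \<Omega> \<Longrightarrow> v \<in> borel_measurable (lebesgue_on \<Omega>)"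
  by (simp add: l2_def)

lemma l2_square_integrable: "v \<in> l2 \<Omega> \<Longrightarrow> integrable (lebesgue_on \<Omega>) (\<lambda>x. (v x)\<^sup>2)"
  by (simp add: l2_def)

lemma l2_mult_integrable:
  assumes "v \<in> l2 \<Omega>" "w \<in> l2 \<Omega>"
  shows "integrable (lebesgue_on \<Omega>) (\<lambda>x. v x * w x)"
proof (rule Bochner_Integration.integrable_bound)
  show "integrable (lebesgue_on \<Omega>) (\<lambda>x. (v x)\<^sup>2 + (w x)\<^sup>2)"
    using assms by (intro Bochner_Integration.integrable_add l2_square_integrable)
  show "(\<lambda>x. v x * w x) \<in> borel_measurable (lebesgue_on \<Omega>)"
    using assms by (intro borel_measurable_times l2_measurable)
  have "\<bar>a * b\<bar> \<le> a\<^sup>2 + b\<^sup>2" for a b :: real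
  proof -
    have "2 * (\<bar>a\<bar> * \<bar>b\<bar>) \<le> a\<^sup>2 + b\<^sup>2"
      using sum_squares_bound[of "\<bar>a\<bar>" "\<bar>b\<bar>"] by simp
    moreover have "0 \<le> \<bar>a\<bar> * \<bar>b\<bar>" by simp
    ultimately show ?thesis unfolding abs_mult by linarith
  qed
  then show "AE x in lebesgue_on \<Omega>. norm (v x * w x) \<le> norm ((v x)\<^sup>2 + (w x)\<^sup>2)"
    by (intro AE_I2) auto
qed

lemma l2I_bound:
  assumes "v \<in> borel_measurable (lebesgue_on \<Omega>)" "integrable (lebesgue_on \<Omega>) h"
    "AE x in lebesgue_on \<Omega>. (v x)\<^sup>2 \<le> h x"
  shows "v \<in> l2 \<Omega>"
  unfolding l2_def
  using assms
  by (auto intro!: Bochner_Integration.integrable_bound[OF assms(2)] borel_measurable_power)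

lemma l2_cmult: "v \<in> l2 \<Omega> \<Longrightarrow> (\<lambda>x. c * v x) \<in> l2 \<Omega>"
  by (auto simp: l2_def power_mult_distrib)

lemma l2_add:
  assumes "v \<in> l2 \<Omega>" "w \<in> l2 \<Omega>"
  shows "(\<lambda>x. v x + w x) \<in> l2 \<Omega>"
  using assms l2_mult_integrable[OF l2_cmult[OF assms(1), of 2] assms(2)]
  by (auto simp: l2_def power2_sum)

lemma l2_diff: "v \<in> l2 \<Omega> \<Longrightarrow> w \<in> l2 \<Omega> \<Longrightarrow> (\<lambda>x. v x - w x) \<in> l2 \<Omega>"
  using l2_add[of v \<Omega> "\<lambda>x. -1 * w x"] l2_cmult[of w \<Omega> "-1"] by simp

lemma l2_0: "(\<lambda>x. 0) \<in> l2 \<Omega>" by (simp add: l2_def)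

lemma l2_sum: "(\<And>i. i \<in> I \<Longrightarrow> v i \<in> l2 \<Omega>) \<Longrightarrow> (\<lambda>x. \<Sum>i\<in>I. v i x) \<in> l2 \<Omega>"
  by (induction I rule: infinite_finite_induct) (auto intro: l2_add l2_0)

lemma l2_bounded_mult:
  assumes "v \<in> l2 \<Omega>" "b \<in> borel_measurable (lebesgue_on \<Omega>)" "AE x in lebesgue_on \<Omega>. \<bar>b x\<bar> \<le> K"
  shows "(\<lambda>x. b x * v x) \<in> l2 \<Omega>"
proof (rule l2I_bound)
  show "integrable (lebesgue_on \<Omega>) (\<lambda>x. K\<^sup>2 * (v x)\<^sup>2)"
    by (intro integrable_mult_right l2_square_integrable assms)
  show "AE x in lebesgue_on \<Omega>. (b x * v x)\<^sup>2 \<le> K\<^sup>2 * (v x)\<^sup>2"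
    using assms(3) by eventually_elim (auto simp: power_mult_distrib abs_le_square_iff[symmetric] intro!: mult_right_mono)
qed (intro borel_measurable_times assms l2_measurable)

lemma l2_inner_commute: "l2_inner \<Omega> v w = l2_inner \<Omega> w v"
  by (simp add: l2_inner_def mult.commute)

lemma l2_inner_add_left:
  "v \<in> l2 \<Omega> \<Longrightarrow> v' \<in> l2 \<Omega> \<Longrightarrow> w \<in> l2 \<Omega> \<Longrightarrow>
    l2_inner \<Omega> (\<lambda>x. v x + v' x) w = l2_inner \<Omega> v w + l2_inner \<Omega> v' w"
  by (simp add: l2_inner_def distrib_right l2_mult_integrable)

lemma l2_inner_diff_left:
  "v \<in> l2 \<Omega> \<Longrightarrow> v' \<in> l2 \<Omega> \<Longrightarrow> w \<in> l2 \<Omega> \<Longrightarrow>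
    l2_inner \<Omega> (\<lambda>x. v x - v' x) w = l2_inner \<Omega> v w - l2_inner \<Omega> v' w"
  by (simp add: l2_inner_def left_diff_distrib l2_mult_integrable)

lemma l2_inner_diff_right:
  "v \<in> l2 \<Omega> \<Longrightarrow> w \<in> l2 \<Omega> \<Longrightarrow> w' \<in> l2 \<Omega> \<Longrightarrow>
    l2_inner \<Omega> v (\<lambda>x. w x - w' x) = l2_inner \<Omega> v w - l2_inner \<Omega> v w'"
  by (simp add: l2_inner_diff_left l2_inner_commute[of \<Omega> v])

lemma l2_inner_cmult_left: "l2_inner \<Omega> (\<lambda>x. c * v x) w = c * l2_inner \<Omega> v w"
  by (simp add: l2_inner_def mult.assoc)

lemma l2_inner_cmult_right: "l2_inner \<Omega> v (\<lambda>x. c * w x) = c * l2_inner \<Omega> v w"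
  by (simp add: l2_inner_def mult.left_commute)

lemma l2_inner_add_right:
  "v \<in> l2 \<Omega> \<Longrightarrow> w \<in> l2 \<Omega> \<Longrightarrow> w' \<in> l2 \<Omega> \<Longrightarrow>
    l2_inner \<Omega> v (\<lambda>x. w x + w' x) = l2_inner \<Omega> v w + l2_inner \<Omega> v w'"
  by (simp add: l2_inner_add_left l2_inner_commute[of \<Omega> v])

lemma l2_inner_sum_left:
  assumes "\<And>i. i \<in> I \<Longrightarrow> v i \<in> l2 \<Omega>" "w \<in> l2 \<Omega>"
  shows "l2_inner \<Omega> (\<lambda>x. \<Sum>i\<in>I. v i x) w = (\<Sum>i\<in>I. l2_inner \<Omega> (v i) w)"
  using assms(1)
proof (induction I rule: infinite_finite_induct)
  case (insert i I)
  then show ?case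
    using l2_inner_add_left[of "v i" \<Omega> "\<lambda>x. \<Sum>i\<in>I. v i x" w] assms(2) by (simp add: l2_sum)
qed (simp_all add: l2_inner_def)

lemma l2_inner_self_nonneg: "0 \<le> l2_inner \<Omega> v v"
  by (simp add: l2_inner_def)

lemma l2_norm_square: "(l2_norm \<Omega> v)\<^sup>2 = l2_inner \<Omega> v v"
  by (simp add: l2_norm_def l2_inner_self_nonneg)

lemma l2_norm_nonneg: "0 \<le> l2_norm \<Omega> v"
  by (simp add: l2_norm_def l2_inner_self_nonneg)

lemma l2_inner_cong_AE:
  assumes "v \<in> borel_measurable (lebesgue_on \<Omega>)" "v' \<in> borel_measurable (lebesgue_on \<Omega>)"
    "w \<in> borel_measurable (lebesgue_on \<Omega>)" "AE x in lebesgue_on \<Omega>. v x = v' x"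
  shows "l2_inner \<Omega> v w = l2_inner \<Omega> v' w"
  unfolding l2_inner_def
proof (rule integral_cong_AE)
  show "AE x in lebesgue_on \<Omega>. v x * w x = v' x * w x"
    using assms(4) by eventually_elim simp
qed (intro borel_measurable_times assms)+

lemma l2_norm_cong_AE:
  assumes "v \<in> borel_measurable (lebesgue_on \<Omega>)" "w \<in> borel_measurable (lebesgue_on \<Omega>)"
    "AE x in lebesgue_on \<Omega>. v x = w x"
  shows "l2_norm \<Omega> v = l2_norm \<Omega> w"
  using l2_inner_cong_AE[OF assms(1,2,1,3)] l2_inner_cong_AE[OF assms(1,2,2,3)]
  by (simp add: l2_norm_def l2_inner_commute)

text \<open>
  The quadratic form \<open>\<parallel>s v - t w\<parallel>\<^sup>2\<close> in \<open>(s, t)\<close> is nonnegative, so its discriminant is not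
  positive.
\<close>

lemma l2_Cauchy_Schwarz:
  assumes "v \<in> l2 \<Omega>" "w \<in> l2 \<Omega>"
  shows "\<bar>l2_inner \<Omega> v w\<bar> \<le> l2_norm \<Omega> v * l2_norm \<Omega> w"
proof -
  have "(l2_inner \<Omega> v w)\<^sup>2 \<le> (l2_norm \<Omega> v * l2_norm \<Omega> w)\<^sup>2"
  proof -
    define A B C where "A = l2_inner \<Omega> v v" and "B = l2_inner \<Omega> v w" and "C = l2_inner \<Omega> w w"
    have quad: "0 \<le> s\<^sup>2 * A - 2 * s * t * B + t\<^sup>2 * C" for s t
    proof -
      have sv: "(\<lambda>x. s * v x) \<in> l2 \<Omega>" and tw: "(\<lambda>x. t * w x) \<in> l2 \<Omega>"
        using assms by (auto intro: l2_cmult)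
      have "0 \<le> l2_inner \<Omega> (\<lambda>x. s * v x - t * w x) (\<lambda>x. s * v x - t * w x)"
        by (rule l2_inner_self_nonneg)
      also have "\<dots> = s\<^sup>2 * A - 2 * s * t * B + t\<^sup>2 * C"
        unfolding l2_inner_diff_left[OF sv tw l2_diff[OF sv tw]] l2_inner_diff_right[OF sv sv tw]
          l2_inner_diff_right[OF tw sv tw]
          l2_inner_diff_right[OF assms(1) sv tw] l2_inner_diff_right[OF assms(2) sv tw] l2_inner_cmult_left l2_inner_cmult_right
          A_def B_def C_def l2_inner_commute[of \<Omega> w v]
        by (simp add: power2_eq_square algebra_simps)
      finally show ?thesis .
    qed
    have "A \<ge> 0" "C \<ge> 0" by (auto simp: A_def C_def l2_inner_self_nonneg)
    have "B\<^sup>2 \<le> A * C"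
    proof (cases "C = 0")
      case True
      have "0 \<le> 1\<^sup>2 * A - 2 * 1 * t * B" for t using quad[of 1 t] True by simp
      \<comment> \<open>an affine function of \<open>t\<close> that is bounded below is constant\<close>
      from this[of "(A + 1) / (2 * B)"] have "B = 0" by (cases "B = 0") auto
      then show ?thesis using True by simp
    next
      case False
      then have "C > 0" using \<open>C \<ge> 0\<close> by simp
      have "0 \<le> C\<^sup>2 * A - 2 * C * B * B + B\<^sup>2 * C" by (rule quad)
      also have "\<dots> = C * (A * C - B\<^sup>2)" by (simp add: power2_eq_square algebra_simps)
      finally show ?thesis using \<open>C > 0\<close> by (simp add: zero_le_mult_iff)
    qed
    then show ?thesis by (simp add: power_mult_distrib l2_norm_square A_def B_def C_def)
  qed
  then show ?thesis
    using abs_le_square_iff[of "l2_inner \<Omega> v w" "l2_norm \<Omega> v * l2_norm \<Omega> w"] l2_norm_nonneg[of \<Omega>]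
    by (simp add: abs_mult)
qed

lemma l2_norm_triangle:
  assumes "v \<in> l2 \<Omega>" "w \<in> l2 \<Omega>"
  shows "l2_norm \<Omega> (\<lambda>x. v x + w x) \<le> l2_norm \<Omega> v + l2_norm \<Omega> w"
proof (rule power2_le_imp_le)
  have "(l2_norm \<Omega> (\<lambda>x. v x + w x))\<^sup>2 = l2_inner \<Omega> v v + 2 * l2_inner \<Omega> v w + l2_inner \<Omega> w w"
    unfolding l2_norm_square l2_inner_add_left[OF assms l2_add[OF assms]]
      l2_inner_add_right[OF assms(1) assms] l2_inner_add_right[OF assms(2) assms]
      l2_inner_commute[of \<Omega> w v] by simp
  also have "\<dots> \<le> (l2_norm \<Omega> v + l2_norm \<Omega> w)\<^sup>2"
    using l2_Cauchy_Schwarz[OF assms] by (simp add: power2_sum l2_norm_square)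
  finally show "(l2_norm \<Omega> (\<lambda>x. v x + w x))\<^sup>2 \<le> (l2_norm \<Omega> v + l2_norm \<Omega> w)\<^sup>2" .
qed (simp add: l2_norm_nonneg)

lemma l2_norm_minus: "l2_norm \<Omega> (\<lambda>x. v x - w x) = l2_norm \<Omega> (\<lambda>x. w x - v x)"
  by (simp add: l2_norm_def l2_inner_def algebra_simps)

lemma l2_norm_uminus: "l2_norm \<Omega> (\<lambda>x. - v x) = l2_norm \<Omega> v"
  by (simp add: l2_norm_def l2_inner_def)

lemma l2_norm_diff_triangle:
  assumes "u \<in> l2 \<Omega>" "v \<in> l2 \<Omega>" "w \<in> l2 \<Omega>"
  shows "l2_norm \<Omega> (\<lambda>x. u x - w x) \<le> l2_norm \<Omega> (\<lambda>x. u x - v x) + l2_norm \<Omega> (\<lambda>x. v x - w x)"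
  using l2_norm_triangle[OF l2_diff[OF assms(1,2)] l2_diff[OF assms(2,3)]] by simp

lemma l2_norm_diff_le:
  assumes "v \<in> l2 \<Omega>" "w \<in> l2 \<Omega>"
  shows "l2_norm \<Omega> (\<lambda>x. v x - w x) \<le> l2_norm \<Omega> v + l2_norm \<Omega> w"
  using l2_norm_diff_triangle[OF assms(1) l2_0 assms(2)] by (simp add: l2_norm_uminus)

lemma l2_norm_reverse_triangle:
  assumes "v \<in> l2 \<Omega>" "w \<in> l2 \<Omega>"
  shows "\<bar>l2_norm \<Omega> v - l2_norm \<Omega> w\<bar> \<le> l2_norm \<Omega> (\<lambda>x. v x - w x)"
  using l2_norm_triangle[OF l2_diff[OF assms] assms(2)] l2_norm_triangle[OF l2_diff[OF assms(2,1)] assms(1)]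
  by (simp add: l2_norm_minus[of _ w])

lemma nn_integral_square_l2:
  assumes "v \<in> l2 \<Omega>"
  shows "(\<integral>\<^sup>+x. ennreal ((v x)\<^sup>2) \<partial>lebesgue_on \<Omega>) = ennreal ((l2_norm \<Omega> v)\<^sup>2)"
  using nn_integral_eq_integral[OF l2_square_integrable[OF assms]]
  unfolding l2_norm_square l2_inner_def by (simp add: power2_eq_square)

lemma l2_abs: "v \<in> l2 \<Omega> \<Longrightarrow> (\<lambda>x. \<bar>v x\<bar>) \<in> l2 \<Omega>"
  by (auto simp: l2_def)

lemma l2_norm_abs: "l2_norm \<Omega> (\<lambda>x. \<bar>v x\<bar>) = l2_norm \<Omega> v"
  by (simp add: l2_norm_def l2_inner_def abs_mult[symmetric])

lemma nn_integral_product_l2: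
  assumes "v \<in> l2 \<Omega>" "w \<in> l2 \<Omega>"
  shows "(\<integral>\<^sup>+x. ennreal \<bar>v x * w x\<bar> \<partial>lebesgue_on \<Omega>) \<le> ennreal (l2_norm \<Omega> v * l2_norm \<Omega> w)"
proof -
  have "(\<integral>\<^sup>+x. ennreal \<bar>v x * w x\<bar> \<partial>lebesgue_on \<Omega>) = ennreal (l2_inner \<Omega> (\<lambda>x. \<bar>v x\<bar>) (\<lambda>x. \<bar>w x\<bar>))"
    unfolding l2_inner_def abs_mult
    by (rule nn_integral_eq_integral[OF l2_mult_integrable[OF l2_abs[OF assms(1)] l2_abs[OF assms(2)]]]) simp
  also have "\<dots> \<le> ennreal (l2_norm \<Omega> v * l2_norm \<Omega> w)"
    using l2_Cauchy_Schwarz[OF l2_abs[OF assms(1)] l2_abs[OF assms(2)]]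
    by (intro ennreal_leI) (simp add: l2_norm_abs)
  finally show ?thesis .
qed

lemma l2_inner_tendsto_right:
  assumes "v \<in> l2 \<Omega>" "\<And>n. w n \<in> l2 \<Omega>" "w' \<in> l2 \<Omega>"
    and "((\<lambda>n. l2_norm \<Omega> (\<lambda>x. w n x - w' x)) \<longlongrightarrow> 0) F"
  shows "((\<lambda>n. l2_inner \<Omega> v (w n)) \<longlongrightarrow> l2_inner \<Omega> v w') F"
proof -
  have "((\<lambda>n. l2_inner \<Omega> v (w n) - l2_inner \<Omega> v w') \<longlongrightarrow> 0) F"
  proof (rule Lim_null_comparison)
    show "\<forall>\<^sub>F n in F. norm (l2_inner \<Omega> v (w n) - l2_inner \<Omega> v w') \<le> l2_norm \<Omega> v * l2_norm \<Omega> (\<lambda>x. w n x - w' x)"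
      using l2_Cauchy_Schwarz[OF assms(1) l2_diff[OF assms(2,3)]]
      by (intro always_eventually allI) (simp add: l2_inner_diff_right assms)
    show "((\<lambda>n. l2_norm \<Omega> v * l2_norm \<Omega> (\<lambda>x. w n x - w' x)) \<longlongrightarrow> 0) F"
      using tendsto_mult_right_zero[OF assms(4)] .
  qed
  then show ?thesis by (simp add: LIM_zero_iff)
qed

section \<open>Test functions\<close>

lemma test_functions_subset: "\<phi> \<in> test_functions S \<Longrightarrow> S \<subseteq> S' \<Longrightarrow> \<phi> \<in> test_functions S'"
  by (auto simp: test_functions_def)

lemma test_functionI:
  assumes "\<And>k. C_k k \<phi>" "compact K" "K \<subseteq> S" "\<And>x. x \<notin> K \<Longrightarrow> \<phi> x = 0"
  shows "\<phi> \<in> test_functions S"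
proof -
  have "closure {x. \<phi> x \<noteq> 0} \<subseteq> K"
    using assms by (intro closure_minimal compact_imp_closed) auto
  moreover from this have "compact (closure {x. \<phi> x \<noteq> 0})"
    using assms(2) by (meson bounded_closure bounded_subset closed_closure compact_eq_bounded_closed)
  ultimately show ?thesis using assms by (auto simp: test_functions_def)
qed

lemma test_functionE:
  assumes "\<phi> \<in> test_functions S"
  obtains K where "compact K" "K \<subseteq> S" "\<And>x. x \<notin> K \<Longrightarrow> \<phi> x = 0"
proof (rule that)
  show "compact (closure {x. \<phi> x \<noteq> 0})" "closure {x. \<phi> x \<noteq> 0} \<subseteq> S"
    using assms by (auto simp: test_functions_def)
  show "\<phi> x = 0" if "x \<notin> closure {x. \<phi> x \<noteq> 0}" for x
    using that closure_subset by (auto simp: subset_eq)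
qed

lemma test_function_C_k: "\<phi> \<in> test_functions S \<Longrightarrow> C_k k \<phi>"
  by (simp add: test_functions_def)

lemma test_function_continuous: "\<phi> \<in> test_functions S \<Longrightarrow> continuous_on UNIV \<phi>"
  by (rule C_k_imp_continuous[OF test_function_C_k[of _ _ 0]])

lemma test_function_outside: "\<phi> \<in> test_functions S \<Longrightarrow> x \<notin> S \<Longrightarrow> \<phi> x = 0"
  by (meson test_functionE subset_iff)

lemma test_function_bounded:
  assumes "\<phi> \<in> test_functions S"
  obtains B where "B \<ge> 0" "\<And>x. \<bar>\<phi> x\<bar> \<le> B"
proof -
  obtain K where K: "compact K" "K \<subseteq> S" "\<And>x. x \<notin> K \<Longrightarrow> \<phi> x = 0"
    using test_functionE[OF assms] by blast
  have "compact (\<phi> ` K)"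
    using test_function_continuous[OF assms] K(1) by (meson compact_continuous_image continuous_on_subset top_greatest)
  then obtain B where B: "\<And>y. y \<in> \<phi> ` K \<Longrightarrow> norm y \<le> B"
    using compact_imp_bounded bounded_iff by metis
  have "\<bar>\<phi> x\<bar> \<le> max 0 B" for x
    using B[of "\<phi> x"] K(3)[of x] by (cases "x \<in> K") auto
  then show thesis using that[of "max 0 B"] by auto
qed

lemma test_function_has_derivative:
  "\<phi> \<in> test_functions S \<Longrightarrow> (\<phi> has_derivative frechet_derivative \<phi> (at x)) (at x)"
  by (rule C_k_SucD(1)[OF test_function_C_k])

lemma test_function_partial:
  assumes "\<phi> \<in> test_functions S" "b \<in> Basis"
  shows "(\<lambda>x. frechet_derivative \<phi> (at x) b) \<in> test_functions S"
proof -
  obtain K where K: "compact K" "K \<subseteq> S" "\<And>x. x \<notin> K \<Longrightarrow> \<phi> x = 0"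
    using test_functionE[OF assms(1)] by blast
  show ?thesis
  proof (rule test_functionI[OF _ K(1,2)])
    show "C_k k (\<lambda>x. frechet_derivative \<phi> (at x) b)" for k
      by (rule C_k_SucD(2)[OF test_function_C_k[OF assms(1)] assms(2)])
    fix x assume "x \<notin> K"
    have "((\<lambda>x. 0) has_derivative frechet_derivative \<phi> (at x)) (at x)"
      by (rule has_derivative_transform_within_open[OF test_function_has_derivative[OF assms(1)], of "- K"])
        (use K \<open>x \<notin> K\<close> in \<open>auto intro: compact_imp_closed\<close>)
    then have "frechet_derivative \<phi> (at x) = (\<lambda>_. 0)"
      by (metis has_derivative_const has_derivative_unique)
    then show "frechet_derivative \<phi> (at x) b = 0" by simp
  qed
qed

lemma test_function_diff:
  assumes "\<phi> \<in> test_functions S" "\<psi> \<in> test_functions S"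
  shows "(\<lambda>x. \<phi> x - \<psi> x) \<in> test_functions S"
proof -
  obtain K1 where K1: "compact K1" "K1 \<subseteq> S" "\<And>x. x \<notin> K1 \<Longrightarrow> \<phi> x = 0"
    using test_functionE[OF assms(1)] by blast
  obtain K2 where K2: "compact K2" "K2 \<subseteq> S" "\<And>x. x \<notin> K2 \<Longrightarrow> \<psi> x = 0"
    using test_functionE[OF assms(2)] by blast
  show ?thesis
    by (rule test_functionI[of _ "K1 \<union> K2"])
      (use K1 K2 in \<open>auto intro: C_k_diff test_function_C_k[OF assms(1)] test_function_C_k[OF assms(2)]\<close>)
qed

lemma test_function_mult:
  assumes "\<phi> \<in> test_functions S" "\<psi> \<in> test_functions S"
  shows "(\<lambda>x. \<phi> x * \<psi> x) \<in> test_functions S"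
proof -
  obtain K where K: "compact K" "K \<subseteq> S" "\<And>x. x \<notin> K \<Longrightarrow> \<phi> x = 0"
    using test_functionE[OF assms(1)] by blast
  show ?thesis
    by (rule test_functionI[of _ K])
      (use K in \<open>auto intro: C_k_mult test_function_C_k[OF assms(1)] test_function_C_k[OF assms(2)]\<close>)
qed

lemma integrable_test_function:
  assumes "\<phi> \<in> test_functions S"
  shows "integrable lborel \<phi>"
proof -
  obtain K where K: "compact K" "K \<subseteq> S" "\<And>x. x \<notin> K \<Longrightarrow> \<phi> x = 0"
    using test_functionE[OF assms(1)] by blast
  have "integrable lborel (\<lambda>x. indicator K x *\<^sub>R \<phi> x)"
    by (rule borel_integrable_compact[OF K(1) continuous_on_subset[OF test_function_continuous[OF assms]]]) simp
  moreover have "(\<lambda>x. indicator K x *\<^sub>R \<phi> x) = \<phi>"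
    using K(3) by (auto simp: indicator_def fun_eq_iff)
  ultimately show ?thesis by simp
qed

text \<open>
  By translation invariance the difference quotients of \<open>\<phi>\<close> in the direction \<open>b\<close> have integral \<open>0\<close>. They are
  bounded by the maximum of the derivative, vanish outside a fixed ball, and converge to the derivative. This
  replaces an iterated integration along the coordinate axes.
\<close>

lemma integral_partial_test_function:
  fixes \<phi> :: "'a::euclidean_space \<Rightarrow> real"
  assumes "\<phi> \<in> test_functions S" "b \<in> Basis"
  shows "(LINT x|lborel. frechet_derivative \<phi> (at x) b) = 0"
proof -
  define D where "D x = frechet_derivative \<phi> (at x) b" for x
  have D: "D \<in> test_functions S" unfolding D_def by (rule test_function_partial[OF assms])
  obtain B where B: "B \<ge> 0" "\<And>x. \<bar>D x\<bar> \<le> B" using test_function_bounded[OF D] by blast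
  obtain K where K: "compact K" "K \<subseteq> S" "\<And>x. x \<notin> K \<Longrightarrow> \<phi> x = 0"
    using test_functionE[OF assms(1)] by blast
  obtain r where r: "\<And>x. x \<in> K \<Longrightarrow> norm x \<le> r"
    using compact_imp_bounded[OF K(1)] by (auto simp: bounded_iff)
  define h where "h n = inverse (real (Suc n))" for n
  have h: "0 < h n" "h n \<le> 1" for n by (auto simp: h_def field_simps)
  have h_lim: "h \<longlonglongrightarrow> 0"
    unfolding h_def[abs_def] by (rule LIMSEQ_inverse_real_of_nat)
  define Q where "Q n x = (\<phi> (x + h n *\<^sub>R b) - \<phi> x) / h n" for n x
  have line: "((\<lambda>s. \<phi> (x + s *\<^sub>R b)) has_real_derivative D (x + s *\<^sub>R b)) (at s)" for x s
  proof -
    have "((\<lambda>s. \<phi> (x + s *\<^sub>R b)) has_derivative (\<lambda>t. frechet_derivative \<phi> (at (x + s *\<^sub>R b)) (t *\<^sub>R b))) (at s)"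
      by (rule has_derivative_compose[OF _ test_function_has_derivative[OF assms(1)]])
        (auto intro!: derivative_eq_intros)
    moreover have "linear (frechet_derivative \<phi> (at (x + s *\<^sub>R b)))"
      using test_function_has_derivative[OF assms(1)] has_derivative_linear by blast
    then have "(\<lambda>t. frechet_derivative \<phi> (at (x + s *\<^sub>R b)) (t *\<^sub>R b)) = (*) (D (x + s *\<^sub>R b))"
      by (simp add: fun_eq_iff linear_cmul D_def)
    ultimately show ?thesis by (simp add: has_field_derivative_def)
  qed
  have borel: "\<phi> \<in> borel_measurable borel" "D \<in> borel_measurable borel"
    using test_function_continuous[OF assms(1)] test_function_continuous[OF D]
    by (auto intro: borel_measurable_continuous_onI)
  have "(\<lambda>n. LINT x|lborel. Q n x) \<longlonglongrightarrow> (LINT x|lborel. D x)"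
  proof (rule integral_dominated_convergence)
    show "integrable lborel (\<lambda>x. B * indicat_real (cball 0 (r + 1)) x)"
      by (intro integrable_mult_right integrable_real_indicator emeasure_bounded_finite bounded_cball)
        simp
    show "AE x in lborel. (\<lambda>n. Q n x) \<longlonglongrightarrow> D x"
    proof (rule AE_I2)
      fix x
      have "((\<lambda>t. (\<phi> (x + (0 + t) *\<^sub>R b) - \<phi> (x + 0 *\<^sub>R b)) / t) \<longlongrightarrow> D (x + 0 *\<^sub>R b)) (at 0)"
        using line[of x 0] by (simp only: DERIV_def)
      moreover have "filterlim h (at 0) sequentially"
        using h(1) h_lim by (auto simp: filterlim_at order_less_imp_not_eq2)
      ultimately show "(\<lambda>n. Q n x) \<longlonglongrightarrow> D x"
        using filterlim_compose by (fastforce simp: Q_def)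
    qed
    show "AE x in lborel. norm (Q n x) \<le> B * indicat_real (cball 0 (r + 1)) x" for n
    proof (rule AE_I2)
      fix x
      show "norm (Q n x) \<le> B * indicat_real (cball 0 (r + 1)) x"
      proof (cases "x \<in> cball 0 (r + 1)")
        case True
        obtain z where "\<phi> (x + h n *\<^sub>R b) - \<phi> (x + 0 *\<^sub>R b) = (h n - 0) * D (x + z *\<^sub>R b)"
          using MVT2[of 0 "h n" "\<lambda>s. \<phi> (x + s *\<^sub>R b)" "\<lambda>s. D (x + s *\<^sub>R b)", OF h(1) line] by blast
        then have "Q n x = D (x + z *\<^sub>R b)" using h(1)[of n] by (simp add: Q_def)
        then show ?thesis using B(2) True by simp
      next
        case False
        have "norm x \<le> norm (x + h n *\<^sub>R b) + norm (h n *\<^sub>R b)"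
          using norm_triangle_ineq4[of "x + h n *\<^sub>R b" "h n *\<^sub>R b"] by simp
        also have "norm (h n *\<^sub>R b) \<le> 1" using h[of n] assms(2) by simp
        finally have "x + h n *\<^sub>R b \<notin> K" "x \<notin> K" using False r[of x] r[of "x + h n *\<^sub>R b"] by auto
        then show ?thesis using False K(3) by (simp add: Q_def)
      qed
    qed
  qed (use borel in \<open>auto simp: Q_def\<close>)
  moreover have "(LINT x|lborel. Q n x) = 0" for n
  proof -
    have dist: "distr lborel borel ((+) (h n *\<^sub>R b)) = lborel" by (rule lborel_distr_plus)
    have int: "integrable lborel \<phi>" by (rule integrable_test_function[OF assms(1)])
    have int': "integrable lborel (\<lambda>x. \<phi> (h n *\<^sub>R b + x))"
      using int integrable_distr_eq[of "(+) (h n *\<^sub>R b)" lborel borel \<phi>] dist borel by simp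
    have "(LINT x|lborel. \<phi> (h n *\<^sub>R b + x)) = (LINT x|lborel. \<phi> x)"
      using integral_distr[of "(+) (h n *\<^sub>R b)" lborel borel \<phi>] dist borel by simp
    then show ?thesis using int int' by (simp add: Q_def add.commute)
  qed
  ultimately have "(LINT x|lborel. D x) = 0" by (simp add: LIMSEQ_const_iff)
  then show ?thesis by (simp add: D_def)
qed

lemma LINT_lebesgue_on_vanishing:
  assumes "\<Omega> \<in> sets lebesgue" "g \<in> borel_measurable borel" "\<And>x. x \<notin> \<Omega> \<Longrightarrow> g x = 0"
  shows "(LINT x|lebesgue_on \<Omega>. g x) = (LINT x|lborel. (g x :: real))"
proof -
  have "(LINT x|lebesgue_on \<Omega>. g x) = (LINT x|lebesgue. indicat_real \<Omega> x *\<^sub>R g x)"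
    using assms(1) by (intro integral_restrict_space) auto
  also have "(\<lambda>x. indicat_real \<Omega> x *\<^sub>R g x) = g" using assms(3) by (auto simp: indicator_def fun_eq_iff)
  also have "(LINT x|lebesgue. g x) = (LINT x|lborel. g x)"
    using assms(2) by (intro integral_completion) auto
  finally show ?thesis .
qed

lemma l2_continuous_bounded:
  assumes "\<Omega> \<in> lmeasurable" "continuous_on UNIV g" "\<And>x. \<bar>g x\<bar> \<le> B"
  shows "g \<in> l2 \<Omega>"
proof -
  interpret finite_measure "lebesgue_on \<Omega>" by (rule finite_measure_lebesgue_on[OF assms(1)])
  have "g \<in> borel_measurable borel" using assms(2) by (rule borel_measurable_continuous_onI)
  then have "g \<in> borel_measurable (lebesgue_on \<Omega>)"
    by (intro measurable_restrict_space1 measurable_completion) simp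
  then show ?thesis
    by (rule l2I_bound[where h = "\<lambda>_. B\<^sup>2"]) (auto simp: abs_le_square_iff[symmetric] intro!: AE_I2 order_trans[OF assms(3)])
qed

lemma test_function_l2: "\<Omega> \<in> lmeasurable \<Longrightarrow> \<phi> \<in> test_functions S \<Longrightarrow> \<phi> \<in> l2 \<Omega>"
  by (meson test_function_bounded l2_continuous_bounded test_function_continuous)

text \<open>
  The product \<open>\<phi> \<psi>\<close> is a test function, so the integral of its partial derivative vanishes.
\<close>

lemma test_function_by_parts:
  fixes \<phi> \<psi> :: "real ^ 'd \<Rightarrow> real"
  assumes "\<Omega> \<in> lmeasurable" "\<phi> \<in> test_functions \<Omega>" "\<psi> \<in> test_functions \<Omega>" "b \<in> Basis"
  shows "l2_inner \<Omega> \<phi> (\<lambda>x. frechet_derivative \<psi> (at x) b) = - l2_inner \<Omega> (\<lambda>x. frechet_derivative \<phi> (at x) b) \<psi>"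
proof -
  let ?D = "\<lambda>f x. frechet_derivative f (at x) b"
  have prod: "?D (\<lambda>x. \<phi> x * \<psi> x) x = \<phi> x * ?D \<psi> x + ?D \<phi> x * \<psi> x" for x
    using frechet_derivative_at[OF has_derivative_mult[OF test_function_has_derivative[OF assms(2)] test_function_has_derivative[OF assms(3)]], of x]
    by (simp add: fun_eq_iff)
  have "0 = (LINT x|lborel. ?D (\<lambda>x. \<phi> x * \<psi> x) x)"
    using integral_partial_test_function[OF test_function_mult[OF assms(2,3)] assms(4)] by simp
  also have "\<dots> = (LINT x|lebesgue_on \<Omega>. ?D (\<lambda>x. \<phi> x * \<psi> x) x)"
    using test_function_partial[OF test_function_mult[OF assms(2,3)] assms(4)] assms(1)
    by (intro LINT_lebesgue_on_vanishing[symmetric]) 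
      (auto intro: test_function_outside borel_measurable_continuous_onI test_function_continuous)
  also have "\<dots> = (LINT x|lebesgue_on \<Omega>. \<phi> x * ?D \<psi> x + ?D \<phi> x * \<psi> x)" by (simp add: prod)
  also have "\<dots> = l2_inner \<Omega> \<phi> (?D \<psi>) + l2_inner \<Omega> (?D \<phi>) \<psi>"
    unfolding l2_inner_def
    using assms by (intro Bochner_Integration.integral_add l2_mult_integrable) (auto intro: test_function_l2 test_function_partial)
  finally show ?thesis by simp
qed

text \<open>
  Products over the coordinates of steps that steepen at the faces of the box from inside.
\<close>

lemma box_cutoffs:
  fixes a b :: "'a::euclidean_space"
  obtains \<phi> :: "nat \<Rightarrow> 'a \<Rightarrow> real" where
    "\<And>n. \<phi> n \<in> test_functions (cbox a b)" "\<And>n x. 0 \<le> \<phi> n x \<and> \<phi> n x \<le> 1"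
    "\<And>x. (\<lambda>n. \<phi> n x) \<longlonglongrightarrow> indicat_real (box a b) x"
proof -
  obtain \<Phi> \<beta> :: "real \<Rightarrow> real" where \<Phi>: "\<And>k. C_k k \<Phi>" "\<And>x. 0 \<le> \<Phi> x \<and> \<Phi> x \<le> 1"
      "\<And>x. x \<le> 0 \<Longrightarrow> \<Phi> x = 0" "\<And>x. x \<ge> 1 \<Longrightarrow> \<Phi> x = 1"
      "\<And>x. (\<Phi> has_real_derivative \<beta> x) (at x)"
    by (rule smooth_step_exists) blast
  define \<phi> where "\<phi> n x = (\<Prod>i\<in>Basis. \<Phi> (real n * (x \<bullet> i - a \<bullet> i)) * \<Phi> (real n * (b \<bullet> i - x \<bullet> i)))" for n and x :: 'a
  have out: "\<phi> n x = 0" if "x \<notin> box a b" for n x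
  proof -
    obtain i where "i \<in> Basis" "x \<bullet> i \<le> a \<bullet> i \<or> b \<bullet> i \<le> x \<bullet> i"
      using \<open>x \<notin> box a b\<close> by (force simp: mem_box not_less)
    then show ?thesis unfolding \<phi>_def
      by (intro prod_zero finite_Basis bexI[of _ i]) (auto simp: \<Phi>(3) mult_nonneg_nonpos)
  qed
  have smooth: "C_k k (\<phi> n)" for k n
  proof -
    have "C_k k (\<lambda>x. \<Phi> (real n * (x \<bullet> i - a \<bullet> i)) * \<Phi> (real n * (b \<bullet> i - x \<bullet> i)))" for i :: 'a
    proof -
      have "C_k k (\<lambda>x. \<Phi> ((real n *\<^sub>R i) \<bullet> x + - real n * (a \<bullet> i)) * \<Phi> ((- real n *\<^sub>R i) \<bullet> x + real n * (b \<bullet> i)))"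
        by (rule C_k_mult[OF C_k_compose_affine[OF \<Phi>(1)] C_k_compose_affine[OF \<Phi>(1)]])
      then show ?thesis by (simp add: algebra_simps inner_commute)
    qed
    then show ?thesis unfolding \<phi>_def[abs_def] by (rule C_k_prod)
  qed
  show thesis
  proof (rule that[of \<phi>])
    show "\<phi> n \<in> test_functions (cbox a b)" for n
      by (rule test_functionI[OF smooth compact_cbox]) (use out box_subset_cbox in blast)+
    show "0 \<le> \<phi> n x \<and> \<phi> n x \<le> 1" for n x
      unfolding \<phi>_def using \<Phi>(2) by (intro conjI prod_nonneg prod_le_1) (auto intro: mult_le_one)
    show "(\<lambda>n. \<phi> n x) \<longlonglongrightarrow> indicat_real (box a b) x" for x
    proof (cases "x \<in> box a b")
      case True
      have ev: "\<forall>\<^sub>F n in sequentially. \<Phi> (real n * t) = 1" if "t > 0" for t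
      proof -
        have "\<forall>\<^sub>F n in sequentially. 1 / t \<le> real n"
          using filterlim_real_sequentially by (auto simp: filterlim_at_top)
        then show ?thesis by eventually_elim (use that in \<open>auto simp: field_simps intro!: \<Phi>(4)\<close>)
      qed
      have "\<forall>\<^sub>F n in sequentially. \<forall>i\<in>Basis. \<Phi> (real n * (x \<bullet> i - a \<bullet> i)) = 1 \<and> \<Phi> (real n * (b \<bullet> i - x \<bullet> i)) = 1"
        using True by (intro eventually_ball_finite finite_Basis ballI eventually_conj ev) (auto simp: mem_box)
      then have "\<forall>\<^sub>F n in sequentially. \<phi> n x = 1"
        by eventually_elim (auto simp: \<phi>_def)
      then show ?thesis using True by (simp add: tendsto_eventually)
    qed (simp add: out)
  qed
qed

section \<open>Weak gradients\<close>

text \<open>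
  The positive and the negative part of \<open>F\<close> are the densities of two measures that agree on boxes, hence
  on all Borel sets, so that the densities coincide almost everywhere.
\<close>

lemma AE_zero_of_box_integrals:
  fixes F :: "'a::euclidean_space \<Rightarrow> real"
  assumes int: "integrable lebesgue F" and zero: "\<And>l u. (LINT x:box l u|lebesgue. F x) = 0"
  shows "AE x in lebesgue. F x = 0"
proof -
  obtain G where G: "G \<in> borel_measurable lborel" "AE x in lborel. F x = G x"
    using completion_ex_borel_measurable_real borel_measurable_integrable[OF int] by blast
  then have ae: "AE x in lebesgue. F x = G x" by (simp add: AE_completion)
  have [measurable]: "G \<in> borel_measurable borel" using G by simp
  have "integrable lebesgue G"
    using int by (rule integrable_cong_AE_imp) (use ae G in \<open>auto intro: measurable_completion\<close>)
  then have intG: "integrable lborel G" using G(1) by (simp add: integrable_completion)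
  have zeroG: "(LINT x:box l u|lborel. G x) = 0" for l u
  proof -
    have "(LINT x:box l u|lborel. G x) = (LINT x:box l u|lebesgue. G x)"
      unfolding set_lebesgue_integral_def by (intro integral_completion[symmetric]) simp
    also have "\<dots> = (LINT x:box l u|lebesgue. F x)"
      unfolding set_lebesgue_integral_def
    proof (rule integral_cong_AE)
      show "AE x in lebesgue. indicat_real (box l u) x *\<^sub>R G x = indicat_real (box l u) x *\<^sub>R F x"
        using ae by eventually_elim simp
      show "(\<lambda>x. indicat_real (box l u) x *\<^sub>R G x) \<in> borel_measurable lebesgue"
        by (intro measurable_completion) simp
      show "(\<lambda>x. indicat_real (box l u) x *\<^sub>R F x) \<in> borel_measurable lebesgue"
        using borel_measurable_integrable[OF int] by (intro borel_measurable_scaleR borel_measurable_indicator) auto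
    qed
    finally show ?thesis using zero by simp
  qed
  let ?P = "density lborel (\<lambda>x. ennreal (G x))" and ?N = "density lborel (\<lambda>x. ennreal (- G x))"
  have "?P = ?N"
  proof (rule measure_eqI_generator_eq)
    let ?E = "range (\<lambda>(a, b). box a b::'a set)"
    show "Int_stable ?E" by (auto simp: Int_stable_def box_Int_box)
    show "?E \<subseteq> Pow UNIV" "sets ?P = sigma_sets UNIV ?E" "sets ?N = sigma_sets UNIV ?E"
      by (simp_all add: borel_eq_box)
    let ?A = "\<lambda>n::nat. box (- (real n *\<^sub>R One)) (real n *\<^sub>R One) :: 'a set"
    show "range ?A \<subseteq> ?E" "(\<Union>i. ?A i) = UNIV" unfolding UN_box_eq_UNIV by auto
    have int_parts: "integrable lborel (\<lambda>x. max 0 (G x))" "integrable lborel (\<lambda>x. max 0 (- G x))"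
      using intG by auto
    have int_box: "integrable lborel (\<lambda>x. indicat_real (box l u) x * max 0 (G x))"
        "integrable lborel (\<lambda>x. indicat_real (box l u) x * max 0 (- G x))" for l u
      using integrable_mult_indicator[OF _ int_parts(1), of "box l u"]
        integrable_mult_indicator[OF _ int_parts(2), of "box l u"] by simp_all
    have pos: "emeasure ?P (box l u) = ennreal (LINT x:box l u|lborel. max 0 (G x))" for l u
    proof -
      have "emeasure ?P (box l u) = (\<integral>\<^sup>+x. ennreal (indicat_real (box l u) x * max 0 (G x)) \<partial>lborel)"
        by (subst emeasure_density) (auto intro!: nn_integral_cong simp: indicator_def max_def ennreal_neg)
      also have "\<dots> = ennreal (LINT x:box l u|lborel. max 0 (G x))"
        unfolding set_lebesgue_integral_def real_scaleR_def
        by (rule nn_integral_eq_integral) (auto intro: int_box)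
      finally show ?thesis .
    qed
    have neg: "emeasure ?N (box l u) = ennreal (LINT x:box l u|lborel. max 0 (- G x))" for l u
    proof -
      have "emeasure ?N (box l u) = (\<integral>\<^sup>+x. ennreal (indicat_real (box l u) x * max 0 (- G x)) \<partial>lborel)"
        by (subst emeasure_density) (auto intro!: nn_integral_cong simp: indicator_def max_def ennreal_neg)
      also have "\<dots> = ennreal (LINT x:box l u|lborel. max 0 (- G x))"
        unfolding set_lebesgue_integral_def real_scaleR_def
        by (rule nn_integral_eq_integral) (auto intro: int_box)
      finally show ?thesis .
    qed
    show "emeasure ?P (?A i) \<noteq> \<infinity>" for i by (simp add: pos)
    fix X assume "X \<in> ?E"
    then obtain l u where X: "X = box l u" by auto
    have "(LINT x:box l u|lborel. max 0 (G x)) - (LINT x:box l u|lborel. max 0 (- G x))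
        = (LINT x:box l u|lborel. max 0 (G x) - max 0 (- G x))"
      by (rule set_integral_diff(2)[symmetric])
        (simp_all add: set_integrable_def int_box)
    also have "(\<lambda>x. max 0 (G x) - max 0 (- G x)) = G" by (auto simp: fun_eq_iff max_def)
    finally show "emeasure ?P X = emeasure ?N X" by (simp add: X pos neg zeroG)
  qed
  then have "AE x in lborel. ennreal (G x) = ennreal (- G x)"
    by (subst (asm) sigma_finite_measure.density_unique_iff[OF sigma_finite_lborel]) auto
  then have "AE x in lborel. G x = 0"
  proof eventually_elim
    fix x assume "ennreal (G x) = ennreal (- G x)"
    then show "G x = 0" by (cases "G x \<ge> 0") (auto simp: ennreal_neg dest!: sym[of 0])
  qed
  then have "AE x in lebesgue. G x = 0" by (simp add: AE_completion)
  with ae show ?thesis by eventually_elim simp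
qed

lemma l2_integrable:
  assumes "\<Omega> \<in> lmeasurable" "v \<in> l2 \<Omega>"
  shows "integrable (lebesgue_on \<Omega>) v"
  using l2_mult_integrable[OF assms(2) l2_continuous_bounded[OF assms(1), of "\<lambda>_. 1" 1]] by simp

text \<open>
  The fundamental lemma of the calculus of variations: cutoffs of boxes show that the integral of \<open>g\<close> over every
  box with closure in \<open>\<Omega>\<close> vanishes, and \<open>\<Omega>\<close> is a countable union of closed boxes.
\<close>

lemma AE_zero_of_orthogonal_test_functions:
  fixes g :: "real ^ 'd \<Rightarrow> real"
  assumes "open \<Omega>" "\<Omega> \<in> lmeasurable" "g \<in> l2 \<Omega>"
    and orth: "\<And>\<phi>. \<phi> \<in> test_functions \<Omega> \<Longrightarrow> l2_inner \<Omega> g \<phi> = 0"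
  shows "AE x in lebesgue_on \<Omega>. g x = 0"
proof -
  have meas: "\<Omega> \<in> sets lebesgue" using assms(2) by auto
  have int: "integrable (lebesgue_on \<Omega>) g" by (rule l2_integrable[OF assms(2,3)])
  have intG: "integrable lebesgue (\<lambda>x. indicat_real \<Omega> x * g x)"
    using int meas by (simp add: integrable_restrict_space)
  have box0: "(LINT x:box a b|lebesgue. indicat_real \<Omega> x * g x) = 0" if "cbox a b \<subseteq> \<Omega>" for a b
  proof -
    obtain \<phi> :: "nat \<Rightarrow> real ^ 'd \<Rightarrow> real" where \<phi>: "\<And>n. \<phi> n \<in> test_functions (cbox a b)" "\<And>n x. 0 \<le> \<phi> n x \<and> \<phi> n x \<le> 1"
      "\<And>x. (\<lambda>n. \<phi> n x) \<longlonglongrightarrow> indicat_real (box a b) x"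
      using box_cutoffs[of a b] by blast
    have "(\<lambda>n. LINT x|lebesgue_on \<Omega>. g x * \<phi> n x) \<longlonglongrightarrow> (LINT x|lebesgue_on \<Omega>. g x * indicat_real (box a b) x)"
    proof (rule integral_dominated_convergence)
      show "integrable (lebesgue_on \<Omega>) (\<lambda>x. \<bar>g x\<bar>)" using int by simp
      show "(\<lambda>x. g x * indicat_real (box a b) x) \<in> borel_measurable (lebesgue_on \<Omega>)"
        by (intro borel_measurable_times[OF borel_measurable_integrable[OF int]
              measurable_restrict_space1[OF borel_measurable_indicator]]) auto
      show "(\<lambda>x. g x * \<phi> n x) \<in> borel_measurable (lebesgue_on \<Omega>)" for n
        by (intro borel_measurable_times l2_measurable assms test_function_l2[OF assms(2) \<phi>(1)])
      show "AE x in lebesgue_on \<Omega>. (\<lambda>n. g x * \<phi> n x) \<longlonglongrightarrow> g x * indicat_real (box a b) x"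
        by (intro AE_I2 tendsto_mult tendsto_const \<phi>(3))
      show "AE x in lebesgue_on \<Omega>. norm (g x * \<phi> n x) \<le> \<bar>g x\<bar>" for n
        using \<phi>(2) by (intro AE_I2) (auto simp: abs_mult intro: mult_left_le)
    qed
    moreover have "(LINT x|lebesgue_on \<Omega>. g x * \<phi> n x) = 0" for n
      using orth[OF test_functions_subset[OF \<phi>(1) that]] by (simp add: l2_inner_def)
    ultimately have "(LINT x|lebesgue_on \<Omega>. g x * indicat_real (box a b) x) = 0"
      by (simp add: LIMSEQ_const_iff)
    then show ?thesis
      using meas by (simp add: integral_restrict_space set_lebesgue_integral_def mult_ac)
  qed
  have cbox0: "AE x in lebesgue. x \<in> cbox c d \<longrightarrow> g x = 0" if "cbox c d \<subseteq> \<Omega>" for c d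
  proof -
    let ?F = "\<lambda>x. indicat_real (box c d) x * (indicat_real \<Omega> x * g x)"
    have "AE x in lebesgue. ?F x = 0"
    proof (rule AE_zero_of_box_integrals)
      show "integrable lebesgue ?F"
        using integrable_mult_indicator[OF _ intG, of "box c d"] by simp
      fix l u :: "real ^ 'd"
      obtain a b where ab: "box l u \<inter> box c d = box a b" unfolding box_Int_box by blast
      have "(LINT x:box l u|lebesgue. ?F x) = (LINT x:box a b|lebesgue. indicat_real \<Omega> x * g x)"
        unfolding ab[symmetric] set_lebesgue_integral_def
        by (simp add: indicator_inter_arith mult_ac)
      also have "\<dots> = 0"
      proof (cases "box a b = {}")
        case False
        then have "closure (box a b) = cbox a b" by (rule closure_box)
        moreover have "closure (box a b) \<subseteq> cbox c d"
          using ab box_subset_cbox[of c d] by (intro closure_minimal) auto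
        ultimately show ?thesis using that box0[of a b] by simp
      qed (simp add: set_lebesgue_integral_def)
      finally show "(LINT x:box l u|lebesgue. ?F x) = 0" .
    qed
    moreover have "AE x in lebesgue. x \<notin> cbox c d - box c d"
      by (intro AE_not_in) (simp add: negligible_iff_null_sets[symmetric] negligible_frontier_interval)
    ultimately show ?thesis
    proof eventually_elim
      case (elim x)
      then show ?case using that box_subset_cbox[of c d] by (auto simp: indicator_def split: if_splits)
    qed
  qed
  obtain \<D> where \<D>: "countable \<D>" "\<D> \<subseteq> Pow \<Omega>" "\<And>X. X \<in> \<D> \<Longrightarrow> \<exists>a b. X = cbox a b" "\<Union>\<D> = \<Omega>"
    using open_countable_Union_open_cbox[OF assms(1)] by blast
  have "AE x in lebesgue. \<forall>X\<in>\<D>. x \<in> X \<longrightarrow> g x = 0"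
    unfolding AE_ball_countable[OF \<D>(1)] using \<D>(2,3) cbox0 by blast
  then have "AE x in lebesgue. x \<in> \<Omega> \<longrightarrow> g x = 0"
    by eventually_elim (use \<D>(4) in auto)
  then show ?thesis using meas by (simp add: AE_restrict_space_iff)
qed

lemma is_weak_grad_l2: "is_weak_grad \<Omega> v G \<Longrightarrow> (\<lambda>x. G x $ i) \<in> l2 \<Omega>"
  by (simp add: is_weak_grad_def)

text \<open>
  The constant \<open>weak_grad\<close> selects an arbitrary weak gradient. Uniqueness almost everywhere allows it to be
  replaced by any other one, in particular by the classical gradient and by differences of weak gradients.
\<close>

lemma weak_grad_unique:
  assumes "open \<Omega>" "\<Omega> \<in> lmeasurable" "is_weak_grad \<Omega> v G" "is_weak_grad \<Omega> v G'"
  shows "AE x in lebesgue_on \<Omega>. G x $ i = G' x $ i"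
proof -
  have l2: "(\<lambda>x. G x $ i) \<in> l2 \<Omega>" "(\<lambda>x. G' x $ i) \<in> l2 \<Omega>"
    using assms(3,4) by (auto intro: is_weak_grad_l2)
  have "AE x in lebesgue_on \<Omega>. G x $ i - G' x $ i = 0"
  proof (rule AE_zero_of_orthogonal_test_functions[OF assms(1,2) l2_diff[OF l2]])
    fix \<phi> assume \<phi>: "\<phi> \<in> test_functions \<Omega>"
    have "l2_inner \<Omega> (\<lambda>x. G x $ i) \<phi> = l2_inner \<Omega> (\<lambda>x. G' x $ i) \<phi>"
      using assms(3,4) \<phi> by (simp add: is_weak_grad_def)
    then show "l2_inner \<Omega> (\<lambda>x. G x $ i - G' x $ i) \<phi> = 0"
      by (simp add: l2_inner_diff_left l2 test_function_l2[OF assms(2) \<phi>])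
  qed
  then show ?thesis by eventually_elim simp
qed

lemma is_weak_grad_diff:
  assumes "\<Omega> \<in> lmeasurable" "v \<in> l2 \<Omega>" "w \<in> l2 \<Omega>" "is_weak_grad \<Omega> v G" "is_weak_grad \<Omega> w H"
  shows "is_weak_grad \<Omega> (\<lambda>x. v x - w x) (\<lambda>x. G x - H x)"
  unfolding is_weak_grad_def
proof (intro allI conjI ballI)
  fix i
  have GH: "(\<lambda>x. G x $ i) \<in> l2 \<Omega>" "(\<lambda>x. H x $ i) \<in> l2 \<Omega>"
    using assms by (auto intro: is_weak_grad_l2)
  show "(\<lambda>x. (G x - H x) $ i) \<in> l2 \<Omega>" using l2_diff[OF GH] by simp
  fix \<phi> assume \<phi>: "\<phi> \<in> test_functions \<Omega>"
  have \<phi>l2: "\<phi> \<in> l2 \<Omega>" "(\<lambda>x. frechet_derivative \<phi> (at x) (axis i 1)) \<in> l2 \<Omega>"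
    using \<phi> by (auto intro!: test_function_l2[OF assms(1)] test_function_partial simp: axis_in_Basis_iff)
  show "l2_inner \<Omega> (\<lambda>x. v x - w x) (\<lambda>x. frechet_derivative \<phi> (at x) (axis i 1))
      = - l2_inner \<Omega> (\<lambda>x. (G x - H x) $ i) \<phi>"
    using assms(4,5) \<phi>
    by (simp add: l2_inner_diff_left assms(2,3) \<phi>l2 GH is_weak_grad_def)
qed

lemma is_weak_grad_test_function:
  assumes "\<Omega> \<in> lmeasurable" "\<phi> \<in> test_functions \<Omega>"
  shows "is_weak_grad \<Omega> \<phi> (\<lambda>x. \<chi> i. frechet_derivative \<phi> (at x) (axis i 1))"
  unfolding is_weak_grad_def
  using assms by (auto intro!: test_function_l2 test_function_partial test_function_by_parts simp: axis_in_Basis_iff)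

lemma is_weak_grad_weak_grad: "is_weak_grad \<Omega> v G \<Longrightarrow> is_weak_grad \<Omega> v (weak_grad \<Omega> v)"
  unfolding weak_grad_def by (rule someI[of "is_weak_grad \<Omega> v"])

lemma H1_norm_eq:
  assumes "open \<Omega>" "\<Omega> \<in> lmeasurable" "is_weak_grad \<Omega> v G"
  shows "H1_norm \<Omega> v = sqrt ((l2_norm \<Omega> v)\<^sup>2 + (\<Sum>i\<in>UNIV. (l2_norm \<Omega> (\<lambda>x. G x $ i))\<^sup>2))"
proof -
  have "l2_norm \<Omega> (\<lambda>x. weak_grad \<Omega> v x $ i) = l2_norm \<Omega> (\<lambda>x. G x $ i)" for i
    by (intro l2_norm_cong_AE l2_measurable is_weak_grad_l2[OF assms(3)]
        is_weak_grad_l2[OF is_weak_grad_weak_grad[OF assms(3)]]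
        weak_grad_unique[OF assms(1,2) is_weak_grad_weak_grad[OF assms(3)] assms(3)])
  then show ?thesis by (simp add: H1_norm_def)
qed

text \<open>
  Convergence in \<open>H\<^sup>1\<close> is convergence of the functions and of all components of any weak gradients; in
  this form it no longer mentions the selected gradients of differences.
\<close>

lemma H1_norm_tendsto_0_iff:
  assumes "open \<Omega>" "\<Omega> \<in> lmeasurable" "\<And>n::nat. is_weak_grad \<Omega> (v n) (G n)"
  shows "(\<lambda>n. H1_norm \<Omega> (v n)) \<longlonglongrightarrow> 0 \<longleftrightarrow>
    (\<lambda>n. l2_norm \<Omega> (v n)) \<longlonglongrightarrow> 0 \<and> (\<forall>i. (\<lambda>n. l2_norm \<Omega> (\<lambda>x. G n x $ i)) \<longlonglongrightarrow> 0)"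
    (is "?L \<longleftrightarrow> ?R")
proof
  assume L: ?L
  have bound: "l2_norm \<Omega> (v n) \<le> H1_norm \<Omega> (v n)" "l2_norm \<Omega> (\<lambda>x. G n x $ i) \<le> H1_norm \<Omega> (v n)" for n i
  proof -
    have "(l2_norm \<Omega> (\<lambda>x. G n x $ i))\<^sup>2 \<le> (\<Sum>i\<in>UNIV. (l2_norm \<Omega> (\<lambda>x. G n x $ i))\<^sup>2)"
      by (rule member_le_sum) auto
    then show "l2_norm \<Omega> (\<lambda>x. G n x $ i) \<le> H1_norm \<Omega> (v n)"
      unfolding H1_norm_eq[OF assms] by (intro real_le_rsqrt) (simp add: add_increasing)
    show "l2_norm \<Omega> (v n) \<le> H1_norm \<Omega> (v n)"
      unfolding H1_norm_eq[OF assms] by (intro real_le_rsqrt) (simp add: sum_nonneg)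
  qed
  show ?R
    by (intro conjI allI; rule tendsto_sandwich[OF _ _ tendsto_const L])
      (auto intro!: always_eventually bound l2_norm_nonneg)
next
  assume ?R
  then have "(\<lambda>n. sqrt ((l2_norm \<Omega> (v n))\<^sup>2 + (\<Sum>i\<in>UNIV. (l2_norm \<Omega> (\<lambda>x. G n x $ i))\<^sup>2))) \<longlonglongrightarrow> sqrt (0\<^sup>2 + (\<Sum>i\<in>(UNIV :: 'a set). 0\<^sup>2))"
    by (intro tendsto_intros) auto
  then show ?L by (simp add: H1_norm_eq[OF assms])
qed

lemma H10_imp_l2: "v \<in> H10 \<Omega> \<Longrightarrow> v \<in> l2 \<Omega>"
  by (simp add: H10_def H1_def)

lemma H10_weak_grad: "v \<in> H10 \<Omega> \<Longrightarrow> is_weak_grad \<Omega> v (weak_grad \<Omega> v)"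
  by (auto simp: H10_def H1_def intro: is_weak_grad_weak_grad)

lemma H10_approximation:
  assumes "open \<Omega>" "\<Omega> \<in> lmeasurable" "v \<in> H10 \<Omega>" "is_weak_grad \<Omega> v G"
  obtains \<phi> H where "\<And>n::nat. \<phi> n \<in> test_functions \<Omega>" "\<And>n. is_weak_grad \<Omega> (\<phi> n) (H n)"
    "(\<lambda>n. l2_norm \<Omega> (\<lambda>x. \<phi> n x - v x)) \<longlonglongrightarrow> 0"
    "\<And>i. (\<lambda>n. l2_norm \<Omega> (\<lambda>x. H n x $ i - G x $ i)) \<longlonglongrightarrow> 0"
proof -
  obtain \<phi> where \<phi>: "\<And>n::nat. \<phi> n \<in> test_functions \<Omega>" "(\<lambda>n. H1_norm \<Omega> (\<lambda>x. \<phi> n x - v x)) \<longlonglongrightarrow> 0"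
    using assms(3) by (auto simp: H10_def)
  define H where "H n x = (\<chi> i. frechet_derivative (\<phi> n) (at x) (axis i 1))" for n x
  have H: "is_weak_grad \<Omega> (\<phi> n) (H n)" for n
    unfolding H_def[abs_def] by (rule is_weak_grad_test_function[OF assms(2) \<phi>(1)])
  have "is_weak_grad \<Omega> (\<lambda>x. \<phi> n x - v x) (\<lambda>x. H n x - G x)" for n
    by (rule is_weak_grad_diff[OF assms(2) test_function_l2[OF assms(2) \<phi>(1)] H10_imp_l2[OF assms(3)] H assms(4)])
  from H1_norm_tendsto_0_iff[OF assms(1,2), of "\<lambda>n x. \<phi> n x - v x" "\<lambda>n x. H n x - G x", OF this] \<phi>(2)
  show thesis using that[of \<phi>, OF \<phi>(1) H] by simp
qed

lemma H10_diff:
  assumes "open \<Omega>" "\<Omega> \<in> lmeasurable" "v \<in> H10 \<Omega>" "w \<in> H10 \<Omega>"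
  shows "(\<lambda>x. v x - w x) \<in> H10 \<Omega>"
proof -
  note l2 = H10_imp_l2[OF assms(3)] H10_imp_l2[OF assms(4)]
  obtain \<phi> G where \<phi>: "\<And>n::nat. \<phi> n \<in> test_functions \<Omega>" "\<And>n. is_weak_grad \<Omega> (\<phi> n) (G n)"
    "(\<lambda>n. l2_norm \<Omega> (\<lambda>x. \<phi> n x - v x)) \<longlonglongrightarrow> 0"
    "\<And>i. (\<lambda>n. l2_norm \<Omega> (\<lambda>x. G n x $ i - weak_grad \<Omega> v x $ i)) \<longlonglongrightarrow> 0"
    using H10_approximation[OF assms(1-3) H10_weak_grad[OF assms(3)]] by blast
  obtain \<psi> H where \<psi>: "\<And>n::nat. \<psi> n \<in> test_functions \<Omega>" "\<And>n. is_weak_grad \<Omega> (\<psi> n) (H n)"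
    "(\<lambda>n. l2_norm \<Omega> (\<lambda>x. \<psi> n x - w x)) \<longlonglongrightarrow> 0"
    "\<And>i. (\<lambda>n. l2_norm \<Omega> (\<lambda>x. H n x $ i - weak_grad \<Omega> w x $ i)) \<longlonglongrightarrow> 0"
    using H10_approximation[OF assms(1,2,4) H10_weak_grad[OF assms(4)]] by blast
  have diff_tendsto: "(\<lambda>n. l2_norm \<Omega> (\<lambda>x. (a n x - b n x) - (a' x - b' x))) \<longlonglongrightarrow> 0"
    if "\<And>n. a n \<in> l2 \<Omega>" "\<And>n. b n \<in> l2 \<Omega>" "a' \<in> l2 \<Omega>" "b' \<in> l2 \<Omega>"
      "(\<lambda>n. l2_norm \<Omega> (\<lambda>x. a n x - a' x)) \<longlonglongrightarrow> 0" "(\<lambda>n. l2_norm \<Omega> (\<lambda>x. b n x - b' x)) \<longlonglongrightarrow> 0"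
    for a b :: "nat \<Rightarrow> _ \<Rightarrow> real" and a' b'
  proof (rule tendsto_sandwich[OF _ _ tendsto_const])
    show "(\<lambda>n. l2_norm \<Omega> (\<lambda>x. a n x - a' x) + l2_norm \<Omega> (\<lambda>x. b n x - b' x)) \<longlonglongrightarrow> 0"
      using tendsto_add[OF that(5,6)] by simp
    have "l2_norm \<Omega> (\<lambda>x. (a n x - b n x) - (a' x - b' x))
        \<le> l2_norm \<Omega> (\<lambda>x. a n x - a' x) + l2_norm \<Omega> (\<lambda>x. b n x - b' x)" for n
      using l2_norm_diff_le[OF l2_diff[OF that(1,3)] l2_diff[OF that(2,4)], of n n]
      by (simp add: algebra_simps)
    then show "\<forall>\<^sub>F n in sequentially. l2_norm \<Omega> (\<lambda>x. (a n x - b n x) - (a' x - b' x))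
        \<le> l2_norm \<Omega> (\<lambda>x. a n x - a' x) + l2_norm \<Omega> (\<lambda>x. b n x - b' x)" by simp
  qed (simp add: l2_norm_nonneg)
  have \<phi>\<psi>: "(\<lambda>x. \<phi> n x - \<psi> n x) \<in> test_functions \<Omega>" for n by (rule test_function_diff[OF \<phi>(1) \<psi>(1)])
  have vw: "is_weak_grad \<Omega> (\<lambda>x. v x - w x) (\<lambda>x. weak_grad \<Omega> v x - weak_grad \<Omega> w x)"
    by (intro is_weak_grad_diff assms l2 H10_weak_grad)
  have wg: "is_weak_grad \<Omega> (\<lambda>x. (\<phi> n x - \<psi> n x) - (v x - w x)) (\<lambda>x. (G n x - H n x) - (weak_grad \<Omega> v x - weak_grad \<Omega> w x))" for n
    by (intro is_weak_grad_diff assms l2 l2_diff H10_weak_grad \<phi> \<psi> test_function_l2[OF assms(2) \<phi>(1)] test_function_l2[OF assms(2) \<psi>(1)])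
  have "(\<lambda>n. H1_norm \<Omega> (\<lambda>x. (\<phi> n x - \<psi> n x) - (v x - w x))) \<longlonglongrightarrow> 0"
    unfolding H1_norm_tendsto_0_iff[OF assms(1,2) wg] vector_minus_component
    by (intro conjI allI diff_tendsto \<phi>(3,4) \<psi>(3,4) l2 is_weak_grad_l2[OF \<phi>(2)] is_weak_grad_l2[OF \<psi>(2)]
        is_weak_grad_l2[OF H10_weak_grad] assms test_function_l2[OF assms(2) \<phi>(1)] test_function_l2[OF assms(2) \<psi>(1)])
  then have "\<exists>\<eta>. (\<forall>n. \<eta> n \<in> test_functions \<Omega>) \<and> (\<lambda>n. H1_norm \<Omega> (\<lambda>x. \<eta> n x - (v x - w x))) \<longlonglongrightarrow> 0"
    using \<phi>\<psi> by (intro exI[of _ "\<lambda>n x. \<phi> n x - \<psi> n x"]) simp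
  then show ?thesis using vw l2_diff[OF l2] by (auto simp: H10_def H1_def)
qed

section \<open>The elliptic operator\<close>

text \<open>
  The component \<open>i\<close> of \<open>A G + v p\<close> (in the notation \<open>- div (A \<nabla>v + p v) + b \<bullet> \<nabla>v + c v\<close> for the operator), for
  an explicitly given gradient \<open>G\<close> of \<open>v\<close>; it is paired with the gradient of the other argument.
\<close>

definition flow :: "'d::finite elliptic_operator \<Rightarrow> (real ^ 'd \<Rightarrow> real) \<Rightarrow> (real ^ 'd \<Rightarrow> real ^ 'd) \<Rightarrow> 'd \<Rightarrow> real ^ 'd \<Rightarrow> real" where
  "flow L v G i x = (\<Sum>j\<in>UNIV. diffusion L x $ i $ j * G x $ j) + flux L x $ i * v x"

text \<open>
  The part \<open>b \<bullet> G + c v\<close>, which is paired with the other argument itself.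
\<close>

definition lower_order :: "'d::finite elliptic_operator \<Rightarrow> (real ^ 'd \<Rightarrow> real) \<Rightarrow> (real ^ 'd \<Rightarrow> real ^ 'd) \<Rightarrow> real ^ 'd \<Rightarrow> real" where
  "lower_order L v G x = (\<Sum>j\<in>UNIV. convection L x $ j * G x $ j) + reaction L x * v x"

lemma borel_measurable_nth:
  "f \<in> borel_measurable M \<Longrightarrow> (\<lambda>x. f x $ i :: 'b::euclidean_space) \<in> borel_measurable M"
  by (rule measurable_compose[of f _ borel "\<lambda>y. y $ i"])
    (auto intro!: borel_measurable_continuous_onI continuous_intros)

lemma flow_l2:
  assumes "elliptic \<Omega> L" "v \<in> l2 \<Omega>" "\<And>i. (\<lambda>x. G x $ i) \<in> l2 \<Omega>"
  shows "flow L v G i \<in> l2 \<Omega>" "lower_order L v G \<in> l2 \<Omega>"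
proof -
  obtain K where K: "AE x in lebesgue_on \<Omega>. norm (diffusion L x) \<le> K \<and> norm (flux L x) \<le> K \<and>
        norm (convection L x) \<le> K \<and> \<bar>reaction L x\<bar> \<le> K"
    using assms(1) by (auto simp: elliptic_def)
  have meas: "diffusion L \<in> borel_measurable (lebesgue_on \<Omega>)" "flux L \<in> borel_measurable (lebesgue_on \<Omega>)"
     "convection L \<in> borel_measurable (lebesgue_on \<Omega>)" "reaction L \<in> borel_measurable (lebesgue_on \<Omega>)"
    using assms(1) by (auto simp: elliptic_def)
  have "AE x in lebesgue_on \<Omega>. \<bar>diffusion L x $ i $ j\<bar> \<le> K" for i j
    using K
  proof eventually_elim
    case (elim x)
    have "\<bar>diffusion L x $ i $ j\<bar> \<le> norm (diffusion L x $ i)" by (rule component_le_norm_cart)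
    also have "\<dots> \<le> norm (diffusion L x)" by (rule Finite_Cartesian_Product.norm_nth_le)
    finally show ?case using elim by simp
  qed
  moreover have "AE x in lebesgue_on \<Omega>. \<bar>flux L x $ i\<bar> \<le> K" for i
    using K by eventually_elim (meson component_le_norm_cart order_trans)
  moreover have "AE x in lebesgue_on \<Omega>. \<bar>convection L x $ i\<bar> \<le> K" for i
    using K by eventually_elim (meson component_le_norm_cart order_trans)
  moreover have "AE x in lebesgue_on \<Omega>. \<bar>reaction L x\<bar> \<le> K"
    using K by eventually_elim simp
  ultimately show "flow L v G i \<in> l2 \<Omega>" "lower_order L v G \<in> l2 \<Omega>"
    unfolding flow_def[abs_def] lower_order_def[abs_def]
    by (intro l2_add l2_sum l2_bounded_mult[where K = K] assms borel_measurable_nth meas; simp)+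
qed

text \<open>
  Written as a sum of inner products in \<open>L\<^sub>2\<close>, the pairing is visibly linear in both arguments, continuous in
  the second one with respect to \<open>H\<^sup>1\<close>, and independent of the choice of weak gradients.
\<close>

lemma pairing_eq:
  assumes "open \<Omega>" "\<Omega> \<in> lmeasurable" "elliptic \<Omega> L" "v \<in> l2 \<Omega>" "w \<in> l2 \<Omega>"
    "is_weak_grad \<Omega> v G" "is_weak_grad \<Omega> w H"
  shows "pairing \<Omega> L v w = (\<Sum>i\<in>UNIV. l2_inner \<Omega> (flow L v G i) (\<lambda>x. H x $ i)) + l2_inner \<Omega> (lower_order L v G) w"
proof -
  let ?G = "weak_grad \<Omega> v" and ?H = "weak_grad \<Omega> w"
  have wG: "is_weak_grad \<Omega> v ?G" and wH: "is_weak_grad \<Omega> w ?H"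
    using assms by (auto intro: is_weak_grad_weak_grad)
  have fl: "flow L v ?G i \<in> l2 \<Omega>" "lower_order L v ?G \<in> l2 \<Omega>" "flow L v G i \<in> l2 \<Omega>" "lower_order L v G \<in> l2 \<Omega>" for i
    using flow_l2[OF assms(3,4)] is_weak_grad_l2[OF wG] is_weak_grad_l2[OF assms(6)] by blast+
  have H: "(\<lambda>x. H x $ i) \<in> l2 \<Omega>" "(\<lambda>x. ?H x $ i) \<in> l2 \<Omega>" for i
    using is_weak_grad_l2[OF wH] is_weak_grad_l2[OF assms(7)] by blast+
  have "pairing \<Omega> L v w = (LINT x|lebesgue_on \<Omega>. (\<Sum>i\<in>UNIV. flow L v ?G i x * ?H x $ i) + lower_order L v ?G x * w x)"
    unfolding pairing_def flow_def lower_order_def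
    by (intro Bochner_Integration.integral_cong refl)
      (simp add: inner_vec_def matrix_vector_mult_def mult.commute)
  also have "\<dots> = (\<Sum>i\<in>UNIV. l2_inner \<Omega> (flow L v ?G i) (\<lambda>x. ?H x $ i)) + l2_inner \<Omega> (lower_order L v ?G) w"
    unfolding l2_inner_def
    by (subst Bochner_Integration.integral_add, intro Bochner_Integration.integrable_sum l2_mult_integrable fl H,
        intro l2_mult_integrable fl assms, subst Bochner_Integration.integral_sum) (auto intro: l2_mult_integrable fl H)
  also have "(\<Sum>i\<in>UNIV. l2_inner \<Omega> (flow L v ?G i) (\<lambda>x. ?H x $ i)) = (\<Sum>i\<in>UNIV. l2_inner \<Omega> (flow L v G i) (\<lambda>x. H x $ i))"
  proof (rule sum.cong[OF refl])
    fix i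
    have ae: "AE x in lebesgue_on \<Omega>. \<forall>j\<in>UNIV. ?G x $ j = G x $ j"
      by (intro AE_finite_allI finite) (auto intro: weak_grad_unique[OF assms(1,2) wG assms(6)])
    have "AE x in lebesgue_on \<Omega>. flow L v ?G i x = flow L v G i x"
      using ae by eventually_elim (simp add: flow_def)
    then have "l2_inner \<Omega> (flow L v ?G i) (\<lambda>x. ?H x $ i) = l2_inner \<Omega> (flow L v G i) (\<lambda>x. ?H x $ i)"
      by (intro l2_inner_cong_AE l2_measurable fl H)
    also have "\<dots> = l2_inner \<Omega> (flow L v G i) (\<lambda>x. H x $ i)"
      unfolding l2_inner_commute[of \<Omega> "flow L v G i"]
      by (intro l2_inner_cong_AE l2_measurable fl H weak_grad_unique[OF assms(1,2) wH assms(7)])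
    finally show "l2_inner \<Omega> (flow L v ?G i) (\<lambda>x. ?H x $ i) = l2_inner \<Omega> (flow L v G i) (\<lambda>x. H x $ i)" .
  qed
  also have "l2_inner \<Omega> (lower_order L v ?G) w = l2_inner \<Omega> (lower_order L v G) w"
  proof (intro l2_inner_cong_AE l2_measurable fl assms)
    have "AE x in lebesgue_on \<Omega>. \<forall>j\<in>UNIV. ?G x $ j = G x $ j"
      by (intro AE_finite_allI finite) (auto intro: weak_grad_unique[OF assms(1,2) wG assms(6)])
    then show "AE x in lebesgue_on \<Omega>. lower_order L v ?G x = lower_order L v G x"
      by eventually_elim (simp add: lower_order_def)
  qed
  finally show ?thesis .
qed

lemma pairing_diff_left:
  assumes "open \<Omega>" "\<Omega> \<in> lmeasurable" "elliptic \<Omega> L" "v \<in> H10 \<Omega>" "v' \<in> H10 \<Omega>" "\<phi> \<in> test_functions \<Omega>"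
  shows "pairing \<Omega> L (\<lambda>x. v x - v' x) \<phi> = pairing \<Omega> L v \<phi> - pairing \<Omega> L v' \<phi>"
proof -
  let ?G = "weak_grad \<Omega> v" and ?G' = "weak_grad \<Omega> v'" and ?H = "\<lambda>x. \<chi> i. frechet_derivative \<phi> (at x) (axis i 1)"
  note l2 = H10_imp_l2[OF assms(4)] H10_imp_l2[OF assms(5)] test_function_l2[OF assms(2,6)]
  note wg = H10_weak_grad[OF assms(4)] H10_weak_grad[OF assms(5)] is_weak_grad_test_function[OF assms(2,6)]
  have fl: "flow L v ?G i \<in> l2 \<Omega>" "lower_order L v ?G \<in> l2 \<Omega>" "flow L v' ?G' i \<in> l2 \<Omega>" "lower_order L v' ?G' \<in> l2 \<Omega>" for i
    using flow_l2[OF assms(3)] l2 is_weak_grad_l2[OF wg(1)] is_weak_grad_l2[OF wg(2)] by blast+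
  have "flow L (\<lambda>x. v x - v' x) (\<lambda>x. ?G x - ?G' x) i = (\<lambda>x. flow L v ?G i x - flow L v' ?G' i x)" for i
    by (simp add: flow_def fun_eq_iff sum_subtractf algebra_simps)
  moreover have "lower_order L (\<lambda>x. v x - v' x) (\<lambda>x. ?G x - ?G' x) = (\<lambda>x. lower_order L v ?G x - lower_order L v' ?G' x)"
    by (simp add: lower_order_def fun_eq_iff sum_subtractf algebra_simps)
  ultimately show ?thesis
    by (simp only: pairing_eq[OF assms(1-3) l2(1,3) wg(1,3)] pairing_eq[OF assms(1-3) l2(2,3) wg(2,3)]
        pairing_eq[OF assms(1-3) l2_diff[OF l2(1,2)] l2(3) is_weak_grad_diff[OF assms(2) l2(1,2) wg(1,2)] wg(3)]
        l2_inner_diff_left fl l2 is_weak_grad_l2[OF wg(3)] sum_subtractf)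
qed

text \<open>
  Both sides are continuous in \<open>w\<close> with respect to \<open>H\<^sup>1\<close>, and test functions are dense in \<open>H\<^sup>1\<^sub>0\<close>. This is
  what permits testing the equation of the error with the error.
\<close>

lemma pairing_identity_extends:
  assumes "open \<Omega>" "\<Omega> \<in> lmeasurable" "elliptic \<Omega> L" "v \<in> H10 \<Omega>" "w \<in> H10 \<Omega>" "g \<in> l2 \<Omega>"
    and test: "\<And>\<phi>. \<phi> \<in> test_functions \<Omega> \<Longrightarrow> pairing \<Omega> L v \<phi> = l2_inner \<Omega> g \<phi>"
  shows "pairing \<Omega> L v w = l2_inner \<Omega> g w"
proof -
  note l2 = H10_imp_l2[OF assms(4)] H10_imp_l2[OF assms(5)]
  note wg = H10_weak_grad[OF assms(4)] H10_weak_grad[OF assms(5)]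
  let ?G = "weak_grad \<Omega> v" and ?W = "weak_grad \<Omega> w"
  have fl: "flow L v ?G i \<in> l2 \<Omega>" "lower_order L v ?G \<in> l2 \<Omega>" for i
    using flow_l2[OF assms(3)] l2 is_weak_grad_l2[OF wg(1)] by blast+
  obtain \<phi> H where \<phi>: "\<And>n::nat. \<phi> n \<in> test_functions \<Omega>" "\<And>n. is_weak_grad \<Omega> (\<phi> n) (H n)"
    "(\<lambda>n. l2_norm \<Omega> (\<lambda>x. \<phi> n x - w x)) \<longlonglongrightarrow> 0"
    "\<And>i. (\<lambda>n. l2_norm \<Omega> (\<lambda>x. H n x $ i - ?W x $ i)) \<longlonglongrightarrow> 0"
    using H10_approximation[OF assms(1,2,5) wg(2)] by blast
  note \<phi>l2 = test_function_l2[OF assms(2) \<phi>(1)]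
  have "(\<lambda>n. pairing \<Omega> L v (\<phi> n)) \<longlonglongrightarrow> pairing \<Omega> L v w"
    unfolding pairing_eq[OF assms(1-3) l2(1) \<phi>l2 wg(1) \<phi>(2)] pairing_eq[OF assms(1-3) l2 wg]
    by (intro tendsto_add tendsto_sum l2_inner_tendsto_right fl \<phi>l2 l2 \<phi>(3,4) is_weak_grad_l2[OF \<phi>(2)] is_weak_grad_l2[OF wg(2)])
  moreover have "(\<lambda>n. pairing \<Omega> L v (\<phi> n)) \<longlonglongrightarrow> l2_inner \<Omega> g w"
    unfolding test[OF \<phi>(1)] by (intro l2_inner_tendsto_right assms \<phi>l2 l2 \<phi>(3))
  ultimately show ?thesis by (rule LIMSEQ_unique)
qed

section \<open>Weak derivatives of real functions of time\<close>

lemma LINT_lebesgue_on_continuous_support: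
  fixes f :: "real \<Rightarrow> real"
  assumes "S \<in> sets lebesgue" "{p..q} \<subseteq> S" "continuous_on {p..q} f" "\<And>x. x \<notin> {p..q} \<Longrightarrow> f x = 0"
  shows "integrable (lebesgue_on S) f" "(LINT x|lebesgue_on S. f x) = integral {p..q} f"
proof -
  have int: "set_integrable lebesgue {p..q} f"
    by (rule absolutely_integrable_continuous_real[OF assms(3)])
  have eq: "(\<lambda>x. indicat_real S x *\<^sub>R f x) = (\<lambda>x. indicat_real {p..q} x *\<^sub>R f x)"
    using assms(2,4) by (fastforce simp: fun_eq_iff indicator_def)
  show "integrable (lebesgue_on S) f"
    using int assms(1) by (simp add: integrable_restrict_space eq[simplified] set_integrable_def)
  have "(LINT x|lebesgue_on S. f x) = (LINT x:{p..q}|lebesgue. f x)"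
    using assms(1) by (subst integral_restrict_space) (auto simp: set_lebesgue_integral_def eq[simplified])
  then show "(LINT x|lebesgue_on S. f x) = integral {p..q} f"
    using set_lebesgue_integral_eq_integral(2)[OF int] by simp
qed

lemma scaled_kernel_outside:
  fixes \<beta> :: "real \<Rightarrow> real"
  assumes "\<And>x. x \<notin> {0..1} \<Longrightarrow> \<beta> x = 0" "n > 0" "r \<notin> {p..p + 1 / real n}"
  shows "real n * \<beta> (real n * (r - p)) = 0"
proof -
  have "real n * (r - p) \<notin> {0..1}"
    using assms(2,3) by (auto simp: field_simps zero_le_mult_iff)
  then show ?thesis using assms(1) by simp
qed

text \<open>
  The kernels \<open>n \<beta>(n (r - p n))\<close> are nonnegative, have integral \<open>1\<close>, and are supported in
  \<open>{p n..p n + 1 / n}\<close>, an interval that shrinks to \<open>c\<close>. Only the supports have to lie in \<open>S\<close>, so \<open>c\<close> may be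
  the right end point of an open interval \<open>S\<close>.
\<close>

lemma approximate_identity_tendsto:
  fixes \<Phi> \<beta> \<phi> :: "real \<Rightarrow> real" and p :: "nat \<Rightarrow> real"
  assumes \<Phi>: "\<Phi> 0 = 0" "\<Phi> 1 = 1" "\<And>x. (\<Phi> has_real_derivative \<beta> x) (at x)"
    and \<beta>: "continuous_on UNIV \<beta>" "\<And>x. \<beta> x \<ge> 0" "\<And>x. x \<notin> {0..1} \<Longrightarrow> \<beta> x = 0"
    and S: "S \<in> sets lebesgue" "{a..<b} \<subseteq> S" and cont: "continuous_on {a..b} \<phi>" "c \<in> {a..b}"
    and p: "p \<longlonglongrightarrow> c" "\<forall>\<^sub>F n in sequentially. a \<le> p n \<and> p n + 1 / real n < b"
  shows "(\<lambda>n. LINT r|lebesgue_on S. real n * \<beta> (real n * (r - p n)) * \<phi> r) \<longlonglongrightarrow> \<phi> c"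
proof (rule tendstoI)
  fix e :: real assume "e > 0"
  then have "e / 2 > 0" by simp
  then obtain d where d: "d > 0" "\<And>r. r \<in> {a..b} \<Longrightarrow> dist r c < d \<Longrightarrow> dist (\<phi> r) (\<phi> c) < e / 2"
    using cont unfolding continuous_on_iff by metis
  have lim1: "(\<lambda>n. 1 / real n) \<longlonglongrightarrow> 0" by (rule lim_1_over_n)
  have "\<forall>\<^sub>F n in sequentially. dist (p n) c < d / 2" using tendstoD[OF p(1), of "d / 2"] d(1) by simp
  moreover have "\<forall>\<^sub>F n in sequentially. dist (1 / real n) 0 < d / 2" using tendstoD[OF lim1, of "d / 2"] d(1) by simp
  moreover have "\<forall>\<^sub>F n in sequentially. n > (0::nat)" by (rule eventually_gt_at_top)
  ultimately show "\<forall>\<^sub>F n in sequentially. dist (LINT r|lebesgue_on S. real n * \<beta> (real n * (r - p n)) * \<phi> r) (\<phi> c) < e"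
    using p(2)
  proof eventually_elim
    case (elim n)
    let ?q = "p n + 1 / real n"
    let ?k = "\<lambda>r. real n * \<beta> (real n * (r - p n))"
    have pq: "p n \<le> ?q" "{p n..?q} \<subseteq> {a..b}" "{p n..?q} \<subseteq> {a..<b}" using elim by auto
    have out: "?k r = 0" if "r \<notin> {p n..?q}" for r
      by (rule scaled_kernel_outside[OF \<beta>(3) \<open>0 < n\<close> that])
    have contk: "continuous_on A ?k" for A
      by (intro continuous_intros continuous_on_compose2[OF \<beta>(1)]) auto
    have cont\<phi>: "continuous_on {p n..?q} \<phi>" using cont(1) pq(2) by (rule continuous_on_subset)
    have "((\<lambda>r. \<Phi> (real n * (r - p n))) has_real_derivative ?k r) (at r within {p n..?q})" for r
      by (rule has_field_derivative_at_within[OF DERIV_chain2[OF \<Phi>(3), THEN DERIV_cong]]) 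
        (auto intro!: derivative_eq_intros)
    then have "(?k has_integral \<Phi> (real n * (?q - p n)) - \<Phi> (real n * (p n - p n))) {p n..?q}"
      using pq(1) by (intro fundamental_theorem_of_calculus) (auto simp: has_real_derivative_iff_has_vector_derivative)
    then have k1: "(?k has_integral 1) {p n..?q}" using \<Phi>(1,2) elim by simp
    have lint: "(LINT r|lebesgue_on S. ?k r * \<phi> r) = integral {p n..?q} (\<lambda>r. ?k r * \<phi> r)"
      by (rule LINT_lebesgue_on_continuous_support(2)[OF S(1) order_trans[OF pq(3) S(2)] continuous_on_mult[OF contk cont\<phi>]])
        (use out in simp)
    have int\<phi>: "(\<lambda>r. ?k r * \<phi> r) integrable_on {p n..?q}"
      by (intro integrable_continuous_real continuous_on_mult contk cont\<phi>)
    have close: "\<bar>\<phi> r - \<phi> c\<bar> \<le> e / 2" if "r \<in> {p n..?q}" for r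
    proof -
      have "dist r c < d" using that elim by (auto simp: dist_real_def abs_if split: if_splits)
      then show ?thesis using d(2)[of r] that pq(2) by (auto simp: dist_real_def)
    qed
    have lower: "\<phi> c - e / 2 \<le> \<phi> r" and upper: "\<phi> r \<le> \<phi> c + e / 2" if "r \<in> {p n..?q}" for r
      using close[OF that] unfolding abs_le_iff by linarith+
    have k0: "?k r \<ge> 0" for r using \<beta>(2) by simp
    have "1 * (\<phi> c - e / 2) \<le> integral {p n..?q} (\<lambda>r. ?k r * \<phi> r)"
      by (rule has_integral_le[OF has_integral_mult_left[OF k1] integrable_integral[OF int\<phi>]])
        (rule mult_left_mono[OF lower k0])
    moreover have "integral {p n..?q} (\<lambda>r. ?k r * \<phi> r) \<le> 1 * (\<phi> c + e / 2)"
      by (rule has_integral_le[OF integrable_integral[OF int\<phi>] has_integral_mult_left[OF k1]])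
        (rule mult_left_mono[OF upper k0])
    ultimately show ?case
      using \<open>e > 0\<close> by (simp only: lint dist_real_def) (simp add: abs_le_iff abs_less_iff)
  qed
qed

text \<open>
  Test with \<open>\<psi> n\<close>, which rises from \<open>0\<close> to \<open>1\<close> just after \<open>a\<close> and falls back to \<open>0\<close> just before \<open>b\<close>. Then
  \<open>\<psi> n\<close> tends to the indicator of \<open>{a<..<b}\<close>, and its derivative tends to the difference of the Dirac measures at
  \<open>a\<close> and \<open>b\<close>. Both steps lie strictly inside \<open>{a..b}\<close>, so that \<open>b = T\<close> is permitted.
\<close>

lemma weak_derivative_imp_integral:
  fixes \<phi> \<gamma> :: "real \<Rightarrow> real"
  assumes "\<epsilon> < a" "a < b" "b \<le> T" and cont: "continuous_on {a..b} \<phi>"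
    and \<gamma>: "integrable (lebesgue_on {\<epsilon><..<T}) \<gamma>"
    and weak: "\<And>\<psi>. \<psi> \<in> test_functions {\<epsilon><..<T} \<Longrightarrow>
      (LINT r|lebesgue_on {\<epsilon><..<T}. deriv \<psi> r * \<phi> r) = - (LINT r|lebesgue_on {\<epsilon><..<T}. \<psi> r * \<gamma> r)"
  shows "\<phi> b - \<phi> a = (LINT r|lebesgue_on {a<..<b}. \<gamma> r)"
proof -
  obtain \<Phi> \<beta> :: "real \<Rightarrow> real" where \<Phi>: "\<And>k. C_k k \<Phi>" "\<And>x. 0 \<le> \<Phi> x \<and> \<Phi> x \<le> 1"
    "\<And>x. x \<le> 0 \<Longrightarrow> \<Phi> x = 0" "\<And>x. 1 \<le> x \<Longrightarrow> \<Phi> x = 1"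
    "\<And>x. (\<Phi> has_real_derivative \<beta> x) (at x)" and \<beta>: "continuous_on UNIV \<beta>" "\<And>x. \<beta> x \<ge> 0" "\<And>x. x \<notin> {0..1} \<Longrightarrow> \<beta> x = 0"
    by (rule smooth_step_exists) blast
  \<comment> \<open>The second step runs from \<open>p n\<close> to \<open>p n + 1 / n = b - 1 / n < b\<close>.\<close>
  define p where "p n = b - 2 / real n" for n
  define \<psi> where "\<psi> n r = \<Phi> (real n * (r - a)) - \<Phi> (real n * (r - p n))" for n r
  let ?S = "{\<epsilon><..<T}"
  let ?S' = "{a<..<b}"
  have "(\<lambda>n. b - 2 * (1 / real n)) \<longlonglongrightarrow> b - 2 * 0"
    by (intro tendsto_intros lim_1_over_n)
  then have p: "p \<longlonglongrightarrow> b" by (simp add: p_def[abs_def])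
  \<comment> \<open>For \<open>n \<ge> N\<close> there is room for both steps and a gap of length \<open>1 / n\<close> at the end.\<close>
  define N :: nat where "N = nat \<lceil>3 / (b - a)\<rceil>"
  have large: "n > 0 \<and> a \<le> p n \<and> a + 1 / real n < b" if "n \<ge> max 1 N" for n
  proof -
    have "3 / (b - a) \<le> real n" using that by (simp add: N_def nat_le_iff ceiling_le_iff)
    then have "3 \<le> real n * (b - a)" using assms(2) by (simp add: field_simps)
    then show ?thesis using that by (auto simp: p_def field_simps)
  qed
  have D: "(\<psi> n has_real_derivative real n * \<beta> (real n * (r - a)) - real n * \<beta> (real n * (r - p n))) (at r)" for n r
    unfolding \<psi>_def
    by (intro DERIV_diff DERIV_chain2[OF \<Phi>(5), THEN DERIV_cong]) (auto intro!: derivative_eq_intros)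
  have deriv: "deriv (\<psi> n) r = real n * \<beta> (real n * (r - a)) - real n * \<beta> (real n * (r - p n))" for n r
    by (rule DERIV_imp_deriv[OF D])
  have test: "\<psi> n \<in> test_functions ?S" if "n \<ge> max 1 N" for n
  proof (rule test_functionI)
    have "C_k k (\<lambda>r. \<Phi> (real n \<bullet> r + - real n * a) - \<Phi> (real n \<bullet> r + - real n * p n))" for k
      by (rule C_k_diff[OF C_k_compose_affine[OF \<Phi>(1)] C_k_compose_affine[OF \<Phi>(1)]])
    then show "C_k k (\<psi> n)" for k unfolding \<psi>_def[abs_def] by (simp add: algebra_simps)
    show "compact {a..b - 1 / real n}" by simp
    have "b - 1 / real n < b" using that by simp
    then have "r < T" if "r \<le> b - 1 / real n" for r using that assms(3) by linarith
    then show "{a..b - 1 / real n} \<subseteq> ?S" using assms(1) by auto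
    fix r assume r: "r \<notin> {a..b - 1 / real n}"
    have n: "real n > 0" "a \<le> p n" using large[OF that] by auto
    show "\<psi> n r = 0"
    proof (cases "r < a")
      case True
      then have "real n * (r - a) \<le> 0" "real n * (r - p n) \<le> 0" using n by (auto simp: mult_le_0_iff)
      then show ?thesis using \<Phi>(3) by (simp add: \<psi>_def)
    next
      case False
      then have "1 / real n \<le> r - p n" using r by (simp add: p_def)
      then have "real n * (r - p n) \<ge> 1" using n(1) by (simp add: field_simps)
      moreover have "real n * (r - p n) \<le> real n * (r - a)" using n by simp
      ultimately show ?thesis using \<Phi>(4) by (simp add: \<psi>_def)
    qed
  qed
  have left: "(\<lambda>n. LINT r|lebesgue_on ?S. deriv (\<psi> n) r * \<phi> r) \<longlonglongrightarrow> \<phi> a - \<phi> b"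
  proof (rule Lim_transform_eventually)
    let ?k = "\<lambda>q n r. real n * \<beta> (real n * (r - q)) * \<phi> r"
    have S: "?S \<in> sets lebesgue" "{a..<b} \<subseteq> ?S" using assms(1,3) by auto
    have p_less: "p n + 1 / real n < b" if "n \<ge> max 1 N" for n
      using that by (simp add: p_def field_simps)
    show "(\<lambda>n. (LINT r|lebesgue_on ?S. ?k a n r) - (LINT r|lebesgue_on ?S. ?k (p n) n r)) \<longlonglongrightarrow> \<phi> a - \<phi> b"
    proof (intro tendsto_diff)
      show "(\<lambda>n. LINT r|lebesgue_on ?S. ?k a n r) \<longlonglongrightarrow> \<phi> a"
        by (rule approximate_identity_tendsto[OF _ _ \<Phi>(5) \<beta> S cont _ tendsto_const])
          (use \<Phi>(3,4) large assms(2) in \<open>auto simp: eventually_sequentially intro!: exI[of _ "max 1 N"]\<close>)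
      show "(\<lambda>n. LINT r|lebesgue_on ?S. ?k (p n) n r) \<longlonglongrightarrow> \<phi> b"
        by (rule approximate_identity_tendsto[OF _ _ \<Phi>(5) \<beta> S cont _ p])
          (use \<Phi>(3,4) large p_less assms(2) in \<open>auto simp: eventually_sequentially intro!: exI[of _ "max 1 N"]\<close>)
    qed
    have "(LINT r|lebesgue_on ?S. ?k a n r) - (LINT r|lebesgue_on ?S. ?k (p n) n r)
        = (LINT r|lebesgue_on ?S. deriv (\<psi> n) r * \<phi> r)" if "n \<ge> max 1 N" for n
    proof -
      have int: "integrable (lebesgue_on ?S) (?k q n)" if "a \<le> q" "q + 1 / real n < b" for q
      proof (rule LINT_lebesgue_on_continuous_support(1)[OF S(1), of q "q + 1 / real n"])
        show "{q..q + 1 / real n} \<subseteq> ?S" using that assms(1,3) by auto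
        show "continuous_on {q..q + 1 / real n} (?k q n)"
          by (intro continuous_on_mult continuous_on_compose2[OF \<beta>(1)] continuous_intros continuous_on_subset[OF cont])
            (use that in auto)
        show "?k q n r = 0" if "r \<notin> {q..q + 1 / real n}" for r
          using scaled_kernel_outside[of \<beta> n r q, OF \<beta>(3) _ that] large[OF \<open>n \<ge> max 1 N\<close>] by simp
      qed
      show ?thesis
        using Bochner_Integration.integral_diff[OF int[of a] int[of "p n"]] large[OF that] p_less[OF that]
        by (simp add: deriv left_diff_distrib)
    qed
    then show "\<forall>\<^sub>F n in sequentially. (LINT r|lebesgue_on ?S. ?k a n r) - (LINT r|lebesgue_on ?S. ?k (p n) n r)
        = (LINT r|lebesgue_on ?S. deriv (\<psi> n) r * \<phi> r)"
      unfolding eventually_sequentially by blast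
  qed
  have right: "(\<lambda>n. LINT r|lebesgue_on ?S. \<psi> n r * \<gamma> r) \<longlonglongrightarrow> (LINT r|lebesgue_on ?S. indicat_real ?S' r * \<gamma> r)"
  proof (rule integral_dominated_convergence)
    show "integrable (lebesgue_on ?S) (\<lambda>r. \<bar>\<gamma> r\<bar>)" using \<gamma> by simp
    have ind: "indicat_real ?S' \<in> borel_measurable (lebesgue_on ?S)"
      by (intro measurable_restrict_space1 borel_measurable_indicator) simp
    then show "(\<lambda>r. indicat_real ?S' r * \<gamma> r) \<in> borel_measurable (lebesgue_on ?S)"
      using \<gamma> by (intro borel_measurable_times) auto
    have "continuous_on UNIV (\<psi> n)" for n by (rule DERIV_continuous_on[OF has_field_derivative_at_within[OF D]])
    then have "\<psi> n \<in> borel_measurable borel" for n by (rule borel_measurable_continuous_onI)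
    then have "\<psi> n \<in> borel_measurable (lebesgue_on ?S)" for n
      by (intro measurable_restrict_space1 measurable_completion) simp
    then show "(\<lambda>r. \<psi> n r * \<gamma> r) \<in> borel_measurable (lebesgue_on ?S)" for n
      using \<gamma> by (intro borel_measurable_times) auto
    have "\<bar>\<psi> n r\<bar> \<le> 1" for n r
      using \<Phi>(2)[of "real n * (r - a)"] \<Phi>(2)[of "real n * (r - p n)"] by (auto simp: \<psi>_def abs_le_iff)
    then show "AE r in lebesgue_on ?S. norm (\<psi> n r * \<gamma> r) \<le> \<bar>\<gamma> r\<bar>" for n
      by (intro AE_I2) (auto simp: abs_mult intro: mult_left_le_one_le)
    have "(\<lambda>n. \<psi> n r) \<longlonglongrightarrow> indicat_real ?S' r" for r
    proof -
      consider "r \<le> a" | "a < r" "r < b" | "b \<le> r" by linarith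
      then have "\<forall>\<^sub>F n in sequentially. \<psi> n r = indicat_real ?S' r"
      proof cases
        case 1
        have "\<psi> n r = 0" if "n \<ge> max 1 N" for n
        proof -
          have "real n * (r - a) \<le> 0" "real n * (r - p n) \<le> 0"
            using large[OF that] 1 by (auto simp: mult_le_0_iff)
          then show ?thesis using \<Phi>(3) by (simp add: \<psi>_def)
        qed
        then show ?thesis
          using 1 unfolding eventually_sequentially by (intro exI[of _ "max 1 N"]) auto
      next
        case 2
        have "\<forall>\<^sub>F n in sequentially. r < p n" using order_tendstoD(1)[OF p] 2 by simp
        moreover have "\<forall>\<^sub>F n in sequentially. 1 / (r - a) \<le> real n"
          using filterlim_real_sequentially by (auto simp: filterlim_at_top)
        ultimately show ?thesis
        proof eventually_elim
          case (elim n)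
          then have "real n * (r - a) \<ge> 1" "real n * (r - p n) \<le> 0"
            using 2 by (simp_all add: pos_divide_le_eq mult_le_0_iff)
          then show ?case using 2 \<Phi>(3,4) by (simp add: \<psi>_def)
        qed
      next
        case 3
        have "\<psi> n r = 0" if "n \<ge> max 1 N" for n
        proof -
          have n: "real n > 0" "a \<le> p n" using large[OF that] by auto
          have "1 / real n \<le> 2 / real n" by (simp add: divide_right_mono)
          then have "1 / real n \<le> r - p n" using 3 unfolding p_def by linarith
          then have "real n * (r - p n) \<ge> 1" using n(1) by (simp add: field_simps)
          moreover have "real n * (r - p n) \<le> real n * (r - a)" using n by simp
          ultimately show ?thesis using \<Phi>(4) by (simp add: \<psi>_def)
        qed
        then show ?thesis
          using 3 unfolding eventually_sequentially by (intro exI[of _ "max 1 N"]) auto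
      qed
      then show ?thesis by (rule tendsto_eventually)
    qed
    then show "AE r in lebesgue_on ?S. (\<lambda>n. \<psi> n r * \<gamma> r) \<longlonglongrightarrow> indicat_real ?S' r * \<gamma> r"
      by (intro AE_I2 tendsto_mult tendsto_const)
  qed
  have "(\<lambda>n. LINT r|lebesgue_on ?S. deriv (\<psi> n) r * \<phi> r) \<longlonglongrightarrow> - (LINT r|lebesgue_on ?S. indicat_real ?S' r * \<gamma> r)"
    by (rule Lim_transform_eventually[OF tendsto_minus[OF right]])
      (use weak[OF test] in \<open>auto simp: eventually_sequentially intro!: exI[of _ "max 1 N"]\<close>)
  then have "\<phi> b - \<phi> a = (LINT r|lebesgue_on ?S. indicat_real ?S' r * \<gamma> r)"
    using LIMSEQ_unique[OF left] by fastforce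
  also have "\<dots> = (LINT r|lebesgue. indicat_real ?S r * (indicat_real ?S' r * \<gamma> r))"
    by (subst integral_restrict_space) auto
  also have "\<dots> = (LINT r|lebesgue. indicat_real ?S' r * \<gamma> r)"
    using assms(1,3) by (intro Bochner_Integration.integral_cong refl) (auto simp: indicator_def)
  also have "\<dots> = (LINT r|lebesgue_on ?S'. \<gamma> r)"
    by (subst integral_restrict_space) auto
  finally show ?thesis .
qed

section \<open>Functions of time with values in a space of square-integrable functions\<close>

lemma finite_measure_lebesgue_on_Ioo: "finite_measure (lebesgue_on {a<..<b :: real})"
  by (intro finite_measure_lebesgue_on) (metis box_real(1) lmeasurable_box)

lemma pair_sigma_finite_lebesgue_on:
  assumes "\<Omega> \<in> lmeasurable"
  shows "pair_sigma_finite (lebesgue_on {a<..<b :: real}) (lebesgue_on \<Omega>)"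
proof -
  interpret N: finite_measure "lebesgue_on {a<..<b :: real}" by (rule finite_measure_lebesgue_on_Ioo)
  interpret M: finite_measure "lebesgue_on \<Omega>" by (rule finite_measure_lebesgue_on[OF assms])
  show ?thesis ..
qed

lemma product_l2_integrable:
  fixes z :: "real \<Rightarrow> real ^ 'd \<Rightarrow> real" and a b :: real
  defines "N \<equiv> lebesgue_on {a<..<b}"
  assumes \<Omega>: "\<Omega> \<in> lmeasurable" and z: "(\<lambda>(r, x). z r x) \<in> borel_measurable (N \<Otimes>\<^sub>M lebesgue_on \<Omega>)"
    and h: "h \<in> l2 \<Omega>" and \<rho>: "\<rho> \<in> borel_measurable N"
    and bound: "AE r in N. z r \<in> l2 \<Omega> \<and> \<bar>\<rho> r\<bar> * l2_norm \<Omega> (z r) \<le> c r" and c: "integrable N c"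
  shows "integrable (N \<Otimes>\<^sub>M lebesgue_on \<Omega>) (\<lambda>(r, x). \<rho> r * z r x * h x)"
proof -
  interpret pair_sigma_finite N "lebesgue_on \<Omega>"
    unfolding N_def by (rule pair_sigma_finite_lebesgue_on[OF \<Omega>])
  note [measurable] = z \<rho> l2_measurable[OF h]
  let ?f = "\<lambda>(r, x). \<rho> r * z r x * h x"
  have meas: "?f \<in> borel_measurable (N \<Otimes>\<^sub>M lebesgue_on \<Omega>)" by measurable
  have "(\<integral>\<^sup>+p. ennreal (norm (?f p)) \<partial>(N \<Otimes>\<^sub>M lebesgue_on \<Omega>))
      = (\<integral>\<^sup>+r. \<integral>\<^sup>+x. ennreal (norm (?f (r, x))) \<partial>lebesgue_on \<Omega> \<partial>N)"
    using meas by (intro M2.nn_integral_fst[symmetric]) measurable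
  also have "\<dots> \<le> (\<integral>\<^sup>+r. ennreal (c r * l2_norm \<Omega> h) \<partial>N)"
  proof (rule nn_integral_mono_AE)
    show "AE r in N. (\<integral>\<^sup>+x. ennreal (norm (?f (r, x))) \<partial>lebesgue_on \<Omega>) \<le> ennreal (c r * l2_norm \<Omega> h)"
      using bound
    proof eventually_elim
      case (elim r)
      have "(\<integral>\<^sup>+x. ennreal (norm (?f (r, x))) \<partial>lebesgue_on \<Omega>) = (\<integral>\<^sup>+x. ennreal \<bar>\<rho> r * z r x * h x\<bar> \<partial>lebesgue_on \<Omega>)"
        by simp
      also have "\<dots> \<le> ennreal (l2_norm \<Omega> (\<lambda>x. \<rho> r * z r x) * l2_norm \<Omega> h)"
        using elim by (intro nn_integral_product_l2 l2_cmult h) simp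
      also have "l2_norm \<Omega> (\<lambda>x. \<rho> r * z r x) = \<bar>\<rho> r\<bar> * l2_norm \<Omega> (z r)"
        by (simp add: l2_norm_def l2_inner_cmult_left l2_inner_cmult_right real_sqrt_mult mult.assoc[symmetric])
      also have "ennreal (\<bar>\<rho> r\<bar> * l2_norm \<Omega> (z r) * l2_norm \<Omega> h) \<le> ennreal (c r * l2_norm \<Omega> h)"
        using elim by (intro ennreal_leI mult_right_mono l2_norm_nonneg) simp
      finally show ?case .
    qed
  qed
  also have "\<dots> \<le> (\<integral>\<^sup>+r. ennreal (norm (c r * l2_norm \<Omega> h)) \<partial>N)"
    by (intro nn_integral_mono ennreal_leI) simp
  also have "\<dots> < \<infinity>"
    using integrable_mult_left[of "l2_norm \<Omega> h" N c] c unfolding integrable_iff_bounded by blast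
  finally show ?thesis using meas by (simp add: integrable_iff_bounded)
qed

text \<open>
  Inner products commute with weighted time integrals, by Fubini's theorem. The integrable bound \<open>c\<close> of
  \<open>r \<mapsto> \<bar>\<rho> r\<bar> \<parallel>z r\<parallel>\<close> covers both bounded functions and singular weights.
\<close>

lemma l2_inner_time_integral:
  fixes z :: "real \<Rightarrow> real ^ 'd \<Rightarrow> real" and a b :: real
  defines "N \<equiv> lebesgue_on {a<..<b}"
  assumes \<Omega>: "\<Omega> \<in> lmeasurable" and z: "(\<lambda>(r, x). z r x) \<in> borel_measurable (N \<Otimes>\<^sub>M lebesgue_on \<Omega>)"
    and h: "h \<in> l2 \<Omega>" and \<rho>: "\<rho> \<in> borel_measurable N"
    and bound: "AE r in N. z r \<in> l2 \<Omega> \<and> \<bar>\<rho> r\<bar> * l2_norm \<Omega> (z r) \<le> c r" and c: "integrable N c"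
  shows "integrable N (\<lambda>r. \<rho> r * l2_inner \<Omega> (z r) h)"
    and "integrable (lebesgue_on \<Omega>) (\<lambda>x. (LINT r|N. \<rho> r * z r x) * h x)"
    and "l2_inner \<Omega> (\<lambda>x. LINT r|N. \<rho> r * z r x) h = (LINT r|N. \<rho> r * l2_inner \<Omega> (z r) h)"
proof -
  interpret pair_sigma_finite N "lebesgue_on \<Omega>"
    unfolding N_def by (rule pair_sigma_finite_lebesgue_on[OF \<Omega>])
  have int: "integrable (N \<Otimes>\<^sub>M lebesgue_on \<Omega>) (\<lambda>(r, x). \<rho> r * z r x * h x)"
    using product_l2_integrable[OF \<Omega>] assms(3-) unfolding N_def by blast
  show "integrable N (\<lambda>r. \<rho> r * l2_inner \<Omega> (z r) h)"
    using integrable_fst[OF int] by (simp add: l2_inner_def mult.assoc)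
  show "integrable (lebesgue_on \<Omega>) (\<lambda>x. (LINT r|N. \<rho> r * z r x) * h x)"
    using integrable_snd[OF int] by simp
  show "l2_inner \<Omega> (\<lambda>x. LINT r|N. \<rho> r * z r x) h = (LINT r|N. \<rho> r * l2_inner \<Omega> (z r) h)"
  proof -
    have "l2_inner \<Omega> (\<lambda>x. LINT r|N. \<rho> r * z r x) h = (LINT x|lebesgue_on \<Omega>. LINT r|N. \<rho> r * z r x * h x)"
      by (simp add: l2_inner_def)
    also have "\<dots> = (LINT r|N. LINT x|lebesgue_on \<Omega>. \<rho> r * z r x * h x)"
      by (rule Fubini_integral[OF int])
    finally show ?thesis by (simp add: l2_inner_def mult.assoc)
  qed
qed

lemma lebesgue_on_pair_mono:
  fixes F :: "real \<times> 'b::euclidean_space \<Rightarrow> real"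
  assumes "F \<in> borel_measurable (lebesgue_on S \<Otimes>\<^sub>M lebesgue_on \<Omega>)" "S' \<subseteq> S"
  shows "F \<in> borel_measurable (lebesgue_on S' \<Otimes>\<^sub>M lebesgue_on \<Omega>)"
proof -
  have "(\<lambda>x. x) \<in> lebesgue_on S' \<rightarrow>\<^sub>M lebesgue_on S"
    using assms(2) by (intro measurable_restrict_space2 measurable_restrict_space1) (auto simp: space_restrict_space)
  then have "(\<lambda>p. (fst p, snd p)) \<in> (lebesgue_on S' \<Otimes>\<^sub>M lebesgue_on \<Omega>) \<rightarrow>\<^sub>M (lebesgue_on S \<Otimes>\<^sub>M lebesgue_on \<Omega>)"
    by (intro measurable_Pair measurable_snd measurable_compose[OF measurable_fst])
  from measurable_compose[OF this assms(1)] show ?thesis by simp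
qed

lemma AE_Ioo_mono:
  assumes "AE t in lebesgue_on {a<..<b}. P t" "a \<le> a'" "b' \<le> (b :: real)"
  shows "AE t in lebesgue_on {a'<..<b'}. P t"
proof -
  have "AE t in lebesgue. t \<in> {a<..<b} \<longrightarrow> P t"
    using assms(1) by (subst (asm) AE_restrict_space_iff) auto
  then have "AE t in lebesgue. t \<in> {a'<..<b'} \<longrightarrow> P t"
    by eventually_elim (use assms(2,3) in auto)
  then show ?thesis by (subst AE_restrict_space_iff) auto
qed

lemma Linf_l2_mono:
  assumes "y \<in> Linf_l2 \<Omega> a b" "a \<le> a'" "b' \<le> b"
  shows "y \<in> Linf_l2 \<Omega> a' b'"
proof -
  have sub: "{a'<..<b'} \<subseteq> {a<..<b}" using assms(2,3) by auto
  obtain C where C: "AE t in lebesgue_on {a<..<b}. y t \<in> l2 \<Omega> \<and> l2_norm \<Omega> (y t) \<le> C"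
    using assms(1) by (auto simp: Linf_l2_def)
  then have "AE t in lebesgue_on {a'<..<b'}. y t \<in> l2 \<Omega> \<and> l2_norm \<Omega> (y t) \<le> C"
    by (rule AE_Ioo_mono[OF _ assms(2,3)])
  then show ?thesis using assms(1) lebesgue_on_pair_mono[OF _ sub] by (auto simp: Linf_l2_def)
qed

lemma Linf_l2_bound:
  assumes "y \<in> Linf_l2 \<Omega> a b"
  obtains C where "C \<ge> 0" "AE t in lebesgue_on {a<..<b}. y t \<in> l2 \<Omega> \<and> l2_norm \<Omega> (y t) \<le> C"
proof -
  obtain C where C: "AE t in lebesgue_on {a<..<b}. y t \<in> l2 \<Omega> \<and> l2_norm \<Omega> (y t) \<le> C"
    using assms by (auto simp: Linf_l2_def)
  then have "AE t in lebesgue_on {a<..<b}. y t \<in> l2 \<Omega> \<and> l2_norm \<Omega> (y t) \<le> max 0 C"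
    by eventually_elim auto
  then show thesis using that[of "max 0 C"] by simp
qed

lemma Linf_l2_diff:
  assumes "y \<in> Linf_l2 \<Omega> a b" "z \<in> Linf_l2 \<Omega> a b"
  shows "(\<lambda>t x. y t x - z t x) \<in> Linf_l2 \<Omega> a b"
proof -
  obtain C where C: "AE t in lebesgue_on {a<..<b}. y t \<in> l2 \<Omega> \<and> l2_norm \<Omega> (y t) \<le> C"
    using Linf_l2_bound[OF assms(1)] by blast
  obtain D where D: "AE t in lebesgue_on {a<..<b}. z t \<in> l2 \<Omega> \<and> l2_norm \<Omega> (z t) \<le> D"
    using Linf_l2_bound[OF assms(2)] by blast
  have "AE t in lebesgue_on {a<..<b}. (\<lambda>x. y t x - z t x) \<in> l2 \<Omega> \<and> l2_norm \<Omega> (\<lambda>x. y t x - z t x) \<le> C + D"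
    using C D
  proof eventually_elim
    case (elim t)
    then show ?case using l2_norm_diff_le[of "y t" \<Omega> "z t"] by (auto intro: l2_diff)
  qed
  moreover have "(\<lambda>p. (\<lambda>(t, x). y t x) p - (\<lambda>(t, x). z t x) p) \<in> borel_measurable (lebesgue_on {a<..<b} \<Otimes>\<^sub>M lebesgue_on \<Omega>)"
    using assms by (intro borel_measurable_diff) (auto simp: Linf_l2_def)
  ultimately show ?thesis by (auto simp: Linf_l2_def case_prod_beta)
qed

lemma Linf_l2_inner_integrable:
  assumes "\<Omega> \<in> lmeasurable" "z \<in> Linf_l2 \<Omega> a b" "h \<in> l2 \<Omega>"
  shows "integrable (lebesgue_on {a<..<b}) (\<lambda>r. l2_inner \<Omega> (z r) h)"
proof -
  interpret N: finite_measure "lebesgue_on {a<..<b}" by (rule finite_measure_lebesgue_on_Ioo)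
  obtain C where "AE t in lebesgue_on {a<..<b}. z t \<in> l2 \<Omega> \<and> l2_norm \<Omega> (z t) \<le> C"
    using Linf_l2_bound[OF assms(2)] by blast
  then show ?thesis
    using l2_inner_time_integral(1)[OF assms(1) _ assms(3), of z a b "\<lambda>_. 1" "\<lambda>_. C"] assms(2)
    by (simp add: Linf_l2_def)
qed

lemma C_l2_l2: "y \<in> C_l2 \<Omega> T \<Longrightarrow> t \<in> {0..T} \<Longrightarrow> y t \<in> l2 \<Omega>"
  by (simp add: C_l2_def)

lemma continuous_on_l2_inner:
  assumes "y \<in> C_l2 \<Omega> T" "h \<in> l2 \<Omega>"
  shows "continuous_on {0..T} (\<lambda>r. l2_inner \<Omega> (y r) h)"
  unfolding continuous_on_def
proof
  fix t assume t: "t \<in> {0..T}"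
  have "((\<lambda>s. l2_inner \<Omega> (y s) h - l2_inner \<Omega> (y t) h) \<longlongrightarrow> 0) (at t within {0..T})"
  proof (rule Lim_null_comparison)
    show "\<forall>\<^sub>F s in at t within {0..T}. norm (l2_inner \<Omega> (y s) h - l2_inner \<Omega> (y t) h) \<le> l2_norm \<Omega> (\<lambda>x. y s x - y t x) * l2_norm \<Omega> h"
      unfolding eventually_at_filter
      using l2_Cauchy_Schwarz[OF l2_diff[OF C_l2_l2[OF assms(1)] C_l2_l2[OF assms(1) t]] assms(2)] assms C_l2_l2[OF assms(1)] t
      by (intro always_eventually) (auto simp: l2_inner_diff_left)
    show "((\<lambda>s. l2_norm \<Omega> (\<lambda>x. y s x - y t x) * l2_norm \<Omega> h) \<longlongrightarrow> 0) (at t within {0..T})"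
      using assms(1) t by (intro tendsto_mult_left_zero) (simp add: C_l2_def)
  qed
  then show "((\<lambda>s. l2_inner \<Omega> (y s) h) \<longlongrightarrow> l2_inner \<Omega> (y t) h) (at t within {0..T})"
    by (simp add: LIM_zero_iff)
qed

lemma continuous_on_l2_norm:
  assumes "y \<in> C_l2 \<Omega> T"
  shows "continuous_on {0..T} (\<lambda>r. l2_norm \<Omega> (y r))"
  unfolding continuous_on_def
proof
  fix t assume t: "t \<in> {0..T}"
  have "((\<lambda>s. l2_norm \<Omega> (y s) - l2_norm \<Omega> (y t)) \<longlongrightarrow> 0) (at t within {0..T})"
  proof (rule Lim_null_comparison)
    show "\<forall>\<^sub>F s in at t within {0..T}. norm (l2_norm \<Omega> (y s) - l2_norm \<Omega> (y t)) \<le> l2_norm \<Omega> (\<lambda>x. y s x - y t x)"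
      unfolding eventually_at_filter
      using l2_norm_reverse_triangle[OF C_l2_l2[OF assms] C_l2_l2[OF assms t]]
      by (intro always_eventually) auto
    show "((\<lambda>s. l2_norm \<Omega> (\<lambda>x. y s x - y t x)) \<longlongrightarrow> 0) (at t within {0..T})"
      using assms t by (simp add: C_l2_def)
  qed
  then show "((\<lambda>s. l2_norm \<Omega> (y s)) \<longlongrightarrow> l2_norm \<Omega> (y t)) (at t within {0..T})"
    by (simp add: LIM_zero_iff)
qed

lemma C_l2_diff:
  assumes "y \<in> C_l2 \<Omega> T" "z \<in> C_l2 \<Omega> T"
  shows "(\<lambda>t x. y t x - z t x) \<in> C_l2 \<Omega> T"
  unfolding C_l2_def
proof (intro CollectI ballI conjI)
  fix t assume t: "t \<in> {0..T}"
  show "(\<lambda>x. y t x - z t x) \<in> l2 \<Omega>" using assms t by (intro l2_diff C_l2_l2)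
  show "((\<lambda>s. l2_norm \<Omega> (\<lambda>x. (y s x - z s x) - (y t x - z t x))) \<longlongrightarrow> 0) (at t within {0..T})"
  proof (rule tendsto_sandwich[OF _ _ tendsto_const])
    have "((\<lambda>s. l2_norm \<Omega> (\<lambda>x. y s x - y t x) + l2_norm \<Omega> (\<lambda>x. z s x - z t x)) \<longlongrightarrow> 0 + 0) (at t within {0..T})"
      using assms t by (intro tendsto_add) (auto simp: C_l2_def)
    then show "((\<lambda>s. l2_norm \<Omega> (\<lambda>x. y s x - y t x) + l2_norm \<Omega> (\<lambda>x. z s x - z t x)) \<longlongrightarrow> 0) (at t within {0..T})"
      by simp
    have "l2_norm \<Omega> (\<lambda>x. (y s x - z s x) - (y t x - z t x))
        \<le> l2_norm \<Omega> (\<lambda>x. y s x - y t x) + l2_norm \<Omega> (\<lambda>x. z s x - z t x)" if "s \<in> {0..T}" for s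
      using l2_norm_diff_le[OF l2_diff[OF C_l2_l2[OF assms(1) that] C_l2_l2[OF assms(1) t]]
        l2_diff[OF C_l2_l2[OF assms(2) that] C_l2_l2[OF assms(2) t]]] by (simp add: algebra_simps)
    then show "\<forall>\<^sub>F s in at t within {0..T}. l2_norm \<Omega> (\<lambda>x. (y s x - z s x) - (y t x - z t x))
        \<le> l2_norm \<Omega> (\<lambda>x. y s x - y t x) + l2_norm \<Omega> (\<lambda>x. z s x - z t x)"
      unfolding eventually_at_filter by (intro always_eventually) auto
  qed (simp add: l2_norm_nonneg)
qed

text \<open>
  The consequences of regularity in time that are used below, with the weak derivative in integrated form.
  In contrast to the definition by test functions, this form is evidently preserved under differences, and
  it makes increments of \<open>y\<close> directly accessible.
\<close>

definition l2_weakly_differentiable ::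
  "(real ^ 'd) set \<Rightarrow> real \<Rightarrow> (real \<Rightarrow> real ^ 'd \<Rightarrow> real) \<Rightarrow> (real \<Rightarrow> real ^ 'd \<Rightarrow> real) \<Rightarrow> bool" where
  "l2_weakly_differentiable \<Omega> T y y' \<longleftrightarrow> y \<in> C_l2 \<Omega> T \<and>
     (\<forall>\<epsilon>\<in>{0<..T}. y \<in> Linf_l2 \<Omega> \<epsilon> T \<and> y' \<in> Linf_l2 \<Omega> \<epsilon> T) \<and>
     (\<forall>h\<in>l2 \<Omega>. \<forall>a b. 0 < a \<longrightarrow> a < b \<longrightarrow> b \<le> T \<longrightarrow>
        l2_inner \<Omega> (\<lambda>x. y b x - y a x) h = (LINT r|lebesgue_on {a<..<b}. l2_inner \<Omega> (y' r) h))"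

lemma test_function_deriv:
  fixes \<psi> :: "real \<Rightarrow> real"
  assumes "\<psi> \<in> test_functions S"
  shows "deriv \<psi> \<in> test_functions S"
proof -
  have "frechet_derivative \<psi> (at x) 1 = deriv \<psi> x" for x
    using frechet_derivative_at[OF has_field_derivative_imp_has_derivative[OF
      C_k_real_SucD(1)[OF test_function_C_k[OF assms, of "Suc 0"]]], of x] by (metis mult.right_neutral)
  then show ?thesis using test_function_partial[OF assms, of 1] by simp
qed

text \<open>
  The identity that defines the weak derivative holds for almost every \<open>x\<close>, with an exceptional set that depends
  on \<open>\<psi>\<close>. After multiplication by \<open>h\<close> and integration over \<open>\<Omega>\<close>, Fubini's theorem turns it into the same
  identity for the real function \<open>r \<mapsto> \<langle>y r, h\<rangle>\<close>, without an exceptional set.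
\<close>

lemma weak_derivative_l2_inner:
  assumes \<Omega>: "\<Omega> \<in> lmeasurable" and W: "has_W1inf_deriv \<Omega> \<epsilon> T y y'" and h: "h \<in> l2 \<Omega>"
    and \<psi>: "\<psi> \<in> test_functions {\<epsilon><..<T}"
  shows "(LINT r|lebesgue_on {\<epsilon><..<T}. deriv \<psi> r * l2_inner \<Omega> (y r) h)
    = - (LINT r|lebesgue_on {\<epsilon><..<T}. \<psi> r * l2_inner \<Omega> (y' r) h)"
proof -
  let ?N = "lebesgue_on {\<epsilon><..<T}"
  interpret N: finite_measure ?N by (rule finite_measure_lebesgue_on_Ioo)
  have weighted: "integrable (lebesgue_on \<Omega>) (\<lambda>x. (LINT r|?N. \<rho> r * z r x) * h x)
      \<and> l2_inner \<Omega> (\<lambda>x. LINT r|?N. \<rho> r * z r x) h = (LINT r|?N. \<rho> r * l2_inner \<Omega> (z r) h)"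
    if z: "z \<in> Linf_l2 \<Omega> \<epsilon> T" and \<rho>: "\<rho> \<in> test_functions {\<epsilon><..<T}" for \<rho> z
  proof -
    obtain C where C: "C \<ge> 0" "AE r in ?N. z r \<in> l2 \<Omega> \<and> l2_norm \<Omega> (z r) \<le> C"
      using Linf_l2_bound[OF z] by blast
    obtain B where B: "B \<ge> 0" "\<And>r. \<bar>\<rho> r\<bar> \<le> B" using test_function_bounded[OF \<rho>] by blast
    have meas: "\<rho> \<in> borel_measurable ?N"
      using test_function_continuous[OF \<rho>]
      by (intro measurable_restrict_space1 measurable_completion) (simp add: borel_measurable_continuous_onI)
    have bound: "AE r in ?N. z r \<in> l2 \<Omega> \<and> \<bar>\<rho> r\<bar> * l2_norm \<Omega> (z r) \<le> B * C"
      using C(2) by eventually_elim (use B in \<open>auto intro!: mult_mono simp: l2_norm_nonneg\<close>)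
    have "(\<lambda>(r, x). z r x) \<in> borel_measurable (?N \<Otimes>\<^sub>M lebesgue_on \<Omega>)"
      using z by (simp add: Linf_l2_def)
    from l2_inner_time_integral(2,3)[OF \<Omega> this h meas bound] show ?thesis by simp
  qed
  have y: "y \<in> Linf_l2 \<Omega> \<epsilon> T" "y' \<in> Linf_l2 \<Omega> \<epsilon> T" using W by (auto simp: has_W1inf_deriv_def)
  note w1 = weighted[OF y(1) test_function_deriv[OF \<psi>]] and w2 = weighted[OF y(2) \<psi>]
  have "AE x in lebesgue_on \<Omega>. (LINT r|?N. deriv \<psi> r * y r x) = - (LINT r|?N. \<psi> r * y' r x)"
    using W \<psi> by (simp add: has_W1inf_deriv_def)
  then have "AE x in lebesgue_on \<Omega>. (LINT r|?N. deriv \<psi> r * y r x) * h x = - ((LINT r|?N. \<psi> r * y' r x) * h x)"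
    by eventually_elim simp
  then have "(LINT x|lebesgue_on \<Omega>. (LINT r|?N. deriv \<psi> r * y r x) * h x)
      = (LINT x|lebesgue_on \<Omega>. - ((LINT r|?N. \<psi> r * y' r x) * h x))"
    using w1 w2 by (intro integral_cong_AE) auto
  then have "l2_inner \<Omega> (\<lambda>x. LINT r|?N. deriv \<psi> r * y r x) h = - l2_inner \<Omega> (\<lambda>x. LINT r|?N. \<psi> r * y' r x) h"
    by (simp add: l2_inner_def)
  with w1 w2 show ?thesis by simp
qed

lemma regular_imp_weakly_differentiable:
  assumes \<Omega>: "\<Omega> \<in> lmeasurable" and reg: "regular \<Omega> T y y'"
  shows "l2_weakly_differentiable \<Omega> T y y'"
proof -
  have C: "y \<in> C_l2 \<Omega> T" and W: "\<And>\<epsilon>. \<epsilon> \<in> {0<..T} \<Longrightarrow> has_W1inf_deriv \<Omega> \<epsilon> T y y'"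
    using reg by (auto simp: regular_def)
  have "l2_inner \<Omega> (\<lambda>x. y b x - y a x) h = (LINT r|lebesgue_on {a<..<b}. l2_inner \<Omega> (y' r) h)"
    if h: "h \<in> l2 \<Omega>" and ab: "0 < a" "a < b" "b \<le> T" for h a b
  proof -
    have W': "has_W1inf_deriv \<Omega> (a / 2) T y y'" using ab by (intro W) auto
    have "l2_inner \<Omega> (y b) h - l2_inner \<Omega> (y a) h = (LINT r|lebesgue_on {a<..<b}. l2_inner \<Omega> (y' r) h)"
    proof (rule weak_derivative_imp_integral)
      show "continuous_on {a..b} (\<lambda>r. l2_inner \<Omega> (y r) h)"
        using ab by (intro continuous_on_subset[OF continuous_on_l2_inner[OF C h]]) auto
      show "integrable (lebesgue_on {a / 2<..<T}) (\<lambda>r. l2_inner \<Omega> (y' r) h)"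
        using W' by (intro Linf_l2_inner_integrable \<Omega> h) (simp add: has_W1inf_deriv_def)
    qed (use ab weak_derivative_l2_inner[OF \<Omega> W' h] in auto)
    then show ?thesis using ab h C_l2_l2[OF C] by (simp add: l2_inner_diff_left)
  qed
  then show ?thesis using C W unfolding l2_weakly_differentiable_def by (auto simp: has_W1inf_deriv_def)
qed

lemma weakly_differentiable_diff:
  assumes \<Omega>: "\<Omega> \<in> lmeasurable" and y: "l2_weakly_differentiable \<Omega> T y y'" and z: "l2_weakly_differentiable \<Omega> T z z'"
  shows "l2_weakly_differentiable \<Omega> T (\<lambda>t x. y t x - z t x) (\<lambda>t x. y' t x - z' t x)"
  unfolding l2_weakly_differentiable_def
proof (intro conjI ballI allI impI)
  show "(\<lambda>t x. y t x - z t x) \<in> C_l2 \<Omega> T"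
    using y z by (intro C_l2_diff) (auto simp: l2_weakly_differentiable_def)
  show "(\<lambda>t x. y t x - z t x) \<in> Linf_l2 \<Omega> \<epsilon> T" "(\<lambda>t x. y' t x - z' t x) \<in> Linf_l2 \<Omega> \<epsilon> T" if "\<epsilon> \<in> {0<..T}" for \<epsilon>
    using y z that by (auto intro!: Linf_l2_diff simp: l2_weakly_differentiable_def)
  fix h a b assume h: "h \<in> l2 \<Omega>" and ab: "0 < a" "a < b" "b \<le> T"
  let ?N = "lebesgue_on {a<..<b}"
  have Li: "y' \<in> Linf_l2 \<Omega> a b" "z' \<in> Linf_l2 \<Omega> a b"
    using y z ab by (auto intro!: Linf_l2_mono[of _ \<Omega> a T a b] simp: l2_weakly_differentiable_def)
  have l2: "y b \<in> l2 \<Omega>" "y a \<in> l2 \<Omega>" "z b \<in> l2 \<Omega>" "z a \<in> l2 \<Omega>"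
    using y z ab by (auto intro!: C_l2_l2[of _ \<Omega> T] simp: l2_weakly_differentiable_def)
  obtain C where C: "AE t in ?N. y' t \<in> l2 \<Omega> \<and> l2_norm \<Omega> (y' t) \<le> C"
    using Linf_l2_bound[OF Li(1)] by blast
  obtain D where D: "AE t in ?N. z' t \<in> l2 \<Omega> \<and> l2_norm \<Omega> (z' t) \<le> D"
    using Linf_l2_bound[OF Li(2)] by blast
  from C D  have ae: "AE r in ?N. l2_inner \<Omega> (\<lambda>x. y' r x - z' r x) h = l2_inner \<Omega> (y' r) h - l2_inner \<Omega> (z' r) h"
    by eventually_elim (simp add: l2_inner_diff_left h)
  have "l2_inner \<Omega> (\<lambda>x. (y b x - z b x) - (y a x - z a x)) h
      = l2_inner \<Omega> (\<lambda>x. y b x - y a x) h - l2_inner \<Omega> (\<lambda>x. z b x - z a x) h"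
    by (simp add: l2_inner_diff_left l2 l2_diff h)
  also have "\<dots> = (LINT r|?N. l2_inner \<Omega> (y' r) h) - (LINT r|?N. l2_inner \<Omega> (z' r) h)"
    using y z h ab by (simp add: l2_weakly_differentiable_def)
  also have "\<dots> = (LINT r|?N. l2_inner \<Omega> (y' r) h - l2_inner \<Omega> (z' r) h)"
    by (rule Bochner_Integration.integral_diff[symmetric]; rule Linf_l2_inner_integrable[OF \<Omega> _ h]; rule Li)
  also have "\<dots> = (LINT r|?N. l2_inner \<Omega> (\<lambda>x. y' r x - z' r x) h)"
    using ae by (intro integral_cong_AE borel_measurable_integrable Bochner_Integration.integrable_diff
        Linf_l2_inner_integrable[OF \<Omega> _ h] Linf_l2_diff Li) auto
  finally show "l2_inner \<Omega> (\<lambda>x. (y b x - z b x) - (y a x - z a x)) h = (LINT r|?N. l2_inner \<Omega> (\<lambda>x. y' r x - z' r x) h)" .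
qed

lemma LINT_le_const_Ioo:
  assumes "integrable (lebesgue_on {a<..<b}) f" "AE r in lebesgue_on {a<..<b}. f r \<le> c" "a \<le> b"
  shows "(LINT r|lebesgue_on {a<..<b}. f r) \<le> c * (b - a :: real)"
proof -
  interpret N: finite_measure "lebesgue_on {a<..<b}" by (rule finite_measure_lebesgue_on_Ioo)
  have "(LINT r|lebesgue_on {a<..<b}. f r) \<le> (LINT r|lebesgue_on {a<..<b}. c)"
    by (intro integral_mono_AE assms) simp
  also have "\<dots> = c * (b - a)"
    using assms(3) by (simp add: measure_restrict_space)
  finally show ?thesis .
qed

text \<open>
  Take \<open>h = y s - y r\<close> in the integrated identity; \<open>C\<close> is an essential bound of the weak derivative.
\<close>

lemma weakly_differentiable_lipschitz:
  assumes \<Omega>: "\<Omega> \<in> lmeasurable" and y: "l2_weakly_differentiable \<Omega> T y y'" and a: "0 < a"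
  obtains C where "C \<ge> 0" "\<And>r s. a \<le> r \<Longrightarrow> r \<le> s \<Longrightarrow> s \<le> T \<Longrightarrow> l2_norm \<Omega> (\<lambda>x. y s x - y r x) \<le> C * (s - r)"
proof (cases "a \<le> T")
  case True
  have L: "y' \<in> Linf_l2 \<Omega> a T" using y True a by (auto simp: l2_weakly_differentiable_def)
  obtain C where C: "C \<ge> 0" "AE t in lebesgue_on {a<..<T}. y' t \<in> l2 \<Omega> \<and> l2_norm \<Omega> (y' t) \<le> C"
    using Linf_l2_bound[OF L] by blast
  show thesis
  proof (rule that[OF C(1)])
    fix r s assume rs: "a \<le> r" "r \<le> s" "s \<le> T"
    show "l2_norm \<Omega> (\<lambda>x. y s x - y r x) \<le> C * (s - r)"
    proof (cases "r = s")
      case True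
      then show ?thesis by (simp add: l2_norm_def l2_inner_def)
    next
      case False
      then have "r < s" using rs by simp
      let ?h = "\<lambda>x. y s x - y r x"
      have h: "?h \<in> l2 \<Omega>"
        using y rs a by (intro l2_diff C_l2_l2[of y \<Omega> T]) (auto simp: l2_weakly_differentiable_def)
      have ae: "AE t in lebesgue_on {r<..<s}. y' t \<in> l2 \<Omega> \<and> l2_norm \<Omega> (y' t) \<le> C"
        by (rule AE_Ioo_mono[OF C(2)]) (use rs in auto)
      have "(l2_norm \<Omega> ?h)\<^sup>2 = (LINT t|lebesgue_on {r<..<s}. l2_inner \<Omega> (y' t) ?h)"
        using y h rs a \<open>r < s\<close> by (simp add: l2_norm_square l2_weakly_differentiable_def)
      also have "\<dots> \<le> (C * l2_norm \<Omega> ?h) * (s - r)"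
      proof (rule LINT_le_const_Ioo)
        show "integrable (lebesgue_on {r<..<s}) (\<lambda>t. l2_inner \<Omega> (y' t) ?h)"
          by (intro Linf_l2_inner_integrable \<Omega> h Linf_l2_mono[OF L] rs)
        show "AE t in lebesgue_on {r<..<s}. l2_inner \<Omega> (y' t) ?h \<le> C * l2_norm \<Omega> ?h"
          using ae
        proof eventually_elim
          case (elim t)
          have "l2_inner \<Omega> (y' t) ?h \<le> l2_norm \<Omega> (y' t) * l2_norm \<Omega> ?h"
            using l2_Cauchy_Schwarz[OF _ h, of "y' t"] elim by (simp add: abs_le_iff)
          also have "\<dots> \<le> C * l2_norm \<Omega> ?h" using elim by (intro mult_right_mono l2_norm_nonneg) simp
          finally show ?case .
        qed
      qed (use rs in simp)
      finally have "l2_norm \<Omega> ?h * l2_norm \<Omega> ?h \<le> (C * (s - r)) * l2_norm \<Omega> ?h"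
        by (simp add: power2_eq_square mult_ac)
      then show ?thesis
        using l2_norm_nonneg[of \<Omega> ?h] C(1) rs(2)
        by (cases "l2_norm \<Omega> ?h = 0") (auto simp: mult_le_cancel_right)
    qed
  qed
next
  case False
  then show thesis using that[of 0] by auto
qed

text \<open>
  The derivative may blow up at time \<open>0\<close>, so \<open>y\<close> need not be Lipschitz continuous there; increments that end
  at the fixed time \<open>s > 0\<close> are nevertheless bounded linearly down to \<open>r = 0\<close>. This is what the memory integral
  at time \<open>s\<close> requires.
\<close>

lemma weakly_differentiable_lipschitz_at:
  assumes \<Omega>: "\<Omega> \<in> lmeasurable" and y: "l2_weakly_differentiable \<Omega> T y y'" and s: "s \<in> {0<..T}"
  obtains K where "K \<ge> 0" "\<And>r. r \<in> {0..s} \<Longrightarrow> l2_norm \<Omega> (\<lambda>x. y s x - y r x) \<le> K * (s - r)"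
proof -
  have yC: "y \<in> C_l2 \<Omega> T" using y by (simp add: l2_weakly_differentiable_def)
  obtain C where C: "C \<ge> 0" "\<And>r t. s / 2 \<le> r \<Longrightarrow> r \<le> t \<Longrightarrow> t \<le> T \<Longrightarrow> l2_norm \<Omega> (\<lambda>x. y t x - y r x) \<le> C * (t - r)"
    using weakly_differentiable_lipschitz[OF \<Omega> y, of "s / 2"] s by auto
  have "compact ((\<lambda>r. l2_norm \<Omega> (y r)) ` {0..T})"
    by (intro compact_continuous_image continuous_on_l2_norm[OF yC]) simp
  then obtain B where B: "\<And>r. r \<in> {0..T} \<Longrightarrow> l2_norm \<Omega> (y r) \<le> B"
    by (meson bounded_imp_bdd_above compact_imp_bounded bdd_above.E imageI)
  have B0: "B \<ge> 0" using B[of s] s l2_norm_nonneg[of \<Omega> "y s"] by simp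
  \<comment> \<open>For \<open>r \<ge> s / 2\<close> the Lipschitz constant \<open>C\<close> on \<open>{s / 2..T}\<close> applies. For \<open>r < s / 2\<close> the increment is at
    most \<open>2 B\<close>, while \<open>s - r > s / 2\<close>.\<close>
  define K where "K = C + 4 * B / s"
  show thesis
  proof (rule that)
    show "K \<ge> 0" using C(1) B0 s by (simp add: K_def)
    fix r assume r: "r \<in> {0..s}"
    show "l2_norm \<Omega> (\<lambda>x. y s x - y r x) \<le> K * (s - r)"
    proof (cases "s / 2 \<le> r")
      case True
      have "l2_norm \<Omega> (\<lambda>x. y s x - y r x) \<le> C * (s - r)" using C(2)[OF True] r s by simp
      also have "\<dots> \<le> K * (s - r)" using r s B0 by (intro mult_right_mono) (auto simp: K_def)
      finally show ?thesis .
    next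
      case False
      have "l2_norm \<Omega> (\<lambda>x. y s x - y r x) \<le> l2_norm \<Omega> (y s) + l2_norm \<Omega> (y r)"
        using r s by (intro l2_norm_diff_le C_l2_l2[OF yC]) auto
      also have "\<dots> \<le> 2 * B" using B[of s] B[of r] r s by simp
      also have "\<dots> = (4 * B / s) * (s / 2)" using s by simp
      also have "\<dots> \<le> K * (s - r)" using False B0 C(1) s by (intro mult_mono) (auto simp: K_def)
      finally show ?thesis .
    qed
  qed
qed

section \<open>The energy identity\<close>

text \<open>
  With \<open>n\<close> equal steps the total increment is at most \<open>n K ((b - a) / n)\<^sup>2\<close>, which tends to \<open>0\<close>.
\<close>

lemma constant_if_quadratic_increments:
  fixes \<phi> :: "real \<Rightarrow> real"
  assumes "\<And>p q. a \<le> p \<Longrightarrow> p \<le> q \<Longrightarrow> q \<le> b \<Longrightarrow> \<bar>\<phi> q - \<phi> p\<bar> \<le> K * (q - p)\<^sup>2" "a \<le> b"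
  shows "\<phi> b = \<phi> a"
proof -
  have bound: "\<bar>\<phi> b - \<phi> a\<bar> \<le> K * (b - a)\<^sup>2 * (1 / real n)" if "n > 0" for n :: nat
  proof -
    define p where "p i = a + real i * ((b - a) / real n)" for i :: nat
    have "\<phi> b - \<phi> a = (\<Sum>i<n. \<phi> (p (Suc i)) - \<phi> (p i))"
      using that sum_lessThan_telescope[of "\<lambda>i. \<phi> (p i)" n] by (simp add: p_def)
    also have "\<bar>\<dots>\<bar> \<le> (\<Sum>i<n. \<bar>\<phi> (p (Suc i)) - \<phi> (p i)\<bar>)" by (rule sum_abs)
    also have "\<dots> \<le> (\<Sum>i<n. K * ((b - a) / real n)\<^sup>2)"
    proof (rule sum_mono)
      fix i assume i: "i \<in> {..<n}"
      have step: "p (Suc i) - p i = (b - a) / real n"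
        unfolding p_def of_nat_Suc distrib_right by simp
      have "real (Suc i) * ((b - a) / real n) \<le> real n * ((b - a) / real n)"
        using i assms(2) by (intro mult_right_mono) auto
      then have "p (Suc i) \<le> b" using that by (simp add: p_def)
      moreover have "a \<le> p i" using assms(2) by (simp add: p_def)
      moreover have "0 \<le> (b - a) / real n" using assms(2) by simp
      then have "p i \<le> p (Suc i)" using step by linarith
      ultimately show "\<bar>\<phi> (p (Suc i)) - \<phi> (p i)\<bar> \<le> K * ((b - a) / real n)\<^sup>2"
        using assms(1)[of "p i" "p (Suc i)"] step by simp
    qed
    also have "\<dots> = K * (b - a)\<^sup>2 * (1 / real n)" using that by (simp add: power2_eq_square)
    finally show ?thesis .
  qed
  have "(\<lambda>n. K * (b - a)\<^sup>2 * (1 / real n)) \<longlonglongrightarrow> K * (b - a)\<^sup>2 * 0"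
    by (intro tendsto_intros lim_1_over_n)
  then have "\<bar>\<phi> b - \<phi> a\<bar> \<le> K * (b - a)\<^sup>2 * 0"
    by (rule LIMSEQ_le_const) (use bound in \<open>auto intro!: exI[of _ 1]\<close>)
  then show ?thesis by simp
qed


lemma LINT_Icc_lebesgue:
  fixes f :: "real \<Rightarrow> real"
  shows "(LINT r:{p..q}|lebesgue. f r) = (LINT r|lebesgue_on {p<..<q}. f r)"
    and "set_integrable lebesgue {p..q} f \<longleftrightarrow> integrable (lebesgue_on {p<..<q}) f"
proof -
  have "(LINT r:{p..q}|lebesgue. f r) = (LINT r:{p<..<q}|lebesgue. f r)"
    by (rule set_integral_discrete_difference[where X = "{p, q}"]) auto
  then show "(LINT r:{p..q}|lebesgue. f r) = (LINT r|lebesgue_on {p<..<q}. f r)"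
    by (subst integral_restrict_space) (auto simp: set_lebesgue_integral_def)
  have "set_integrable lebesgue {p..q} f \<longleftrightarrow> set_integrable lebesgue {p<..<q} f"
    by (rule set_integrable_discrete_difference[where X = "{p, q}"]) auto
  then show "set_integrable lebesgue {p..q} f \<longleftrightarrow> integrable (lebesgue_on {p<..<q}) f"
    by (subst integrable_restrict_space) (auto simp: set_integrable_def)
qed

text \<open>
  The integrated identity with \<open>h = y q + y p\<close> gives
  \<open>\<parallel>y q\<parallel>\<^sup>2 - \<parallel>y p\<parallel>\<^sup>2 = \<integral> \<langle>y' r, y q + y p\<rangle> dr\<close>. Replacing \<open>y q + y p\<close> by \<open>2 y r\<close> causes an error of second order
  in \<open>q - p\<close>, because \<open>y\<close> is Lipschitz continuous and \<open>y'\<close> is bounded. So the two sides of the asserted identity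
  differ by a function with quadratic increments, which is constant.
\<close>

lemma energy_identity:
  assumes \<Omega>: "\<Omega> \<in> lmeasurable" and y: "l2_weakly_differentiable \<Omega> T y y'" and ab: "0 < a" "a \<le> b" "b \<le> T"
  shows "set_integrable lebesgue {a..b} (\<lambda>r. 2 * l2_inner \<Omega> (y' r) (y r))"
    and "\<And>p q. a \<le> p \<Longrightarrow> p \<le> q \<Longrightarrow> q \<le> b \<Longrightarrow>
      (l2_norm \<Omega> (y q))\<^sup>2 - (l2_norm \<Omega> (y p))\<^sup>2 = (LINT r:{p..q}|lebesgue. 2 * l2_inner \<Omega> (y' r) (y r))"
proof -
  interpret N: finite_measure "lebesgue_on {a<..<b}" by (rule finite_measure_lebesgue_on_Ioo)
  interpret M: finite_measure "lebesgue_on \<Omega>" by (rule finite_measure_lebesgue_on[OF \<Omega>])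
  have yC: "y \<in> C_l2 \<Omega> T" using y by (simp add: l2_weakly_differentiable_def)
  have L: "y \<in> Linf_l2 \<Omega> a b" "y' \<in> Linf_l2 \<Omega> a b"
    using y ab by (auto intro!: Linf_l2_mono[of _ \<Omega> a T a b] simp: l2_weakly_differentiable_def)
  have l2: "y r \<in> l2 \<Omega>" if "r \<in> {a..b}" for r using that ab by (intro C_l2_l2[OF yC]) auto
  obtain C where C: "C \<ge> 0" "AE t in lebesgue_on {a<..<b}. y t \<in> l2 \<Omega> \<and> l2_norm \<Omega> (y t) \<le> C"
    using Linf_l2_bound[OF L(1)] by blast
  obtain D where D: "D \<ge> 0" "AE t in lebesgue_on {a<..<b}. y' t \<in> l2 \<Omega> \<and> l2_norm \<Omega> (y' t) \<le> D"
    using Linf_l2_bound[OF L(2)] by blast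
  let ?g = "\<lambda>r. 2 * l2_inner \<Omega> (y' r) (y r)"
  have meas: "(\<lambda>r. l2_inner \<Omega> (y' r) (y r)) \<in> borel_measurable (lebesgue_on {a<..<b})"
    unfolding l2_inner_def
  proof (rule M.borel_measurable_lebesgue_integral)
    have "(\<lambda>p. (\<lambda>(r, x). y' r x) p * (\<lambda>(r, x). y r x) p) \<in> borel_measurable (lebesgue_on {a<..<b} \<Otimes>\<^sub>M lebesgue_on \<Omega>)"
      using L by (intro borel_measurable_times) (auto simp: Linf_l2_def)
    then show "(\<lambda>(r, x). y' r x * y r x) \<in> borel_measurable (lebesgue_on {a<..<b} \<Otimes>\<^sub>M lebesgue_on \<Omega>)"
      by (simp add: case_prod_beta)
  qed
  have "integrable (lebesgue_on {a<..<b}) (\<lambda>r. l2_inner \<Omega> (y' r) (y r))"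
  proof (rule N.integrable_const_bound[OF _ meas])
    show "AE r in lebesgue_on {a<..<b}. norm (l2_inner \<Omega> (y' r) (y r)) \<le> D * C"
      using C(2) D(2)
    proof eventually_elim
      case (elim r)
      then have "\<bar>l2_inner \<Omega> (y' r) (y r)\<bar> \<le> l2_norm \<Omega> (y' r) * l2_norm \<Omega> (y r)"
        by (intro l2_Cauchy_Schwarz) auto
      also have "\<dots> \<le> D * C" using elim D(1) by (intro mult_mono l2_norm_nonneg) auto
      finally show ?case by simp
    qed
  qed
  then have int: "integrable (lebesgue_on {a<..<b}) ?g" by simp
  then show set_int: "set_integrable lebesgue {a..b} ?g" by (simp add: LINT_Icc_lebesgue(2))
  have sub_int: "set_integrable lebesgue {p..q} ?g" if "a \<le> p" "q \<le> b" for p q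
    using that by (intro set_integrable_subset[OF set_int]) auto
  obtain K where K: "K \<ge> 0" "\<And>r s. a \<le> r \<Longrightarrow> r \<le> s \<Longrightarrow> s \<le> T \<Longrightarrow> l2_norm \<Omega> (\<lambda>x. y s x - y r x) \<le> K * (s - r)"
    using weakly_differentiable_lipschitz[OF \<Omega> y ab(1)] by blast
  let ?w = "\<lambda>r. (l2_norm \<Omega> (y r))\<^sup>2"
  have quad: "\<bar>?w q - ?w p - (LINT r:{p..q}|lebesgue. ?g r)\<bar> \<le> D * K * (q - p)\<^sup>2"
    if pq: "a \<le> p" "p \<le> q" "q \<le> b" for p q
  proof (cases "p = q")
    case True
    have "(LINT r:{p..p}|lebesgue. ?g r) = 0"
      unfolding LINT_Icc_lebesgue(1) by (subst integral_restrict_space) auto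
    then show ?thesis using True by simp
  next
    case False
    then have "p < q" using pq by simp
    let ?N = "lebesgue_on {p<..<q}"
    have ypq: "y p \<in> l2 \<Omega>" "y q \<in> l2 \<Omega>" using pq by (auto intro: l2)
    then have sum: "(\<lambda>x. y q x + y p x) \<in> l2 \<Omega>" by (intro l2_add)
    have intg: "integrable ?N ?g" using sub_int pq by (simp add: LINT_Icc_lebesgue(2)[symmetric])
    have ints: "integrable ?N (\<lambda>r. l2_inner \<Omega> (y' r) (\<lambda>x. y q x + y p x))"
      using pq by (intro Linf_l2_inner_integrable \<Omega> sum Linf_l2_mono[OF L(2)]) auto
    have "?w q - ?w p = l2_inner \<Omega> (\<lambda>x. y q x - y p x) (\<lambda>x. y q x + y p x)"
      using ypq by (simp add: l2_inner_diff_left l2_inner_add_right sum l2_norm_square l2_inner_commute[of \<Omega> "y p" "y q"])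
    also have "\<dots> = (LINT r|?N. l2_inner \<Omega> (y' r) (\<lambda>x. y q x + y p x))"
      using y sum pq ab \<open>p < q\<close> by (simp add: l2_weakly_differentiable_def)
    finally have eq: "?w q - ?w p - (LINT r:{p..q}|lebesgue. ?g r)
        = (LINT r|?N. l2_inner \<Omega> (y' r) (\<lambda>x. y q x + y p x) - ?g r)"
      using Bochner_Integration.integral_diff[OF ints intg] by (simp add: LINT_Icc_lebesgue(1))
    have "AE r in ?N. \<bar>l2_inner \<Omega> (y' r) (\<lambda>x. y q x + y p x) - ?g r\<bar> \<le> D * K * (q - p)"
    proof -
      have "AE r in ?N. y' r \<in> l2 \<Omega> \<and> l2_norm \<Omega> (y' r) \<le> D" by (rule AE_Ioo_mono[OF D(2)]) (use pq in auto)
      moreover have "AE r in ?N. r \<in> {p<..<q}" by (rule AE_I2) (simp add: space_restrict_space)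
      ultimately show ?thesis
      proof eventually_elim
        case (elim r)
        have yr: "y r \<in> l2 \<Omega>" and dl2: "(\<lambda>x. y q x - y r x) \<in> l2 \<Omega>" "(\<lambda>x. y r x - y p x) \<in> l2 \<Omega>"
          using elim pq by (auto intro!: l2_diff l2)
        have lip: "l2_norm \<Omega> (\<lambda>x. y q x - y r x) \<le> K * (q - r)" "l2_norm \<Omega> (\<lambda>x. y r x - y p x) \<le> K * (r - p)"
          using elim pq ab by (auto intro!: K(2))
        have split: "l2_inner \<Omega> (y' r) (\<lambda>x. y q x + y p x) - ?g r
            = l2_inner \<Omega> (y' r) (\<lambda>x. y q x - y r x) - l2_inner \<Omega> (y' r) (\<lambda>x. y r x - y p x)"
          using elim yr ypq by (simp add: l2_inner_add_right l2_inner_diff_right)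
        have "\<bar>l2_inner \<Omega> (y' r) (\<lambda>x. y q x - y r x) - l2_inner \<Omega> (y' r) (\<lambda>x. y r x - y p x)\<bar>
            \<le> \<bar>l2_inner \<Omega> (y' r) (\<lambda>x. y q x - y r x)\<bar> + \<bar>l2_inner \<Omega> (y' r) (\<lambda>x. y r x - y p x)\<bar>"
          by (rule abs_triangle_ineq4)
        also have "\<dots> \<le> D * (K * (q - r)) + D * (K * (r - p))"
        proof (rule add_mono)
          have *: "\<bar>l2_inner \<Omega> (y' r) d\<bar> \<le> D * B" if "d \<in> l2 \<Omega>" "l2_norm \<Omega> d \<le> B" for d B
          proof -
            have "\<bar>l2_inner \<Omega> (y' r) d\<bar> \<le> l2_norm \<Omega> (y' r) * l2_norm \<Omega> d"
              using elim that(1) by (intro l2_Cauchy_Schwarz) auto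
            also have "\<dots> \<le> D * B" using elim that(2) D(1) by (intro mult_mono l2_norm_nonneg) auto
            finally show ?thesis .
          qed
          show "\<bar>l2_inner \<Omega> (y' r) (\<lambda>x. y q x - y r x)\<bar> \<le> D * (K * (q - r))" by (rule *[OF dl2(1) lip(1)])
          show "\<bar>l2_inner \<Omega> (y' r) (\<lambda>x. y r x - y p x)\<bar> \<le> D * (K * (r - p))" by (rule *[OF dl2(2) lip(2)])
        qed
        also have "\<dots> = D * K * (q - p)" by (simp add: algebra_simps)
        finally show ?case unfolding split .
      qed
    qed
    then have ae: "AE r in ?N. l2_inner \<Omega> (y' r) (\<lambda>x. y q x + y p x) - ?g r \<le> D * K * (q - p)"
      "AE r in ?N. - (l2_inner \<Omega> (y' r) (\<lambda>x. y q x + y p x) - ?g r) \<le> D * K * (q - p)"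
      by (eventually_elim, simp add: abs_le_iff)+
    have "(LINT r|?N. l2_inner \<Omega> (y' r) (\<lambda>x. y q x + y p x) - ?g r) \<le> D * K * (q - p) * (q - p)"
      by (rule LINT_le_const_Ioo[OF Bochner_Integration.integrable_diff[OF ints intg] ae(1) pq(2)])
    moreover have "- (LINT r|?N. l2_inner \<Omega> (y' r) (\<lambda>x. y q x + y p x) - ?g r) \<le> D * K * (q - p) * (q - p)"
      using LINT_le_const_Ioo[OF integrable_minus[OF Bochner_Integration.integrable_diff[OF ints intg]] ae(2) pq(2)]
      by (simp only: integral_minus)
    ultimately show ?thesis unfolding eq by (simp add: abs_le_iff power2_eq_square mult.assoc)
  qed
  fix p q assume pq: "a \<le> p" "p \<le> q" "q \<le> b"
  let ?\<phi> = "\<lambda>x. ?w x - (LINT r:{p..x}|lebesgue. ?g r)"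
  have "?\<phi> q = ?\<phi> p"
  proof (rule constant_if_quadratic_increments[OF _ pq(2)])
    fix m n assume mn: "p \<le> m" "m \<le> n" "n \<le> q"
    have I: "(LINT r:{s..t}|lebesgue. ?g r) = integral {s..t} ?g" "?g integrable_on {s..t}" if "a \<le> s" "t \<le> b" for s t
      using set_lebesgue_integral_eq_integral[OF sub_int[OF that]] by auto
    have "(LINT r:{p..n}|lebesgue. ?g r) = (LINT r:{p..m}|lebesgue. ?g r) + (LINT r:{m..n}|lebesgue. ?g r)"
    proof -
      have bounds: "a \<le> m" "m \<le> b" "n \<le> b" using mn pq by auto
      show ?thesis
        unfolding I(1)[OF pq(1) bounds(3)] I(1)[OF pq(1) bounds(2)] I(1)[OF bounds(1,3)]
        by (rule Henstock_Kurzweil_Integration.integral_combine[OF mn(1,2) I(2)[OF pq(1) bounds(3)], symmetric])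
    qed
    then show "\<bar>?\<phi> n - ?\<phi> m\<bar> \<le> D * K * (n - m)\<^sup>2"
      using quad[of m n] mn pq by (simp add: algebra_simps)
  qed
  moreover have "(LINT r:{p..p}|lebesgue. ?g r) = 0" using quad[of p p] pq by simp
  ultimately show "?w q - ?w p = (LINT r:{p..q}|lebesgue. ?g r)" by simp
qed

section \<open>Fractional derivatives\<close>

text \<open>
  Minkowski's inequality for integrals, in a qualitative form and by duality: for the truncations \<open>h n\<close> of the
  integral \<open>I\<close>, \<open>\<parallel>h n\<parallel>\<^sup>2 = \<langle>I, h n\<rangle> \<le> (\<integral> c) \<parallel>h n\<parallel>\<close>, so the norms of the truncations are bounded by \<open>\<integral> c\<close>, and
  Fatou's lemma yields the same bound for \<open>I\<close>. The truncation guarantees that \<open>h n\<close> is square-integrable.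
\<close>

lemma l2_time_integral:
  fixes z :: "real \<Rightarrow> real ^ 'd \<Rightarrow> real" and a b :: real
  defines "N \<equiv> lebesgue_on {a<..<b}"
  assumes \<Omega>: "\<Omega> \<in> lmeasurable" and z: "(\<lambda>(r, x). z r x) \<in> borel_measurable (N \<Otimes>\<^sub>M lebesgue_on \<Omega>)"
    and \<rho>: "\<rho> \<in> borel_measurable N"
    and bound: "AE r in N. z r \<in> l2 \<Omega> \<and> \<bar>\<rho> r\<bar> * l2_norm \<Omega> (z r) \<le> c r" and c: "integrable N c"
  shows "AE x in lebesgue_on \<Omega>. integrable N (\<lambda>r. \<rho> r * z r x)"
    and "(\<lambda>x. LINT r|N. \<rho> r * z r x) \<in> l2 \<Omega>"
proof -
  interpret pair_sigma_finite N "lebesgue_on \<Omega>"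
    unfolding N_def by (rule pair_sigma_finite_lebesgue_on[OF \<Omega>])
  interpret M: finite_measure "lebesgue_on \<Omega>" by (rule finite_measure_lebesgue_on[OF \<Omega>])
  have one: "(\<lambda>_. 1) \<in> l2 \<Omega>" by (rule l2_continuous_bounded[OF \<Omega>, of _ 1]) auto
  have int1: "integrable (N \<Otimes>\<^sub>M lebesgue_on \<Omega>) (\<lambda>(r, x). \<rho> r * z r x * 1)"
    using product_l2_integrable[OF \<Omega> _ one] assms(3-) unfolding N_def by blast
  show "AE x in lebesgue_on \<Omega>. integrable N (\<lambda>r. \<rho> r * z r x)"
    using AE_integrable_snd[OF int1] by simp
  define I where "I x = (LINT r|N. \<rho> r * z r x)" for x
  have "integrable (lebesgue_on \<Omega>) I"
    using integrable_snd[OF int1] by (simp add: I_def[abs_def])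
  then have [measurable]: "I \<in> borel_measurable (lebesgue_on \<Omega>)" by simp
  define A where "A = (LINT r|N. c r)"
  have "0 \<le> A"
    unfolding A_def
  proof (rule integral_nonneg_AE)
    show "AE r in N. 0 \<le> c r"
      using bound by eventually_elim (meson abs_ge_zero l2_norm_nonneg mult_nonneg_nonneg order_trans)
  qed
  define h where "h n x = (if \<bar>I x\<bar> \<le> real n then I x else 0)" for n x
  have h: "h n \<in> l2 \<Omega>" for n
  proof (rule l2I_bound)
    show "h n \<in> borel_measurable (lebesgue_on \<Omega>)" unfolding h_def by measurable
    show "integrable (lebesgue_on \<Omega>) (\<lambda>_. (real n)\<^sup>2)" by simp
    show "AE x in lebesgue_on \<Omega>. (h n x)\<^sup>2 \<le> (real n)\<^sup>2"
      by (intro AE_I2) (auto simp: h_def abs_le_square_iff[symmetric])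
  qed
  have hA: "l2_norm \<Omega> (h n) \<le> A" for n
  proof -
    note H = l2_inner_time_integral[OF \<Omega> z[unfolded N_def] h \<rho>[unfolded N_def] bound[unfolded N_def] c[unfolded N_def],
        folded N_def, folded I_def[abs_def], of n]
    have "(l2_norm \<Omega> (h n))\<^sup>2 = l2_inner \<Omega> I (h n)"
      unfolding l2_norm_square l2_inner_def by (intro Bochner_Integration.integral_cong) (auto simp: h_def)
    also have "\<dots> = (LINT r|N. \<rho> r * l2_inner \<Omega> (z r) (h n))" by (rule H(3))
    also have "\<dots> \<le> (LINT r|N. c r * l2_norm \<Omega> (h n))"
    proof (rule integral_mono_AE[OF H(1)])
      show "integrable N (\<lambda>r. c r * l2_norm \<Omega> (h n))" using c by simp
      show "AE r in N. \<rho> r * l2_inner \<Omega> (z r) (h n) \<le> c r * l2_norm \<Omega> (h n)"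
        using bound
      proof eventually_elim
        case (elim r)
        have "\<rho> r * l2_inner \<Omega> (z r) (h n) \<le> \<bar>\<rho> r\<bar> * \<bar>l2_inner \<Omega> (z r) (h n)\<bar>"
          by (metis abs_ge_self abs_mult)
        also have "\<dots> \<le> \<bar>\<rho> r\<bar> * (l2_norm \<Omega> (z r) * l2_norm \<Omega> (h n))"
          using elim by (intro mult_left_mono l2_Cauchy_Schwarz h) auto
        also have "\<dots> \<le> c r * l2_norm \<Omega> (h n)"
          using elim by (simp add: mult.assoc[symmetric] mult_right_mono l2_norm_nonneg)
        finally show ?case .
      qed
    qed
    also have "\<dots> = A * l2_norm \<Omega> (h n)" by (simp add: A_def)
    finally have "l2_norm \<Omega> (h n) * l2_norm \<Omega> (h n) \<le> A * l2_norm \<Omega> (h n)"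
      by (simp add: power2_eq_square)
    then show ?thesis
      using l2_norm_nonneg[of \<Omega> "h n"] \<open>0 \<le> A\<close>
      by (cases "l2_norm \<Omega> (h n) = 0") (auto simp: mult_le_cancel_right)
  qed
  have "(\<integral>\<^sup>+x. ennreal ((I x)\<^sup>2) \<partial>lebesgue_on \<Omega>) = (\<integral>\<^sup>+x. liminf (\<lambda>n. ennreal ((h n x)\<^sup>2)) \<partial>lebesgue_on \<Omega>)"
  proof (intro nn_integral_cong lim_imp_Liminf[symmetric] tendsto_eventually)
    fix x
    obtain n0 :: nat where "\<bar>I x\<bar> \<le> real n0" using real_arch_simple by blast
    then show "\<forall>\<^sub>F n in sequentially. ennreal ((h n x)\<^sup>2) = ennreal ((I x)\<^sup>2)"
      unfolding eventually_sequentially h_def by (intro exI[of _ n0]) auto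
  qed simp
  also have "\<dots> \<le> liminf (\<lambda>n. \<integral>\<^sup>+x. ennreal ((h n x)\<^sup>2) \<partial>lebesgue_on \<Omega>)"
    using l2_measurable[OF h] by (intro nn_integral_liminf) simp
  also have "\<dots> \<le> ennreal (A\<^sup>2)"
  proof (rule order_trans[OF Liminf_le_Limsup Limsup_bounded])
    show "\<forall>\<^sub>F n in sequentially. (\<integral>\<^sup>+x. ennreal ((h n x)\<^sup>2) \<partial>lebesgue_on \<Omega>) \<le> ennreal (A\<^sup>2)"
      unfolding nn_integral_square_l2[OF h] using hA by (intro always_eventually allI ennreal_leI power_mono l2_norm_nonneg)
  qed simp
  finally have "integrable (lebesgue_on \<Omega>) (\<lambda>x. (I x)\<^sup>2)"
    by (intro integrableI_bounded) (auto simp: le_less_trans[OF _ ennreal_less_top])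
  then show "(\<lambda>x. LINT r|N. \<rho> r * z r x) \<in> l2 \<Omega>" by (simp add: l2_def I_def[symmetric, abs_def])
qed

text \<open>
  Joint measurability is given away from time \<open>0\<close> only; \<open>{0<..<s}\<close> is a countable union of such intervals.
\<close>

lemma joint_measurable_Ioo:
  assumes "l2_weakly_differentiable \<Omega> T y y'" "s \<le> T"
  shows "(\<lambda>(r, x). y r x) \<in> borel_measurable (lebesgue_on {0<..<s} \<Otimes>\<^sub>M lebesgue_on \<Omega>)"
proof (rule measurable_piecewise_restrict)
  let ?P = "lebesgue_on {0<..<s} \<Otimes>\<^sub>M lebesgue_on \<Omega>"
  let ?C = "\<lambda>n::nat. {1 / real (Suc n)<..<s} \<times> space (lebesgue_on \<Omega>)"
  show "countable (range ?C)" by simp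
  show "space ?P \<subseteq> \<Union> (range ?C)"
  proof
    fix p assume "p \<in> space ?P"
    then obtain r x where p: "p = (r, x)" "0 < r" "r < s" "x \<in> space (lebesgue_on \<Omega>)"
      by (auto simp: space_pair_measure space_restrict_space)
    obtain n where "1 / real (Suc n) < r" using p(2) reals_Archimedean by (auto simp: inverse_eq_divide)
    then show "p \<in> \<Union> (range ?C)" using p by auto
  qed
  fix X assume "X \<in> range ?C"
  then obtain n where X: "X = ?C n" by auto
  define e where "e = 1 / real (Suc n)"
  have "e > 0" by (simp add: e_def)
  have X: "X = {e<..<s} \<times> space (lebesgue_on \<Omega>)" by (simp add: X e_def)
  have "{e<..<s} \<in> sets (lebesgue_on {0<..<s})"
    using \<open>e > 0\<close> by (subst sets_restrict_space_iff) auto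
  then show "X \<inter> space ?P \<in> sets ?P" unfolding X by auto
  show "(\<lambda>(r, x). y r x) \<in> borel_measurable (restrict_space ?P X)"
  proof (cases "e \<le> T")
    case True
    have "(\<lambda>(r, x). y r x) \<in> borel_measurable (lebesgue_on {e<..<T} \<Otimes>\<^sub>M lebesgue_on \<Omega>)"
      using assms(1) True \<open>e > 0\<close> by (auto simp: l2_weakly_differentiable_def Linf_l2_def)
    then have m: "(\<lambda>(r, x). y r x) \<in> borel_measurable (lebesgue_on {e<..<s} \<Otimes>\<^sub>M lebesgue_on \<Omega>)"
      by (rule lebesgue_on_pair_mono) (use assms(2) in auto)
    have "fst \<in> restrict_space ?P X \<rightarrow>\<^sub>M lebesgue_on {e<..<s}"
    proof (rule measurable_restrict_space2)
      show "fst \<in> space (restrict_space ?P X) \<rightarrow> {e<..<s}" by (auto simp: space_restrict_space X)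
      have "fst \<in> ?P \<rightarrow>\<^sub>M lebesgue_on {0<..<s}" by (rule measurable_fst)
      moreover have "(\<lambda>x. x) \<in> lebesgue_on {0<..<s} \<rightarrow>\<^sub>M lebesgue" by (intro measurable_restrict_space1) simp
      ultimately have "fst \<in> ?P \<rightarrow>\<^sub>M lebesgue" using measurable_compose by fastforce
      then show "fst \<in> restrict_space ?P X \<rightarrow>\<^sub>M lebesgue" by (rule measurable_restrict_space1)
    qed
    moreover have "snd \<in> restrict_space ?P X \<rightarrow>\<^sub>M lebesgue_on \<Omega>"
      by (intro measurable_restrict_space1 measurable_snd)
    ultimately have "(\<lambda>p. (fst p, snd p)) \<in> restrict_space ?P X \<rightarrow>\<^sub>M (lebesgue_on {e<..<s} \<Otimes>\<^sub>M lebesgue_on \<Omega>)"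
      by (rule measurable_Pair)
    from measurable_compose[OF this m] show ?thesis by (simp add: case_prod_beta)
  next
    case False
    then have "X = {}" using assms(2) by (auto simp: X)
    then show ?thesis by (simp add: measurable_def space_restrict_space)
  qed
qed

lemma integrable_powr_reflected:
  fixes a s :: real
  assumes "a > -1" "s \<ge> 0"
  shows "integrable (lebesgue_on {0<..<s}) (\<lambda>r. (s - r) powr a)"
proof -
  have "(\<lambda>x. x powr a) absolutely_integrable_on {0..s}"
    using has_integral_powr_from_0[OF assms] by (intro nonnegative_absolutely_integrable_1) (auto simp: integrable_on_def)
  then have "integrable lebesgue (\<lambda>x. indicat_real {0..s} x * x powr a)" by (simp add: set_integrable_def)
  then have "integrable lborel (\<lambda>x. indicat_real {0..s} x * x powr a)" by (subst (asm) integrable_completion) auto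
  then have "integrable lborel (\<lambda>x. indicat_real {0..s} (s + -1 * x) * (s + -1 * x) powr a)"
    by (subst lborel_integrable_real_affine_iff[where f = "\<lambda>x. indicat_real {0..s} x * x powr a"]) auto
  also have "(\<lambda>x. indicat_real {0..s} (s + -1 * x) * (s + -1 * x) powr a) = (\<lambda>x. indicat_real {0..s} x * (s - x) powr a)"
    by (auto simp: indicator_def fun_eq_iff)
  finally have "integrable lebesgue (\<lambda>x. indicat_real {0..s} x * (s - x) powr a)"
    by (subst integrable_completion) auto
  then have "set_integrable lebesgue {0..s} (\<lambda>x. (s - x) powr a)" by (simp add: set_integrable_def)
  then show ?thesis by (simp add: LINT_Icc_lebesgue(2))
qed

text \<open>
  As \<open>\<parallel>y s - y r\<parallel> \<le> K (s - r)\<close>, the norm of the integrand is at most \<open>\<alpha> K (s - r)\<^bsup>-\<alpha>\<^esup>\<close>, which is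
  integrable for \<open>\<alpha> < 1\<close>.
\<close>

lemma memory_integral:
  assumes \<Omega>: "\<Omega> \<in> lmeasurable" and y: "l2_weakly_differentiable \<Omega> T y y'" and s: "s \<in> {0<..T}" and \<alpha>: "0 < \<alpha>" "\<alpha> < 1"
  defines "N \<equiv> lebesgue_on {0<..<s}"
  shows "AE x in lebesgue_on \<Omega>. integrable N (\<lambda>r. \<alpha> * (s - r) powr (- \<alpha> - 1) * (y s x - y r x))"
    and "(\<lambda>x. LINT r|N. \<alpha> * (s - r) powr (- \<alpha> - 1) * (y s x - y r x)) \<in> l2 \<Omega>"
    and "h \<in> l2 \<Omega> \<Longrightarrow> l2_inner \<Omega> (\<lambda>x. LINT r|N. \<alpha> * (s - r) powr (- \<alpha> - 1) * (y s x - y r x)) h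
      = (LINT r|N. \<alpha> * (s - r) powr (- \<alpha> - 1) * l2_inner \<Omega> (\<lambda>x. y s x - y r x) h)"
proof -
  have yC: "y \<in> C_l2 \<Omega> T" using y by (simp add: l2_weakly_differentiable_def)
  obtain K where K: "K \<ge> 0" "\<And>r. r \<in> {0..s} \<Longrightarrow> l2_norm \<Omega> (\<lambda>x. y s x - y r x) \<le> K * (s - r)"
    using weakly_differentiable_lipschitz_at[OF \<Omega> y s] by blast
  let ?k = "\<lambda>r. \<alpha> * (s - r) powr (- \<alpha> - 1)"
  have c: "integrable N (\<lambda>r. \<alpha> * K * (s - r) powr (- \<alpha>))"
    unfolding N_def using \<alpha> s by (intro integrable_mult_right integrable_powr_reflected) auto
  have bound: "AE r in N. (\<lambda>x. y s x - y r x) \<in> l2 \<Omega> \<and> \<bar>\<alpha> * (s - r) powr (- \<alpha> - 1)\<bar> * l2_norm \<Omega> (\<lambda>x. y s x - y r x) \<le> \<alpha> * K * (s - r) powr (- \<alpha>)"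
  proof (rule AE_I2)
    fix r assume "r \<in> space N"
    then have r: "0 < r" "r < s" by (auto simp: N_def space_restrict_space)
    have "\<bar>\<alpha> * (s - r) powr (- \<alpha> - 1)\<bar> * l2_norm \<Omega> (\<lambda>x. y s x - y r x) \<le> (\<alpha> * (s - r) powr (- \<alpha> - 1)) * (K * (s - r))"
      using K(2)[of r] r \<alpha> by (simp add: mult_left_mono)
    also have "\<dots> = \<alpha> * K * ((s - r) powr (- \<alpha> - 1) * (s - r) powr 1)" using r by simp
    also have "\<dots> = \<alpha> * K * (s - r) powr (- \<alpha>)" by (simp only: powr_add[symmetric]) simp
    finally show "(\<lambda>x. y s x - y r x) \<in> l2 \<Omega> \<and> \<bar>\<alpha> * (s - r) powr (- \<alpha> - 1)\<bar> * l2_norm \<Omega> (\<lambda>x. y s x - y r x) \<le> \<alpha> * K * (s - r) powr (- \<alpha>)"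
      using r s by (auto intro!: l2_diff C_l2_l2[OF yC])
  qed
  have "(\<lambda>p. y s (snd p)) \<in> borel_measurable (N \<Otimes>\<^sub>M lebesgue_on \<Omega>)"
    using s by (intro measurable_compose[OF measurable_snd] l2_measurable C_l2_l2[OF yC]) auto
  moreover have "(\<lambda>(r, x). y r x) \<in> borel_measurable (N \<Otimes>\<^sub>M lebesgue_on \<Omega>)"
    unfolding N_def using s by (intro joint_measurable_Ioo[OF y]) auto
  ultimately have "(\<lambda>p. y s (snd p) - (\<lambda>(r, x). y r x) p) \<in> borel_measurable (N \<Otimes>\<^sub>M lebesgue_on \<Omega>)"
    by (rule borel_measurable_diff)
  then have meas: "(\<lambda>(r, x). y s x - y r x) \<in> borel_measurable (N \<Otimes>\<^sub>M lebesgue_on \<Omega>)" by (simp add: case_prod_beta)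
  have k: "?k \<in> borel_measurable N"
    unfolding N_def by (intro measurable_restrict_space1 measurable_completion) simp
  note facts = meas[unfolded N_def] k[unfolded N_def] bound[unfolded N_def] c[unfolded N_def]
  show "AE x in lebesgue_on \<Omega>. integrable N (\<lambda>r. ?k r * (y s x - y r x))"
    and "(\<lambda>x. LINT r|N. ?k r * (y s x - y r x)) \<in> l2 \<Omega>"
    unfolding N_def by (rule l2_time_integral[OF \<Omega> facts])+
  show "l2_inner \<Omega> (\<lambda>x. LINT r|N. ?k r * (y s x - y r x)) h = (LINT r|N. ?k r * l2_inner \<Omega> (\<lambda>x. y s x - y r x) h)"
    if "h \<in> l2 \<Omega>"
    unfolding N_def by (rule l2_inner_time_integral(3)[OF \<Omega> facts(1) that facts(2-)])
qed

lemma time_deriv_l2: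
  assumes \<Omega>: "\<Omega> \<in> lmeasurable" and y: "l2_weakly_differentiable \<Omega> T y y'" and s: "s \<in> {0<..T}" and \<alpha>: "0 < \<alpha>"
    and y': "y' s \<in> l2 \<Omega>"
  shows "time_deriv \<alpha> y y' s \<in> l2 \<Omega>"
proof (cases "\<alpha> < 1")
  case True
  have ys: "(\<lambda>x. y s x - y 0 x) \<in> l2 \<Omega>"
    using y s by (intro l2_diff C_l2_l2[of y \<Omega> T]) (auto simp: l2_weakly_differentiable_def)
  have "(\<lambda>x. (1 / Gamma (1 - \<alpha>)) * (s powr (- \<alpha>) * (y s x - y 0 x) + (LINT r|lebesgue_on {0<..<s}. \<alpha> * (s - r) powr (- \<alpha> - 1) * (y s x - y r x)))) \<in> l2 \<Omega>"
    by (intro l2_cmult l2_add ys memory_integral(2)[OF \<Omega> y s \<alpha> True])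
  then show ?thesis using True by (simp add: time_deriv_def[abs_def])
next
  case False
  then show ?thesis using y' by (simp add: time_deriv_def[abs_def])
qed

text \<open>
  The memory integral is a Lebesgue integral for each \<open>x\<close>, with value \<open>0\<close> where it diverges, so that linearity
  holds only where both integrals converge, that is, almost everywhere.
\<close>

lemma time_deriv_diff:
  assumes \<Omega>: "\<Omega> \<in> lmeasurable" and y: "l2_weakly_differentiable \<Omega> T y y'" and z: "l2_weakly_differentiable \<Omega> T z z'"
    and s: "s \<in> {0<..T}" and \<alpha>: "0 < \<alpha>"
  shows "AE x in lebesgue_on \<Omega>. time_deriv \<alpha> (\<lambda>t x. y t x - z t x) (\<lambda>t x. y' t x - z' t x) s x
    = time_deriv \<alpha> y y' s x - time_deriv \<alpha> z z' s x"
proof (cases "\<alpha> < 1")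
  case True
  let ?k = "\<lambda>r. \<alpha> * (s - r) powr (- \<alpha> - 1)"
  note int = memory_integral(1)[OF \<Omega> _ s \<alpha> True]
  show ?thesis using int[OF y] int[OF z]
  proof eventually_elim
    case (elim x)
    have "(LINT r|lebesgue_on {0<..<s}. ?k r * ((y s x - z s x) - (y r x - z r x)))
        = (LINT r|lebesgue_on {0<..<s}. ?k r * (y s x - y r x) - ?k r * (z s x - z r x))"
      by (simp add: algebra_simps)
    also have "\<dots> = (LINT r|lebesgue_on {0<..<s}. ?k r * (y s x - y r x)) - (LINT r|lebesgue_on {0<..<s}. ?k r * (z s x - z r x))"
      using elim by (rule Bochner_Integration.integral_diff)
    finally have eq: "(LINT r|lebesgue_on {0<..<s}. ?k r * ((y s x - z s x) - (y r x - z r x)))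
      = (LINT r|lebesgue_on {0<..<s}. ?k r * (y s x - y r x)) - (LINT r|lebesgue_on {0<..<s}. ?k r * (z s x - z r x))" .
    show ?case using True unfolding time_deriv_def eq by (simp add: diff_divide_distrib[symmetric] algebra_simps)
  qed
qed (simp add: time_deriv_def)

text \<open>
  The integrand of the memory integral, paired with \<open>y s\<close>, is nonnegative, because
  \<open>\<langle>y r, y s\<rangle> \<le> \<parallel>y r\<parallel> \<parallel>y s\<parallel> \<le> \<parallel>y s\<parallel>\<^sup>2\<close>. What remains is the term with the initial value.
\<close>

lemma time_deriv_record_lower_bound:
  assumes \<Omega>: "\<Omega> \<in> lmeasurable" and y: "l2_weakly_differentiable \<Omega> T y y'" and s: "s \<in> {0<..T}" and \<alpha>: "0 < \<alpha>" "\<alpha> < 1"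
    and init: "AE x in lebesgue_on \<Omega>. y 0 x = 0"
    and latest_max: "\<And>r. r \<in> {0..s} \<Longrightarrow> l2_norm \<Omega> (y r) \<le> l2_norm \<Omega> (y s)"
  shows "s powr (- \<alpha>) / Gamma (1 - \<alpha>) * (l2_norm \<Omega> (y s))\<^sup>2 \<le> l2_inner \<Omega> (time_deriv \<alpha> y y' s) (y s)"
proof -
  let ?N = "lebesgue_on {0<..<s}"
  let ?k = "\<lambda>r. \<alpha> * (s - r) powr (- \<alpha> - 1)"
  let ?I = "\<lambda>x. LINT r|?N. ?k r * (y s x - y r x)"
  have l2: "y r \<in> l2 \<Omega>" if "r \<in> {0..s}" for r
    using y s that by (intro C_l2_l2[of y \<Omega> T]) (auto simp: l2_weakly_differentiable_def)
  have ys: "y s \<in> l2 \<Omega>" "y 0 \<in> l2 \<Omega>" using s by (auto intro: l2)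
  have I: "?I \<in> l2 \<Omega>" by (rule memory_integral(2)[OF \<Omega> y s \<alpha>])
  have "l2_inner \<Omega> ?I (y s) = (LINT r|?N. ?k r * l2_inner \<Omega> (\<lambda>x. y s x - y r x) (y s))"
    by (rule memory_integral(3)[OF \<Omega> y s \<alpha> ys(1)])
  also have "\<dots> \<ge> 0"
  proof (rule Bochner_Integration.integral_nonneg)
    fix r assume "r \<in> space ?N"
    then have r: "r \<in> {0..s}" by (auto simp: space_restrict_space)
    have "l2_inner \<Omega> (y r) (y s) \<le> l2_norm \<Omega> (y r) * l2_norm \<Omega> (y s)"
      using l2_Cauchy_Schwarz[OF l2[OF r] ys(1)] by (simp add: abs_le_iff)
    also have "\<dots> \<le> l2_norm \<Omega> (y s) * l2_norm \<Omega> (y s)"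
      using latest_max[OF r] by (intro mult_right_mono l2_norm_nonneg)
    also have "\<dots> = l2_inner \<Omega> (y s) (y s)" by (simp add: l2_norm_square power2_eq_square[symmetric])
    finally have "0 \<le> l2_inner \<Omega> (\<lambda>x. y s x - y r x) (y s)" by (simp add: l2_inner_diff_left ys l2[OF r])
    then show "0 \<le> ?k r * l2_inner \<Omega> (\<lambda>x. y s x - y r x) (y s)" using \<alpha> by (intro mult_nonneg_nonneg) auto
  qed
  finally have I0: "0 \<le> l2_inner \<Omega> ?I (y s)" .
  have "l2_inner \<Omega> (y 0) (y s) = l2_inner \<Omega> (\<lambda>x. 0) (y s)"
    by (intro l2_inner_cong_AE l2_measurable ys l2_0 init)
  then have y0: "l2_inner \<Omega> (y 0) (y s) = 0" by (simp add: l2_inner_def)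
  have "time_deriv \<alpha> y y' s = (\<lambda>x. (1 / Gamma (1 - \<alpha>)) * (s powr (- \<alpha>) * (y s x - y 0 x) + ?I x))"
    using \<alpha> by (simp add: time_deriv_def fun_eq_iff)
  then have "l2_inner \<Omega> (time_deriv \<alpha> y y' s) (y s)
      = (1 / Gamma (1 - \<alpha>)) * (s powr (- \<alpha>) * (l2_inner \<Omega> (y s) (y s) - l2_inner \<Omega> (y 0) (y s)) + l2_inner \<Omega> ?I (y s))"
    by (simp only: l2_inner_cmult_left l2_inner_add_left[OF l2_cmult[OF l2_diff[OF ys]] I ys(1)] l2_inner_diff_left[OF ys ys(1)])
  also have "\<dots> \<ge> (1 / Gamma (1 - \<alpha>)) * (s powr (- \<alpha>) * (l2_norm \<Omega> (y s))\<^sup>2)"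
    using I0 y0 \<alpha> by (intro mult_left_mono) (auto simp: l2_norm_square less_imp_le)
  finally show ?thesis by simp
qed

section \<open>The error bound\<close>

text \<open>
  The residual of \<open>u\<close> vanishes, so subtracting it from the residual of \<open>v\<close> gives the equation
  \<open>\<Sum>\<^sub>i q\<^sub>i D\<^bsup>\<alpha>\<^sub>i\<^esup> e + \<L> e = g\<close> for the error, in the sense of distributions. As everything except \<open>\<L> e\<close> is in
  \<open>L\<^sub>2\<close>, it may be tested with \<open>e(s)\<close>.
\<close>

lemma error_energy_inequality:
  fixes \<Omega> :: "(real ^ 'd::finite) set" and \<alpha> :: "nat \<Rightarrow> real" and q :: "nat \<Rightarrow> real \<Rightarrow> real" and l :: nat
  assumes \<Omega>: "open \<Omega>" "\<Omega> \<in> lmeasurable" and L: "elliptic \<Omega> L"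
    and coercive: "\<And>r. r \<in> H10 \<Omega> \<Longrightarrow> pairing \<Omega> L r r \<ge> lam * (l2_norm \<Omega> r)\<^sup>2"
    and regular: "regular \<Omega> T u u'" "regular \<Omega> T v v'"
    and s: "s \<in> {0<..T}" and \<alpha>: "\<And>i. i \<in> {1..l} \<Longrightarrow> 0 < \<alpha> i"
    and u: "\<And>\<phi>. \<phi> \<in> test_functions \<Omega> \<Longrightarrow> residual \<Omega> l \<alpha> q L f u u' s \<phi> = 0"
    and g: "g \<in> l2 \<Omega>" "\<And>\<phi>. \<phi> \<in> test_functions \<Omega> \<Longrightarrow> residual \<Omega> l \<alpha> q L f v v' s \<phi> = l2_inner \<Omega> g \<phi>"
  defines "e \<equiv> \<lambda>t x. v t x - u t x" and "e' \<equiv> \<lambda>t x. v' t x - u' t x"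
  shows "(\<Sum>i=1..l. q i s * l2_inner \<Omega> (time_deriv (\<alpha> i) e e' s) (e s)) + lam * (l2_norm \<Omega> (e s))\<^sup>2
    \<le> l2_norm \<Omega> g * l2_norm \<Omega> (e s)"
proof -
  note wd = regular_imp_weakly_differentiable[OF \<Omega>(2) regular(1)] regular_imp_weakly_differentiable[OF \<Omega>(2) regular(2)]
  have wde: "l2_weakly_differentiable \<Omega> T e e'"
    unfolding e_def e'_def by (rule weakly_differentiable_diff[OF \<Omega>(2) wd(2,1)])
  have H: "u s \<in> H10 \<Omega>" "v s \<in> H10 \<Omega>" "u' s \<in> l2 \<Omega>" "v' s \<in> l2 \<Omega>"
    using regular s by (auto simp: regular_def)
  have e's: "e' s \<in> l2 \<Omega>" unfolding e'_def by (rule l2_diff[OF H(4,3)])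
  have eH: "e s \<in> H10 \<Omega>" unfolding e_def by (rule H10_diff[OF \<Omega> H(2,1)])
  have el2: "e s \<in> l2 \<Omega>" by (rule H10_imp_l2[OF eH])
  define D where "D w w' x = (\<Sum>i=1..l. q i s * time_deriv (\<alpha> i) w w' s x)"
    for w w' :: "real \<Rightarrow> real ^ 'd \<Rightarrow> real" and x
  have Dl2: "D w w' \<in> l2 \<Omega>" if "l2_weakly_differentiable \<Omega> T w w'" "w' s \<in> l2 \<Omega>" for w w' :: "real \<Rightarrow> real ^ 'd \<Rightarrow> real"
    unfolding D_def[abs_def] using that \<alpha> s by (intro l2_sum l2_cmult time_deriv_l2[OF \<Omega>(2)]) auto
  note D = Dl2[OF wd(1) H(3)] Dl2[OF wd(2) H(4)] Dl2[OF wde e's]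
  have "AE x in lebesgue_on \<Omega>. time_deriv (\<alpha> i) e e' s x = time_deriv (\<alpha> i) v v' s x - time_deriv (\<alpha> i) u u' s x"
    if "i \<in> {1..l}" for i
    unfolding e_def e'_def by (rule time_deriv_diff[OF \<Omega>(2) wd(2,1) s \<alpha>[OF that]])
  then have "AE x in lebesgue_on \<Omega>. \<forall>i\<in>{1..l}. time_deriv (\<alpha> i) e e' s x = time_deriv (\<alpha> i) v v' s x - time_deriv (\<alpha> i) u u' s x"
    by (intro AE_finite_allI finite_atLeastAtMost)
  then have AE_D: "AE x in lebesgue_on \<Omega>. D e e' x = D v v' x - D u u' x"
    by eventually_elim (simp add: D_def right_diff_distrib sum_subtractf)
  have "pairing \<Omega> L (e s) \<phi> = l2_inner \<Omega> (\<lambda>x. g x - D e e' x) \<phi>" if \<phi>: "\<phi> \<in> test_functions \<Omega>" for \<phi>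
  proof -
    have \<phi>l2: "\<phi> \<in> l2 \<Omega>" by (rule test_function_l2[OF \<Omega>(2) \<phi>])
    have "l2_inner \<Omega> (D e e') \<phi> = l2_inner \<Omega> (\<lambda>x. D v v' x - D u u' x) \<phi>"
      by (intro l2_inner_cong_AE l2_measurable D l2_diff \<phi>l2 AE_D)
    also have "\<dots> = l2_inner \<Omega> (D v v') \<phi> - l2_inner \<Omega> (D u u') \<phi>"
      by (rule l2_inner_diff_left[OF D(2,1) \<phi>l2])
    finally have "l2_inner \<Omega> (D e e') \<phi> + pairing \<Omega> L (e s) \<phi>
        = residual \<Omega> l \<alpha> q L f v v' s \<phi> - residual \<Omega> l \<alpha> q L f u u' s \<phi>"
      using pairing_diff_left[OF \<Omega> L H(2,1) \<phi>] by (simp add: residual_def D_def[abs_def] e_def)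
    then show ?thesis using u[OF \<phi>] g(2)[OF \<phi>] by (simp add: l2_inner_diff_left[OF g(1) D(3) \<phi>l2])
  qed
  then have "pairing \<Omega> L (e s) (e s) = l2_inner \<Omega> (\<lambda>x. g x - D e e' x) (e s)"
    by (rule pairing_identity_extends[OF \<Omega> L eH eH l2_diff[OF g(1) D(3)]])
  also have "\<dots> = l2_inner \<Omega> g (e s) - l2_inner \<Omega> (D e e') (e s)"
    by (rule l2_inner_diff_left[OF g(1) D(3) el2])
  also have "l2_inner \<Omega> (D e e') (e s) = (\<Sum>i=1..l. q i s * l2_inner \<Omega> (time_deriv (\<alpha> i) e e' s) (e s))"
    unfolding D_def[abs_def] using \<alpha> e's
    by (subst l2_inner_sum_left) (auto intro!: l2_cmult time_deriv_l2[OF \<Omega>(2) wde s] el2 simp: l2_inner_cmult_left)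
  finally have "lam * (l2_norm \<Omega> (e s))\<^sup>2 + (\<Sum>i=1..l. q i s * l2_inner \<Omega> (time_deriv (\<alpha> i) e e' s) (e s)) \<le> l2_inner \<Omega> g (e s)"
    using coercive[OF eH] by simp
  also have "\<dots> \<le> l2_norm \<Omega> g * l2_norm \<Omega> (e s)"
    using l2_Cauchy_Schwarz[OF g(1) el2] by (simp add: abs_le_iff)
  finally show ?thesis by simp
qed

text \<open>
  The fractional terms are bounded below separately and add up to \<open>R0\<close>; a term of order \<open>1\<close> is kept.
\<close>

lemma error_lower_bound_at_record:
  fixes \<alpha> :: "nat \<Rightarrow> real" and q :: "nat \<Rightarrow> real \<Rightarrow> real" and l :: nat
  assumes \<Omega>: "\<Omega> \<in> lmeasurable" and y: "l2_weakly_differentiable \<Omega> T y y'" and s: "s \<in> {0<..T}"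
    and l: "l \<ge> 1" and \<alpha>: "\<And>i. i \<in> {1..l} \<Longrightarrow> 0 < \<alpha> i" "\<And>i. i \<in> {2..l} \<Longrightarrow> \<alpha> i < 1" "\<alpha> 1 \<le> 1"
    and q: "\<And>i. i \<in> {1..l} \<Longrightarrow> 0 \<le> q i s"
    and init: "AE x in lebesgue_on \<Omega>. y 0 x = 0"
    and latest_max: "\<And>r. r \<in> {0..s} \<Longrightarrow> l2_norm \<Omega> (y r) \<le> l2_norm \<Omega> (y s)"
  shows "R0 l \<alpha> q lam s * (l2_norm \<Omega> (y s))\<^sup>2 + (if \<alpha> 1 < 1 then 0 else q 1 s * l2_inner \<Omega> (y' s) (y s))
    \<le> (\<Sum>i=1..l. q i s * l2_inner \<Omega> (time_deriv (\<alpha> i) y y' s) (y s)) + lam * (l2_norm \<Omega> (y s))\<^sup>2"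
proof -
  let ?w = "(l2_norm \<Omega> (y s))\<^sup>2"
  have frac: "q i s * s powr (- \<alpha> i) / Gamma (1 - \<alpha> i) * ?w \<le> q i s * l2_inner \<Omega> (time_deriv (\<alpha> i) y y' s) (y s)"
    if "i \<in> {1..l}" "\<alpha> i < 1" for i
    using mult_left_mono[OF time_deriv_record_lower_bound[OF \<Omega> y s \<alpha>(1)[OF that(1)] that(2) init latest_max] q[OF that(1)]]
    by (simp add: mult.assoc)
  show ?thesis
  proof (cases "\<alpha> 1 < 1")
    case True
    have "\<alpha> i < 1" if "i \<in> {1..l}" for i using \<alpha>(2)[of i] True that by (cases "i = 1") auto
    then have "(\<Sum>i=1..l. q i s * s powr (- \<alpha> i) / Gamma (1 - \<alpha> i) * ?w)
        \<le> (\<Sum>i=1..l. q i s * l2_inner \<Omega> (time_deriv (\<alpha> i) y y' s) (y s))"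
      by (intro sum_mono frac) auto
    then show ?thesis using True by (simp add: R0_def distrib_right sum_distrib_right)
  next
    case False
    have "(\<Sum>i=2..l. q i s * s powr (- \<alpha> i) / Gamma (1 - \<alpha> i) * ?w)
        \<le> (\<Sum>i=2..l. q i s * l2_inner \<Omega> (time_deriv (\<alpha> i) y y' s) (y s))"
      using \<alpha>(2) by (intro sum_mono frac) auto
    moreover have "(\<Sum>i=1..l. q i s * l2_inner \<Omega> (time_deriv (\<alpha> i) y y' s) (y s))
        = q 1 s * l2_inner \<Omega> (time_deriv (\<alpha> 1) y y' s) (y s) + (\<Sum>i=2..l. q i s * l2_inner \<Omega> (time_deriv (\<alpha> i) y y' s) (y s))"
      using sum.atLeast_Suc_atMost[OF l] by (simp add: numeral_2_eq_2)
    moreover have "time_deriv (\<alpha> 1) y y' s = y' s" using False by (simp add: time_deriv_def fun_eq_iff)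
    ultimately show ?thesis using False by (simp add: R0_def distrib_right sum_distrib_right)
  qed
qed

text \<open>
  All summands of \<open>R0\<close> are nonnegative, so if \<open>R0\<close> vanishes, then so do all coefficients of fractional terms.
  As the coefficients have a positive sum, there must be a term of order \<open>1\<close>, with a positive coefficient.
\<close>

lemma R0_eq_0_imp_time_derivative_term:
  fixes \<alpha> :: "nat \<Rightarrow> real" and q :: "nat \<Rightarrow> real \<Rightarrow> real" and l :: nat
  assumes l: "l \<ge> 1" and \<alpha>: "\<And>i. i \<in> {2..l} \<Longrightarrow> \<alpha> i < 1"
    and q: "\<And>i. i \<in> {1..l} \<Longrightarrow> 0 \<le> q i s" "(\<Sum>i=1..l. q i s) > 0" and "lam \<ge> 0" "s > 0"
  shows "R0 l \<alpha> q lam s \<ge> 0" "R0 l \<alpha> q lam s = 0 \<Longrightarrow> \<not> \<alpha> 1 < 1 \<and> q 1 s > 0"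
proof -
  define j where "j = (if \<alpha> 1 < 1 then 1 else 2 :: nat)"
  have lt: "\<alpha> i < 1" if "i \<in> {j..l}" for i
    using that \<alpha>[of i] by (cases "i = 1") (auto simp: j_def split: if_splits)
  have nonneg: "0 \<le> q i s * s powr (- \<alpha> i) / Gamma (1 - \<alpha> i)" if "i \<in> {j..l}" for i
    using that lt[OF that] q(1)[of i] by (auto simp: j_def intro!: divide_nonneg_nonneg less_imp_le[OF Gamma_real_pos] split: if_splits)
  have R0: "R0 l \<alpha> q lam s = lam + (\<Sum>i=j..l. q i s * s powr (- \<alpha> i) / Gamma (1 - \<alpha> i))"
    by (simp add: R0_def j_def)
  have sum0: "0 \<le> (\<Sum>i=j..l. q i s * s powr (- \<alpha> i) / Gamma (1 - \<alpha> i))"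
    by (intro sum_nonneg nonneg)
  show "R0 l \<alpha> q lam s \<ge> 0" using R0 \<open>lam \<ge> 0\<close> sum0 by linarith
  assume "R0 l \<alpha> q lam s = 0"
  then have "(\<Sum>i=j..l. q i s * s powr (- \<alpha> i) / Gamma (1 - \<alpha> i)) = 0"
    using R0 \<open>lam \<ge> 0\<close> sum0 by linarith
  then have "\<forall>i\<in>{j..l}. q i s * s powr (- \<alpha> i) / Gamma (1 - \<alpha> i) = 0"
    using nonneg by (subst (asm) sum_nonneg_eq_0_iff) auto
  moreover have "Gamma (1 - \<alpha> i) > 0" if "i \<in> {j..l}" for i using lt[OF that] by (intro Gamma_real_pos) simp
  ultimately have q0: "q i s = 0" if "i \<in> {j..l}" for i using that \<open>s > 0\<close> by force
  have "\<not> \<alpha> 1 < 1"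
  proof
    assume "\<alpha> 1 < 1"
    then have "(\<Sum>i=1..l. q i s) = 0" using q0 by (intro sum.neutral) (auto simp: j_def)
    with q(2) show False by simp
  qed
  moreover have "(\<Sum>i=1..l. q i s) = q 1 s + (\<Sum>i=2..l. q i s)"
    using sum.atLeast_Suc_atMost[OF l] by (simp add: numeral_2_eq_2)
  ultimately show "\<not> \<alpha> 1 < 1 \<and> q 1 s > 0" using q0 q(2) by (simp add: j_def)
qed

theorem corollary3p3:
  fixes \<Omega> :: "(real ^ 'd::finite) set" and T lam :: real
    and l :: nat and \<alpha> :: "nat \<Rightarrow> real" and q :: "nat \<Rightarrow> real \<Rightarrow> real"
    and L :: "'d elliptic_operator"
    and f u u' u\<^sub>h u\<^sub>h' :: "real \<Rightarrow> real ^ 'd \<Rightarrow> real" and u\<^sub>0 :: "real ^ 'd \<Rightarrow> real"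
  assumes dim: "CARD('d) \<in> {1, 2, 3}"
    and domain: "bounded \<Omega>" "lipschitz_domain \<Omega>"
    and T: "T > 0"
    and l: "l \<ge> 1"
    and \<alpha>: "0 < \<alpha> l" "\<And>i j. 1 \<le> i \<Longrightarrow> i < j \<Longrightarrow> j \<le> l \<Longrightarrow> \<alpha> j < \<alpha> i" "\<alpha> 1 \<le> 1"
    and q: "\<And>i. i \<in> {1..l} \<Longrightarrow> continuous_on {0..T} (q i)"
      "\<And>i t. i \<in> {1..l} \<Longrightarrow> t \<in> {0..T} \<Longrightarrow> q i t \<ge> 0"
      "\<And>t. t \<in> {0..T} \<Longrightarrow> (\<Sum>i=1..l. q i t) > 0"
    and L: "elliptic \<Omega> L"
    and f: "\<And>t. t \<in> {0<..T} \<Longrightarrow> locally_integrable \<Omega> (f t)"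
    and lam: "lam \<ge> 0" "\<And>r. r \<in> H10 \<Omega> \<Longrightarrow> pairing \<Omega> L r r \<ge> lam * (l2_norm \<Omega> r)\<^sup>2"
    and solution: "is_solution \<Omega> T l \<alpha> q L f u\<^sub>0 u u'"
    and unique: "\<And>w w' t. is_solution \<Omega> T l \<alpha> q L f u\<^sub>0 w w' \<Longrightarrow> t \<in> {0..T} \<Longrightarrow>
                   AE x in lebesgue_on \<Omega>. w t x = u t x"
    and approx: "regular \<Omega> T u\<^sub>h u\<^sub>h'"
    and init: "AE x in lebesgue_on \<Omega>. u\<^sub>h 0 x = u 0 x"
    and t: "t \<in> {0<..T}"
  shows "ennreal (l2_norm \<Omega> (\<lambda>x. u\<^sub>h t x - u t x))
         \<le> (SUP s\<in>{0<..t}. distr_l2_norm \<Omega> (residual \<Omega> l \<alpha> q L f u\<^sub>h u\<^sub>h' s) / ennreal (R0 l \<alpha> q lam s))"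
proof (rule ccontr)
  let ?S = "SUP s\<in>{0<..t}. distr_l2_norm \<Omega> (residual \<Omega> l \<alpha> q L f u\<^sub>h u\<^sub>h' s) / ennreal (R0 l \<alpha> q lam s)"
  define e where "e = (\<lambda>t x. u\<^sub>h t x - u t x)"
  define e' where "e' = (\<lambda>t x. u\<^sub>h' t x - u' t x)"
  define v where "v r = l2_norm \<Omega> (e r)" for r
  assume "\<not> ennreal (l2_norm \<Omega> (\<lambda>x. u\<^sub>h t x - u t x)) \<le> ?S"
  then have "?S < ennreal (v t)" by (simp add: v_def e_def not_le)
  moreover from this obtain M where M: "M \<ge> 0" "?S = ennreal M"
    by (cases ?S) (auto simp: less_top[symmetric])
  ultimately have "M < v t" by (simp add: ennreal_less_iff)
  have \<Omega>: "open \<Omega>" "\<Omega> \<in> lmeasurable"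
    using domain by (auto simp: lipschitz_domain_def intro: lmeasurable_open)
  have reg: "regular \<Omega> T u u'" using solution by (simp add: is_solution_def)
  have wd: "l2_weakly_differentiable \<Omega> T e e'"
    unfolding e_def e'_def
    by (intro weakly_differentiable_diff regular_imp_weakly_differentiable \<Omega> reg approx)
  have eC: "e \<in> C_l2 \<Omega> T" using wd by (simp add: l2_weakly_differentiable_def)
  have \<alpha>pos: "0 < \<alpha> i" if "i \<in> {1..l}" for i
    using \<alpha>(1) \<alpha>(2)[of i l] that by (cases "i = l") force+
  have \<alpha>lt: "\<alpha> i < 1" if "i \<in> {2..l}" for i
    using \<alpha>(2)[of 1 i] \<alpha>(3) that by force
  have contv: "continuous_on {0..T} v"
    unfolding v_def by (rule continuous_on_l2_norm[OF eC])
  have e0: "AE x in lebesgue_on \<Omega>. e 0 x = 0" using init by eventually_elim (simp add: e_def)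
  have v0: "v 0 = 0"
  proof -
    have "v 0 = l2_norm \<Omega> (\<lambda>x. 0)"
      unfolding v_def using T by (intro l2_norm_cong_AE l2_measurable C_l2_l2[OF eC] l2_0 e0) simp
    then show ?thesis by (simp add: l2_norm_def l2_inner_def)
  qed
  \<comment> \<open>From the first time \<open>a\<close> at the level \<open>m\<close> on, all records of \<open>v\<close> on \<open>{a..b}\<close> are records on \<open>{0..b}\<close> and have
    values above \<open>M\<close>. Since \<open>a > 0\<close>, the energy identity is available on \<open>{a..b}\<close>.\<close>
  define m where "m = (M + v t) / 2"
  have m: "M < m" "m < v t" using \<open>M < v t\<close> by (auto simp: m_def)
  obtain a where a: "0 < a" "a \<le> t" "v a = m" "\<And>r. 0 \<le> r \<Longrightarrow> r < a \<Longrightarrow> v r < m"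
    using first_time_at_level[of 0 t v m] continuous_on_subset[OF contv, of "{0..t}"] t v0 m M(1) by auto
  obtain b where b: "b \<in> {a..t}" "\<And>r. r \<in> {a..t} \<Longrightarrow> v r \<le> v b"
    using continuous_attains_sup[of "{a..t}" v] continuous_on_subset[OF contv, of "{a..t}"] a t by auto
  have "v a < v b" using b(2)[of t] a m by auto
  have abT: "0 < a" "a \<le> b" "b \<le> T" using a b t by auto
  have "\<exists>s\<in>{a..b}. (\<forall>r\<in>{a..s}. (v r)\<^sup>2 \<le> (v s)\<^sup>2) \<and> 0 < 2 * l2_inner \<Omega> (e' s) (e s)"
  proof (rule increasing_record)
    show "continuous_on {a..b} (\<lambda>r. (v r)\<^sup>2)"
      using abT by (intro continuous_on_power continuous_on_subset[OF contv]) auto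
    show "set_integrable lebesgue {a..b} (\<lambda>r. 2 * l2_inner \<Omega> (e' r) (e r))"
      by (rule energy_identity(1)[OF \<Omega>(2) wd abT])
    show "(v y)\<^sup>2 - (v x)\<^sup>2 = (LINT r:{x..y}|lebesgue. 2 * l2_inner \<Omega> (e' r) (e r))"
      if "a \<le> x" "x \<le> y" "y \<le> b" for x y
      unfolding v_def by (rule energy_identity(2)[OF \<Omega>(2) wd abT that])
    show "(v a)\<^sup>2 < (v b)\<^sup>2"
      using \<open>v a < v b\<close> by (intro power_strict_mono) (auto simp: v_def l2_norm_nonneg)
    show "(v r)\<^sup>2 \<le> (v b)\<^sup>2" if "r \<in> {a..b}" for r
      using b that by (intro power_mono) (auto simp: v_def l2_norm_nonneg)
  qed (rule abT)
  then obtain s where s: "s \<in> {a..b}" "\<And>r. r \<in> {a..s} \<Longrightarrow> (v r)\<^sup>2 \<le> (v s)\<^sup>2" "0 < l2_inner \<Omega> (e' s) (e s)"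
    by auto
  have v_max: "v r \<le> v s" if "r \<in> {a..s}" for r
    using s(2)[OF that] by (rule power2_le_imp_le) (simp add: v_def l2_norm_nonneg)
  have "m \<le> v s" using v_max[of a] a(3) s(1) by simp
  then have "M < v s" "0 < v s" using m M(1) by auto
  have latest: "v r \<le> v s" if "r \<in> {0..s}" for r
  proof (cases "r < a")
    case True
    then show ?thesis using a(4)[of r] that \<open>m \<le> v s\<close> by simp
  qed (use v_max that in auto)
  have sT: "s \<in> {0<..T}" "s \<in> {0..T}" "s \<in> {0<..t}" using s(1) a b t by auto
  define P where "P = (if \<alpha> 1 < 1 then 0 else q 1 s * l2_inner \<Omega> (e' s) (e s))"
  define R where "R = R0 l \<alpha> q lam s"
  have qs: "0 \<le> q i s" if "i \<in> {1..l}" for i using q(2)[OF that] sT by simp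
  have "P \<ge> 0" using qs[of 1] l s(3) by (simp add: P_def)
  have R: "R \<ge> 0" "R = 0 \<Longrightarrow> P > 0"
    using R0_eq_0_imp_time_derivative_term[of l \<alpha> q s lam, OF l \<alpha>lt qs q(3)[OF sT(2)] lam(1)] sT(1) s(3)
    by (auto simp: R_def P_def)
  let ?D = "distr_l2_norm \<Omega> (residual \<Omega> l \<alpha> q L f u\<^sub>h u\<^sub>h' s)"
  have D: "ennreal (R * v s + P / v s) \<le> ?D"
    unfolding distr_l2_norm_def
  proof (intro INF_greatest ennreal_leI)
    fix g assume "g \<in> {g \<in> l2 \<Omega>. \<forall>\<phi>\<in>test_functions \<Omega>. residual \<Omega> l \<alpha> q L f u\<^sub>h u\<^sub>h' s \<phi> = l2_inner \<Omega> g \<phi>}"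
    then have g: "g \<in> l2 \<Omega>" "\<And>\<phi>. \<phi> \<in> test_functions \<Omega> \<Longrightarrow> residual \<Omega> l \<alpha> q L f u\<^sub>h u\<^sub>h' s \<phi> = l2_inner \<Omega> g \<phi>"
      by auto
    have "R * (v s)\<^sup>2 + P \<le> (\<Sum>i=1..l. q i s * l2_inner \<Omega> (time_deriv (\<alpha> i) e e' s) (e s)) + lam * (v s)\<^sup>2"
      unfolding R_def P_def v_def
      by (rule error_lower_bound_at_record[where \<alpha> = \<alpha> and q = q, OF \<Omega>(2) wd sT(1) l \<alpha>pos \<alpha>lt \<alpha>(3) qs e0 latest[unfolded v_def]])
    also have "\<dots> \<le> l2_norm \<Omega> g * v s"
      unfolding v_def e_def e'_def
      by (rule error_energy_inequality[where \<alpha> = \<alpha> and q = q, OF \<Omega> L lam(2) reg approx sT(1) \<alpha>pos _ g])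
        (use solution sT in \<open>auto simp: is_solution_def\<close>)
    also have "R * (v s)\<^sup>2 + P = (R * v s + P / v s) * v s"
      using \<open>0 < v s\<close> by (simp add: power2_eq_square distrib_right)
    finally have "(R * v s + P / v s) * v s \<le> l2_norm \<Omega> g * v s" .
    then show "R * v s + P / v s \<le> l2_norm \<Omega> g" using \<open>0 < v s\<close> by simp
  qed
  have "?D / ennreal R \<le> ?S" unfolding R_def using sT(3) by (rule SUP_upper)
  then have DM: "?D / ennreal R \<le> ennreal M" using M(2) by simp
  show False
  proof (cases "R = 0")
    case True
    then have "0 < ennreal (P / v s)" using R(2) \<open>0 < v s\<close> by simp
    also have "\<dots> \<le> ?D" using D True by simp
    finally show False using DM True by (simp add: ennreal_quotient_by_zero top_unique split: if_splits)
  next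
    case False
    then have "R > 0" using R(1) by simp
    have "ennreal ((R * v s + P / v s) / R) = ennreal (R * v s + P / v s) / ennreal R"
      using \<open>R > 0\<close> \<open>P \<ge> 0\<close> \<open>0 < v s\<close> by (intro divide_ennreal[symmetric]) auto
    also have "\<dots> \<le> ?D / ennreal R" using D by (rule divide_right_mono_ennreal)
    also have "\<dots> \<le> ennreal M" by (rule DM)
    finally have "(R * v s + P / v s) / R \<le> M" using M(1) by (simp add: ennreal_le_iff)
    moreover have "v s \<le> (R * v s + P / v s) / R"
      using \<open>R > 0\<close> \<open>P \<ge> 0\<close> \<open>0 < v s\<close> by (simp add: field_simps)
    ultimately show False using \<open>M < v s\<close> by simp
  qed
qed

end
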